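(* Let $A$ and $B$ be unital $C^*$-algebras with one of them different from a matrix algebra. Then a mapping $\theta: A\otimes^\gamma B\to A\otimes^\gamma B$ is an isometric outer $*$-automorphism if and only if either $\theta=\phi\otimes^\gamma\psi$, where $\phi$ is a $*$-automorphism of $A$ and $\psi$ is a $*$-automorphism of $B$ with at least one of $\phi,\psi$ being outer, or $\theta=(\mu\otimes^\gamma\rho)\circ\tau$, where $\mu: B\to A$ and $\rho: A\to B$ are $*$-isomorphisms and $\tau: A\otimes^\gamma B\to B\otimes^\gamma A$ is the flip map $\tau(x\otimes y)=y\otimes x$.
   Context: For Banach spaces $X, Y$, $X\otimes^\gamma Y$ denotes the Banach space projective tensor product, i.e. the completion of the algebraic tensor product $X\otimes Y$ in the norm $\|u\| = \inf\{\sum_{i=1}^n \|x_i\|\|y_i\| : u=\sum_{i=1}^n x_i\otimes y_i\}$. For $C^*$-algebras $A,B$, $A\otimes^\gamma B$ is a Banach $*$-algebra with $(a\otimes b)(c\otimes d)=ac\otimes bd$ and $(a\otimes b)^*=a^*\otimes b^*$. A $*$-automorphism $\theta$ of a unital Banach $*$-algebra $D$ is inner if there is a unitary $u\in D$ (i.e. $uu^*=u^*u=1$) with $\theta(x)=uxu^*$ for all $x\in D$; it is outer if it is not inner. A matrix algebra is a $C^*$-algebra $*$-isomorphic to $M_n(\mathbb{C})$ for some $n\in\mathbb{N}$; the hypothesis means that at least one of $A$, $B$ is not a matrix algebra. For $*$-isomorphisms $\phi_i: A_i\to B_i$ ($i=1,2$) of $C^*$-algebras, $\phi_1\otimes^\gamma\phi_2: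 A_1\otimes^\gamma A_2\to B_1\otimes^\gamma B_2$ denotes the unique continuous linear extension of $x\otimes y\mapsto\phi_1(x)\otimes\phi_2(y)$; $\tau$ is likewise the continuous linear extension of the given formula. *)

theory Defs
  imports Complex_Main "Jordan_Normal_Form.Schur_Decomposition"
begin

section \<open>Complex normed spaces, Banach *-algebras and C*-algebras\<close>

class scaleC =
  fixes scaleC :: "complex \<Rightarrow> 'a \<Rightarrow> 'a"  (infixr "*\<^sub>C" 75)

class complex_vector = scaleC + ab_group_add +
  assumes scaleC_add_right: "c *\<^sub>C (x + y) = c *\<^sub>C x + c *\<^sub>C y"
    and scaleC_add_left: "(c + d) *\<^sub>C x = c *\<^sub>C x + d *\<^sub>C x"
    and scaleC_scaleC: "c *\<^sub>C d *\<^sub>C x = (c * d) *\<^sub>C x"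
    and scaleC_one: "1 *\<^sub>C x = x"

class complex_normed_vector = complex_vector + real_normed_vector +
  assumes scaleR_scaleC: "scaleR r x = complex_of_real r *\<^sub>C x"
    and norm_scaleC: "norm (c *\<^sub>C x) = cmod c * norm x"

class unital_star_algebra = complex_vector + ring + monoid_mult +
  fixes star :: "'a \<Rightarrow> 'a"
  assumes mult_scaleC_left: "(c *\<^sub>C x) * y = c *\<^sub>C (x * y)"
    and mult_scaleC_right: "x * (c *\<^sub>C y) = c *\<^sub>C (x * y)"
    and star_add: "star (x + y) = star x + star y"
    and star_scaleC: "star (c *\<^sub>C x) = cnj c *\<^sub>C star x"
    and star_mult: "star (x * y) = star y * star x"
    and star_star: "star (star x) = x"

class unital_banach_star_algebra =
  unital_star_algebra + complex_normed_vector + real_normed_algebra + banach +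
  assumes norm_star: "norm (star x) = norm x"

text \<open>As usual for unital algebras, the zero algebra is excluded. Submultiplicativity and
  completeness of the norm are inherited; \<open>norm 1 = 1\<close> follows from the C*-identity
  (\<open>cstar_norm_one\<close> below).\<close>

class unital_cstar_algebra = unital_banach_star_algebra + zero_neq_one +
  assumes norm_star_mult_self: "norm (star x * x) = (norm x)\<^sup>2"

definition clinear :: "('a::complex_vector \<Rightarrow> 'b::complex_vector) \<Rightarrow> bool" where
  "clinear f \<longleftrightarrow> (\<forall>x y. f (x + y) = f x + f y) \<and> (\<forall>c x. f (c *\<^sub>C x) = c *\<^sub>C f x)"

definition star_isomorphism :: "('a::unital_star_algebra \<Rightarrow> 'b::unital_star_algebra) \<Rightarrow> bool" where
  "star_isomorphism f \<longleftrightarrow>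
     bij f \<and> clinear f \<and> (\<forall>x y. f (x * y) = f x * f y) \<and> (\<forall>x. f (star x) = star (f x))"

abbreviation star_automorphism :: "('a::unital_star_algebra \<Rightarrow> 'a) \<Rightarrow> bool" where
  "star_automorphism f \<equiv> star_isomorphism f"

definition unitary :: "'a::unital_star_algebra \<Rightarrow> bool" where
  "unitary u \<longleftrightarrow> u * star u = 1 \<and> star u * u = 1"

definition inner_map :: "('a::unital_star_algebra \<Rightarrow> 'a) \<Rightarrow> bool" where
  "inner_map f \<longleftrightarrow> (\<exists>u. unitary u \<and> (\<forall>x. f x = u * x * star u))"

abbreviation outer_map :: "('a::unital_star_algebra \<Rightarrow> 'a) \<Rightarrow> bool" where
  "outer_map f \<equiv> \<not> inner_map f"

definition matrix_algebra :: "'a::unital_cstar_algebra itself \<Rightarrow> bool" where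
  "matrix_algebra _ \<longleftrightarrow> (\<exists>n>0. \<exists>f :: 'a \<Rightarrow> complex mat.
     bij_betw f UNIV (carrier_mat n n) \<and>
     (\<forall>x y. f (x + y) = f x + f y) \<and> (\<forall>c x. f (c *\<^sub>C x) = c \<cdot>\<^sub>m f x) \<and>
     (\<forall>x y. f (x * y) = f x * f y) \<and> (\<forall>x. f (star x) = mat_adjoint (f x)))"

lemma scaleC_zero_right [simp]: "c *\<^sub>C 0 = (0 :: 'a::complex_vector)"
  using scaleC_add_right[of c 0 "0::'a"] by simp

lemma scaleC_zero_left [simp]: "0 *\<^sub>C x = (0 :: 'a::complex_vector)"
  using scaleC_add_left[of 0 0 x] by simp

lemma scaleC_minus_right: "c *\<^sub>C (- x) = - (c *\<^sub>C (x::'a::complex_vector))"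
  using scaleC_add_right[of c x "- x"] by (simp add: eq_neg_iff_add_eq_0 add.commute)

lemma scaleC_diff_right: "c *\<^sub>C (x - y) = c *\<^sub>C x - c *\<^sub>C (y::'a::complex_vector)"
  using scaleC_add_right[of c x "- y"] by (simp add: scaleC_minus_right)

lemma scaleC_minus_one: "(- 1) *\<^sub>C x = - (x::'a::complex_vector)"
  using scaleC_add_left[of 1 "-1" x] by (simp add: scaleC_one eq_neg_iff_add_eq_0 add.commute)

lemma star_zero [simp]: "star 0 = (0::'a::unital_star_algebra)"
  using star_add[of 0 "0::'a"] by simp

lemma star_diff: "star (x - y) = star x - star (y::'a::unital_star_algebra)"
  using star_add[of "x - y" y] by (simp add: algebra_simps)

lemma star_one [simp]: "star 1 = (1::'a::unital_star_algebra)"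
  by (metis mult_1_left mult_1_right star_mult star_star)

lemma cstar_norm_one: "norm (1::'a::unital_cstar_algebra) = 1"
  using norm_star_mult_self[of "1::'a"] by (simp add: power2_eq_square)

instantiation complex :: unital_cstar_algebra
begin

definition scaleC_complex :: "complex \<Rightarrow> complex \<Rightarrow> complex" where "scaleC_complex = (*)"

definition star_complex :: "complex \<Rightarrow> complex" where "star_complex = cnj"

instance
  by standard
    (auto simp: scaleC_complex_def star_complex_def algebra_simps norm_mult power2_eq_square
      scaleR_conv_of_real)

end


section \<open>The algebraic tensor product\<close>

text \<open>A list of pairs \<open>(x\<^sub>1, y\<^sub>1), \<dots>, (x\<^sub>n, y\<^sub>n)\<close> stands for the formal sum of the
  \<open>x\<^sub>i \<otimes> y\<^sub>i\<close>; the algebraic tensor product over the complex numbers is the quotient by the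
  congruence generated by the bilinearity relations.\<close>

inductive tensor_eq ::
  "('a::complex_vector \<times> 'b::complex_vector) list \<Rightarrow> ('a \<times> 'b) list \<Rightarrow> bool" where
  refl: "tensor_eq u u"
| sym: "tensor_eq u v \<Longrightarrow> tensor_eq v u"
| trans: "tensor_eq u v \<Longrightarrow> tensor_eq v w \<Longrightarrow> tensor_eq u w"
| append: "tensor_eq u u' \<Longrightarrow> tensor_eq v v' \<Longrightarrow> tensor_eq (u @ v) (u' @ v')"
| commute: "tensor_eq (u @ v) (v @ u)"
| zero: "tensor_eq [(0, y)] []"
| add_left: "tensor_eq [(x + x', y)] [(x, y), (x', y)]"
| add_right: "tensor_eq [(x, y + y')] [(x, y), (x, y')]"
| scale: "tensor_eq [(c *\<^sub>C x, y)] [(x, c *\<^sub>C y)]"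

quotient_type (overloaded) ('a, 'b) tensor =
  "('a::complex_vector \<times> 'b::complex_vector) list" / tensor_eq
  morphisms rep_tensor formal_sum
  by (intro equivpI reflpI sympI transpI) (blast intro: tensor_eq.intros)+

lemma formal_sum_eq_iff: "formal_sum u = formal_sum v \<longleftrightarrow> tensor_eq u v"
  using tensor.abs_eq_iff .

lemma ex_formal_sum: "\<exists>l. t = formal_sum l"
  by (metis Quotient3_abs_rep Quotient3_tensor)

definition pure_tensor :: "'a::complex_vector \<Rightarrow> 'b::complex_vector \<Rightarrow> ('a, 'b) tensor" where
  "pure_tensor x y = formal_sum [(x, y)]"

lemma tensor_eq_uminus:
  "tensor_eq u v \<Longrightarrow> tensor_eq (map (\<lambda>(x, y). (- x, y)) u) (map (\<lambda>(x, y). (- x, y)) v)"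
proof (induction rule: tensor_eq.induct)
  case (scale c x y)
  then show ?case using tensor_eq.scale[of c "- x" y] by (simp add: scaleC_minus_right)
next
  case (add_left x x' y)
  then show ?case using tensor_eq.add_left[of "- x" "- x'" y] by simp
next
  case (add_right x y y')
  then show ?case using tensor_eq.add_right[of "- x" y y'] by simp
qed (auto intro: tensor_eq.intros)

lemma tensor_eq_cancel: "tensor_eq (map (\<lambda>(x, y). (- x, y)) u @ u) []"
proof (induction u)
  case Nil
  then show ?case by (simp add: tensor_eq.refl)
next
  case (Cons p u)
  obtain x y where p: "p = (x, y)" by (cases p)
  let ?n = "map (\<lambda>(x, y). (- x, y))"
  have 1: "tensor_eq [(- x, y), (x, y)] []"
    using tensor_eq.trans[OF tensor_eq.sym[OF tensor_eq.add_left[of "- x" x y]], of "[]"]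
    by (simp add: tensor_eq.zero)
  have "tensor_eq ([(- x, y)] @ (?n u @ [(x, y)]) @ u) ([(- x, y)] @ ([(x, y)] @ ?n u) @ u)"
    by (intro tensor_eq.append tensor_eq.refl tensor_eq.commute)
  moreover have "tensor_eq ([(- x, y), (x, y)] @ (?n u @ u)) ([] @ [])"
    by (intro tensor_eq.append 1 Cons)
  ultimately show ?case
    using tensor_eq.trans by (fastforce simp: p)
qed

instantiation tensor :: (complex_vector, complex_vector) ab_group_add
begin

lift_definition zero_tensor :: "('a, 'b) tensor" is "[]" .

lift_definition plus_tensor :: "('a, 'b) tensor \<Rightarrow> ('a, 'b) tensor \<Rightarrow> ('a, 'b) tensor" is "(@)"
  by (rule tensor_eq.append)

lift_definition uminus_tensor :: "('a, 'b) tensor \<Rightarrow> ('a, 'b) tensor" is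
  "map (\<lambda>(x, y). (- x, y))"
  by (rule tensor_eq_uminus)

definition minus_tensor :: "('a, 'b) tensor \<Rightarrow> ('a, 'b) tensor \<Rightarrow> ('a, 'b) tensor" where
  "minus_tensor u v = u + - v"

instance
proof
  fix a b c :: "('a, 'b) tensor"
  show "a + b + c = a + (b + c)" by transfer (simp add: tensor_eq.refl)
  show "a + b = b + a" by transfer (rule tensor_eq.commute)
  show "0 + a = a" by transfer (simp add: tensor_eq.refl)
  show "- a + a = 0" by transfer (rule tensor_eq_cancel)
  show "a - b = a + - b" by (rule minus_tensor_def)
qed

end

lemma formal_sum_append: "formal_sum (u @ v) = formal_sum u + formal_sum v"
  by (simp add: plus_tensor.abs_eq)

lemma formal_sum_Nil: "formal_sum [] = 0"
  by (simp add: zero_tensor.abs_eq)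

lemma formal_sum_Cons: "formal_sum ((x, y) # u) = pure_tensor x y + formal_sum u"
  using formal_sum_append[of "[(x, y)]" u] by (simp add: pure_tensor_def)

lemma formal_sum_eq_sum_list: "formal_sum l = (\<Sum>(x, y)\<leftarrow>l. pure_tensor x y)"
  by (induction l) (auto simp: formal_sum_Nil formal_sum_Cons)

lemma pure_tensor_add_left: "pure_tensor (x + x') y = pure_tensor x y + pure_tensor x' y"
  unfolding pure_tensor_def formal_sum_append[symmetric] formal_sum_eq_iff
  using tensor_eq.add_left by simp

lemma pure_tensor_add_right: "pure_tensor x (y + y') = pure_tensor x y + pure_tensor x y'"
  unfolding pure_tensor_def formal_sum_append[symmetric] formal_sum_eq_iff
  using tensor_eq.add_right by simp

lemma pure_tensor_scale: "pure_tensor (c *\<^sub>C x) y = pure_tensor x (c *\<^sub>C y)"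
  unfolding pure_tensor_def formal_sum_eq_iff by (rule tensor_eq.scale)

lemma tensor_induct [case_names zero add]:
  assumes "P 0" "\<And>x y t. P t \<Longrightarrow> P (pure_tensor x y + t)"
  shows "P t"
proof -
  have "P (formal_sum l)" for l
    by (induction l) (auto simp: formal_sum_Nil formal_sum_Cons assms)
  then show ?thesis using ex_formal_sum by metis
qed

definition balanced ::
  "('a::complex_vector \<Rightarrow> 'b::complex_vector \<Rightarrow> 'c::ab_group_add) \<Rightarrow> bool" where
  "balanced f \<longleftrightarrow>
     (\<forall>x x' y. f (x + x') y = f x y + f x' y) \<and>
     (\<forall>x y y'. f x (y + y') = f x y + f x y') \<and>
     (\<forall>c x y. f (c *\<^sub>C x) y = f x (c *\<^sub>C y))"

text \<open>The additive map induced by a balanced map; independent of the representative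
  when \<open>f\<close> is balanced.\<close>

definition tensor_lift ::
  "('a::complex_vector \<Rightarrow> 'b::complex_vector \<Rightarrow> 'c::ab_group_add) \<Rightarrow> ('a, 'b) tensor \<Rightarrow> 'c" where
  "tensor_lift f t = (\<Sum>(x, y)\<leftarrow>rep_tensor t. f x y)"

lemma tensor_eq_sum_list:
  assumes "balanced f" "tensor_eq u v"
  shows "(\<Sum>(x, y)\<leftarrow>u. f x y) = (\<Sum>(x, y)\<leftarrow>v. f x y)"
  using assms(2)
proof (induction rule: tensor_eq.induct)
  case (zero y)
  have "f (0 + 0) y = f 0 y + f 0 y" using assms(1) unfolding balanced_def by blast
  then show ?case by simp
qed (use assms(1) in \<open>auto simp: balanced_def add.commute\<close>)

lemma tensor_lift_formal_sum:
  assumes "balanced f"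
  shows "tensor_lift f (formal_sum l) = (\<Sum>(x, y)\<leftarrow>l. f x y)"
  unfolding tensor_lift_def
  by (rule tensor_eq_sum_list[OF assms])
    (metis Quotient3_abs_rep Quotient3_tensor formal_sum_eq_iff)

lemma tensor_lift_zero: "balanced f \<Longrightarrow> tensor_lift f 0 = 0"
  by (simp add: tensor_lift_formal_sum flip: formal_sum_Nil)

lemma tensor_lift_pure: "balanced f \<Longrightarrow> tensor_lift f (pure_tensor x y) = f x y"
  by (simp add: pure_tensor_def tensor_lift_formal_sum)

lemma tensor_lift_add:
  assumes "balanced f"
  shows "tensor_lift f (s + t) = tensor_lift f s + tensor_lift f t"
proof -
  obtain k l where "s = formal_sum k" "t = formal_sum l" using ex_formal_sum by metis
  then show ?thesis using assms by (simp add: tensor_lift_formal_sum flip: formal_sum_append)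
qed

lemma tensor_additive_eqI:
  fixes F G :: "('a::complex_vector, 'b::complex_vector) tensor \<Rightarrow> 'c::ab_group_add"
  assumes "\<And>s t. F (s + t) = F s + F t" "\<And>s t. G (s + t) = G s + G t"
    and "\<And>x y. F (pure_tensor x y) = G (pure_tensor x y)"
  shows "F t = G t"
proof (induction t rule: tensor_induct)
  case zero
  show ?case using assms(1)[of 0 0] assms(2)[of 0 0] by simp
qed (simp add: assms)

definition scale_pure :: "complex \<Rightarrow> 'a::complex_vector \<Rightarrow> 'b::complex_vector \<Rightarrow> ('a, 'b) tensor"
  where "scale_pure c x y = pure_tensor (c *\<^sub>C x) y"

lemma balanced_scale_pure: "balanced (scale_pure c)"
  unfolding balanced_def scale_pure_def
  by (simp add: scaleC_add_right pure_tensor_add_left pure_tensor_add_right scaleC_scaleC mult.commute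
      flip: pure_tensor_scale)

instantiation tensor :: (complex_vector, complex_vector) complex_vector
begin

definition scaleC_tensor :: "complex \<Rightarrow> ('a, 'b) tensor \<Rightarrow> ('a, 'b) tensor" where
  "scaleC_tensor c = tensor_lift (scale_pure c)"

lemma scaleC_pure_tensor: "c *\<^sub>C pure_tensor x y = pure_tensor (c *\<^sub>C x) (y :: 'b)"
  by (simp add: scaleC_tensor_def tensor_lift_pure[OF balanced_scale_pure] scale_pure_def)

lemma scaleC_tensor_add: "c *\<^sub>C (s + t) = c *\<^sub>C s + c *\<^sub>C (t :: ('a, 'b) tensor)"
  by (simp add: scaleC_tensor_def tensor_lift_add[OF balanced_scale_pure])

instance
proof
  fix c d and x y :: "('a, 'b) tensor"
  show "c *\<^sub>C (x + y) = c *\<^sub>C x + c *\<^sub>C y" by (rule scaleC_tensor_add)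
  show "(c + d) *\<^sub>C x = c *\<^sub>C x + d *\<^sub>C x"
    by (rule tensor_additive_eqI)
      (simp_all add: scaleC_tensor_add scaleC_pure_tensor scaleC_add_left pure_tensor_add_left)
  show "c *\<^sub>C d *\<^sub>C x = (c * d) *\<^sub>C x"
    by (rule tensor_additive_eqI)
      (simp_all add: scaleC_tensor_add scaleC_pure_tensor scaleC_scaleC)
  show "1 *\<^sub>C x = x"
    by (rule tensor_additive_eqI)
      (simp_all add: scaleC_tensor_add scaleC_pure_tensor scaleC_one)
qed

end

lemma scaleC_pure_tensor_right:
  "c *\<^sub>C pure_tensor x y = pure_tensor x (c *\<^sub>C (y :: 'b::complex_vector))"
  by (simp add: scaleC_pure_tensor pure_tensor_scale)

text \<open>Multiplication \<open>(a \<otimes> b)(c \<otimes> d) = ac \<otimes> bd\<close> and involution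
  \<open>(a \<otimes> b)\<^sup>* = a\<^sup>* \<otimes> b\<^sup>*\<close>. The involution is conjugate-linear in both arguments, which is
  why only balancedness is required of lifted maps.\<close>

definition mult_pure ::
  "'a::unital_star_algebra \<Rightarrow> 'b::unital_star_algebra \<Rightarrow> 'a \<Rightarrow> 'b \<Rightarrow> ('a, 'b) tensor" where
  "mult_pure a b c d = pure_tensor (a * c) (b * d)"

definition star_pure ::
  "'a::unital_star_algebra \<Rightarrow> 'b::unital_star_algebra \<Rightarrow> ('a, 'b) tensor" where
  "star_pure a b = pure_tensor (star a) (star b)"

lemma balanced_mult_pure: "balanced (mult_pure a b)"
  unfolding balanced_def mult_pure_def
  by (simp add: distrib_left pure_tensor_add_left pure_tensor_add_right mult_scaleC_right
      flip: pure_tensor_scale)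

lemma balanced_star_pure: "balanced star_pure"
  unfolding balanced_def star_pure_def
  by (simp add: star_add star_scaleC pure_tensor_add_left pure_tensor_add_right
      flip: pure_tensor_scale)

lemma mult_lift_pure: "tensor_lift (mult_pure a b) (pure_tensor c d) = pure_tensor (a * c) (b * d)"
  unfolding tensor_lift_pure[OF balanced_mult_pure] by (rule mult_pure_def)

lemma balanced_mult_lift: "balanced (\<lambda>a b. tensor_lift (mult_pure a b) t)"
  unfolding balanced_def
proof (intro conjI allI)
  note simps = tensor_lift_add[OF balanced_mult_pure] mult_lift_pure
  fix a a' b b' c
  show "tensor_lift (mult_pure (a + a') b) t = tensor_lift (mult_pure a b) t + tensor_lift (mult_pure a' b) t"
    by (rule tensor_additive_eqI[where t = t])
      (simp_all add: simps distrib_right pure_tensor_add_left)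
  show "tensor_lift (mult_pure a (b + b')) t = tensor_lift (mult_pure a b) t + tensor_lift (mult_pure a b') t"
    by (rule tensor_additive_eqI[where t = t])
      (simp_all add: simps distrib_right pure_tensor_add_right)
  show "tensor_lift (mult_pure (c *\<^sub>C a) b) t = tensor_lift (mult_pure a (c *\<^sub>C b)) t"
    by (rule tensor_additive_eqI[where t = t])
      (simp_all add: simps mult_scaleC_left pure_tensor_scale)
qed

instantiation tensor :: (unital_star_algebra, unital_star_algebra) unital_star_algebra
begin

definition one_tensor :: "('a, 'b) tensor" where
  "one_tensor = pure_tensor 1 1"

definition times_tensor :: "('a, 'b) tensor \<Rightarrow> ('a, 'b) tensor \<Rightarrow> ('a, 'b) tensor" where
  "times_tensor s t = tensor_lift (\<lambda>a b. tensor_lift (mult_pure a b) t) s"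

definition star_tensor :: "('a, 'b) tensor \<Rightarrow> ('a, 'b) tensor" where
  "star_tensor = tensor_lift star_pure"

lemma pure_tensor_times: "pure_tensor a b * t = tensor_lift (mult_pure a b) (t :: ('a, 'b) tensor)"
  unfolding times_tensor_def tensor_lift_pure[OF balanced_mult_lift] ..

lemma times_tensor_add_left: "(s + s') * t = s * t + s' * (t :: ('a, 'b) tensor)"
  by (simp add: times_tensor_def tensor_lift_add[OF balanced_mult_lift])

lemma times_tensor_add_right: "s * (t + t') = s * t + s * (t' :: ('a, 'b) tensor)"
proof (rule tensor_additive_eqI[where t = s])
  fix s s' and a :: 'a and b :: 'b
  show "pure_tensor a b * (t + t') = pure_tensor a b * t + pure_tensor a b * t'"
    unfolding pure_tensor_times tensor_lift_add[OF balanced_mult_pure] ..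
qed (simp_all add: times_tensor_add_left)

lemma times_pure_tensor:
  "pure_tensor a b * pure_tensor c d = pure_tensor (a * c :: 'a) (b * d :: 'b)"
  unfolding pure_tensor_times by (rule mult_lift_pure)

lemma star_tensor_add: "star (s + t) = star s + star (t :: ('a, 'b) tensor)"
  by (simp add: star_tensor_def tensor_lift_add[OF balanced_star_pure])

lemma star_pure_tensor: "star (pure_tensor a b) = pure_tensor (star a :: 'a) (star b :: 'b)"
  by (simp add: star_tensor_def tensor_lift_pure[OF balanced_star_pure] star_pure_def)

instance
proof
  note simps = times_tensor_add_left times_tensor_add_right times_pure_tensor
    star_tensor_add star_pure_tensor scaleC_add_right scaleC_pure_tensor
  fix x y z :: "('a, 'b) tensor" and c :: complex
  show "(x + y) * z = x * z + y * z" by (rule times_tensor_add_left)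
  show "x * (y + z) = x * y + x * z" by (rule times_tensor_add_right)
  have pure2: "pure_tensor (a * a') (b * b') * z = pure_tensor a b * (pure_tensor a' b' * z)"
    for a a' :: 'a and b b' :: 'b
    by (rule tensor_additive_eqI[where t = z]) (simp_all add: simps mult.assoc)
  have pure1: "pure_tensor a b * y * z = pure_tensor a b * (y * z)" for a :: 'a and b :: 'b
    by (rule tensor_additive_eqI[where t = y]) (simp_all add: simps pure2)
  show "x * y * z = x * (y * z)"
    by (rule tensor_additive_eqI[where t = x]) (simp_all add: simps pure1)
  show "1 * x = x"
    by (rule tensor_additive_eqI[where t = x]) (simp_all add: simps one_tensor_def)
  show "x * 1 = x"
    by (rule tensor_additive_eqI[where t = x]) (simp_all add: simps one_tensor_def)
  have sl: "(c *\<^sub>C pure_tensor a b) * y = c *\<^sub>C (pure_tensor a b * y)" for a :: 'a and b :: 'b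
    by (rule tensor_additive_eqI[where t = y]) (simp_all add: simps mult_scaleC_left)
  show "(c *\<^sub>C x) * y = c *\<^sub>C (x * y)"
    by (rule tensor_additive_eqI[where t = x]) (simp_all add: simps(1-6) scaleC_add_right sl)
  have sr: "pure_tensor a b * (c *\<^sub>C y) = c *\<^sub>C (pure_tensor a b * y)" for a :: 'a and b :: 'b
    by (rule tensor_additive_eqI[where t = y]) (simp_all add: simps mult_scaleC_right)
  show "x * (c *\<^sub>C y) = c *\<^sub>C (x * y)"
    by (rule tensor_additive_eqI[where t = x]) (simp_all add: simps(1-6) scaleC_add_right sr)
  show "star (x + y) = star x + star y" by (rule star_tensor_add)
  show "star (c *\<^sub>C x) = cnj c *\<^sub>C star x"
    by (rule tensor_additive_eqI[where t = x]) (simp_all add: simps star_scaleC)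
  have sm: "star (pure_tensor a b * y) = star y * star (pure_tensor a b)" for a :: 'a and b :: 'b
    by (rule tensor_additive_eqI[where t = y]) (simp_all add: simps star_mult)
  show "star (x * y) = star y * star x"
    by (rule tensor_additive_eqI[where t = x]) (simp_all add: simps(1-3) star_tensor_add sm)
  show "star (star x) = x"
    by (rule tensor_additive_eqI[where t = x]) (simp_all add: simps star_star)
qed

end



section \<open>The projective norm\<close>

definition sum_norms ::
  "('a::complex_normed_vector \<times> 'b::complex_normed_vector) list \<Rightarrow> real" where
  "sum_norms l = (\<Sum>(x, y)\<leftarrow>l. norm x * norm y)"

definition proj_norm :: "('a::complex_normed_vector, 'b::complex_normed_vector) tensor \<Rightarrow> real"
  where "proj_norm t = (INF l\<in>{l. t = (\<Sum>(x, y)\<leftarrow>l. pure_tensor x y)}. sum_norms l)"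

lemma sum_norms_nonneg: "sum_norms l \<ge> 0"
  unfolding sum_norms_def by (induction l) auto

lemma sum_norms_append: "sum_norms (k @ l) = sum_norms k + sum_norms l"
  by (simp add: sum_norms_def)

lemma bdd_below_sum_norms: "bdd_below (sum_norms ` S)"
  by (rule bdd_belowI[where m = 0]) (auto simp: sum_norms_nonneg)

lemma proj_norm_le: "proj_norm (formal_sum l) \<le> sum_norms l"
  unfolding proj_norm_def formal_sum_eq_sum_list
  by (rule cINF_lower[OF bdd_below_sum_norms]) simp

lemma proj_norm_approx:
  assumes "e > 0"
  shows "\<exists>l. t = formal_sum l \<and> sum_norms l < proj_norm t + e"
proof -
  obtain k where "t = formal_sum k" using ex_formal_sum by metis
  then have "{l. t = (\<Sum>(x, y)\<leftarrow>l. pure_tensor x y)} \<noteq> {}"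
    unfolding formal_sum_eq_sum_list by auto
  from cINF_less_iff[OF this bdd_below_sum_norms, of "proj_norm t + e"] assms
  show ?thesis unfolding formal_sum_eq_sum_list by (auto simp: proj_norm_def)
qed

lemma proj_norm_nonneg [simp]: "proj_norm t \<ge> 0"
proof (rule field_le_epsilon)
  fix e :: real assume "e > 0"
  then obtain l where "t = formal_sum l" "sum_norms l < proj_norm t + e"
    using proj_norm_approx by blast
  then show "0 \<le> proj_norm t + e" using sum_norms_nonneg[of l] by linarith
qed

lemma proj_norm_zero [simp]: "proj_norm 0 = 0"
  by (rule order_antisym) (use proj_norm_le[of "[]"] in \<open>simp_all add: formal_sum_Nil sum_norms_def\<close>)

lemma proj_norm_pure_le: "proj_norm (pure_tensor x y) \<le> norm x * norm y"
  using proj_norm_le[of "[(x, y)]"] by (simp add: sum_norms_def pure_tensor_def)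

lemma proj_norm_add: "proj_norm (s + t) \<le> proj_norm s + proj_norm t"
proof (rule field_le_epsilon)
  fix e :: real assume "e > 0"
  then have e2: "e / 2 > 0" by simp
  obtain k l where "s = formal_sum k" "sum_norms k < proj_norm s + e / 2"
    "t = formal_sum l" "sum_norms l < proj_norm t + e / 2"
    using proj_norm_approx[OF e2] by metis
  then show "proj_norm (s + t) \<le> proj_norm s + proj_norm t + e"
    using proj_norm_le[of "k @ l"] by (simp add: formal_sum_append sum_norms_append)
qed

text \<open>\<open>N\<close> is a seminorm in the applications.\<close>

lemma proj_norm_additive_bound:
  fixes F :: "('a::complex_normed_vector, 'b::complex_normed_vector) tensor \<Rightarrow> 'c::ab_group_add"
    and N :: "'c \<Rightarrow> real"
  assumes F: "\<And>s t. F (s + t) = F s + F t"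
    and N: "N 0 = 0" "\<And>s t. N (s + t) \<le> N s + N t"
    and K: "K \<ge> 0" "\<And>x y. N (F (pure_tensor x y)) \<le> K * (norm x * norm y)"
  shows "N (F t) \<le> K * proj_norm t"
proof (rule field_le_epsilon)
  fix e :: real assume e: "e > 0"
  define d where "d = e / (K + 1)"
  have "d > 0" using e K by (simp add: d_def)
  then obtain l where l: "t = formal_sum l" "sum_norms l < proj_norm t + d"
    using proj_norm_approx by blast
  have F0: "F 0 = 0" using F[of 0 0] by simp
  have "N (F (formal_sum l)) \<le> K * sum_norms l"
  proof (induction l)
    case Nil
    then show ?case by (simp add: formal_sum_Nil F0 N sum_norms_def)
  next
    case (Cons p l)
    obtain x y where p: "p = (x, y)" by (cases p)
    have "N (F (formal_sum (p # l))) \<le> N (F (pure_tensor x y)) + N (F (formal_sum l))"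
      by (simp add: p formal_sum_Cons F N)
    also have "\<dots> \<le> K * (norm x * norm y) + K * sum_norms l"
      by (intro add_mono K Cons)
    finally show ?case by (simp add: p sum_norms_def algebra_simps)
  qed
  also have "\<dots> \<le> K * (proj_norm t + d)" using l K by (intro mult_left_mono) auto
  also have "K * d \<le> e"
    using e K by (simp add: d_def field_simps)
  then have "K * (proj_norm t + d) \<le> K * proj_norm t + e" by (simp add: algebra_simps)
  finally show "N (F t) \<le> K * proj_norm t + e" by (simp add: l)
qed

lemma proj_norm_scaleC: "proj_norm (c *\<^sub>C t) = cmod c * proj_norm t"
proof -
  have le: "proj_norm (d *\<^sub>C s) \<le> cmod d * proj_norm s" for d and s :: "('a, 'b) tensor"
    by (rule proj_norm_additive_bound[where N = proj_norm])
      (auto simp: scaleC_add_right proj_norm_add scaleC_pure_tensor norm_scaleC mult.assoc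
        intro: order.trans[OF proj_norm_pure_le])
  show ?thesis
  proof (cases "c = 0")
    case False
    have "proj_norm t = proj_norm (inverse c *\<^sub>C (c *\<^sub>C t))"
      using False by (simp add: scaleC_scaleC scaleC_one)
    also have "\<dots> \<le> inverse (cmod c) * proj_norm (c *\<^sub>C t)"
      using le[of "inverse c"] by (simp add: norm_inverse)
    finally show ?thesis using False le[of c t] by (simp add: field_simps)
  qed simp
qed

lemma proj_norm_minus [simp]: "proj_norm (- t) = proj_norm t"
  using proj_norm_scaleC[of "-1" t] by (simp add: scaleC_minus_one)

lemma proj_norm_minus_commute: "proj_norm (s - t) = proj_norm (t - s)"
  using proj_norm_minus[of "s - t"] by simp

lemma proj_norm_triangle: "proj_norm (s - u) \<le> proj_norm (s - t) + proj_norm (t - u)"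
  using proj_norm_add[of "s - t" "t - u"] by simp

lemma proj_norm_diff_le: "\<bar>proj_norm s - proj_norm t\<bar> \<le> proj_norm (s - t)"
  using proj_norm_add[of "s - t" t] proj_norm_add[of "t - s" s] proj_norm_minus_commute[of s t]
  by (simp add: abs_le_iff)

lemma proj_norm_mult:
  fixes s t :: "('a::unital_banach_star_algebra, 'b::unital_banach_star_algebra) tensor"
  shows "proj_norm (s * t) \<le> proj_norm s * proj_norm t"
proof -
  have pure: "proj_norm (pure_tensor a b * t) \<le> (norm a * norm b) * proj_norm t" for a :: 'a and b :: 'b
  proof (rule proj_norm_additive_bound[where N = proj_norm])
    fix x :: 'a and y :: 'b
    have "proj_norm (pure_tensor a b * pure_tensor x y) \<le> norm (a * x) * norm (b * y)"
      by (simp add: times_pure_tensor proj_norm_pure_le)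
    also have "\<dots> \<le> (norm a * norm x) * (norm b * norm y)"
      by (intro mult_mono norm_mult_ineq) auto
    finally show "proj_norm (pure_tensor a b * pure_tensor x y) \<le> norm a * norm b * (norm x * norm y)"
      by (simp add: algebra_simps)
  qed (auto simp: distrib_left proj_norm_add)
  have "proj_norm (s * t) \<le> proj_norm t * proj_norm s"
    by (rule proj_norm_additive_bound[where N = proj_norm])
      (use pure in \<open>auto simp: distrib_right proj_norm_add mult.commute\<close>)
  then show ?thesis by (simp add: mult.commute)
qed

lemma proj_norm_star:
  fixes t :: "('a::unital_banach_star_algebra, 'b::unital_banach_star_algebra) tensor"
  shows "proj_norm (star t) = proj_norm t"
proof -
  have le: "proj_norm (star s) \<le> 1 * proj_norm s" for s :: "('a, 'b) tensor"
    by (rule proj_norm_additive_bound[where N = proj_norm])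
      (auto simp: star_add proj_norm_add star_pure_tensor norm_star
        intro: order.trans[OF proj_norm_pure_le])
  show ?thesis using le[of t] le[of "star t"] by (simp add: star_star)
qed


section \<open>The Banach space projective tensor product\<close>

text \<open>The completion of the algebraic tensor product in the projective norm: Cauchy
  sequences modulo null sequences.\<close>

definition proj_Cauchy ::
  "(nat \<Rightarrow> ('a::complex_normed_vector, 'b::complex_normed_vector) tensor) \<Rightarrow> bool" where
  "proj_Cauchy f \<longleftrightarrow> (\<forall>e>0. \<exists>M. \<forall>m\<ge>M. \<forall>n\<ge>M. proj_norm (f m - f n) < e)"

definition proj_rel ::
  "(nat \<Rightarrow> ('a::complex_normed_vector, 'b::complex_normed_vector) tensor) \<Rightarrow>
   (nat \<Rightarrow> ('a, 'b) tensor) \<Rightarrow> bool" where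
  "proj_rel f g \<longleftrightarrow> proj_Cauchy f \<and> proj_Cauchy g \<and> (\<lambda>n. proj_norm (f n - g n)) \<longlonglongrightarrow> 0"

lemma null_le:
  fixes f g :: "nat \<Rightarrow> real"
  assumes "g \<longlonglongrightarrow> 0" "\<And>n. 0 \<le> f n" "\<And>n. f n \<le> g n"
  shows "f \<longlonglongrightarrow> 0"
  by (rule tendsto_sandwich[OF _ _ tendsto_const assms(1)]) (auto simp: assms)

lemma proj_Cauchy_const: "proj_Cauchy (\<lambda>_. t)"
  by (simp add: proj_Cauchy_def)

lemma proj_CauchyD:
  assumes "proj_Cauchy f" "e > 0"
  obtains M where "\<And>m n. m \<ge> M \<Longrightarrow> n \<ge> M \<Longrightarrow> proj_norm (f m - f n) < e"
  using assms unfolding proj_Cauchy_def by blast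

lemma proj_Cauchy_add:
  assumes "proj_Cauchy f" "proj_Cauchy g"
  shows "proj_Cauchy (\<lambda>n. f n + g n)"
  unfolding proj_Cauchy_def
proof (intro allI impI)
  fix e :: real assume "e > 0"
  then have e2: "e / 2 > 0" by simp
  obtain M where M: "\<And>m n. m \<ge> M \<Longrightarrow> n \<ge> M \<Longrightarrow> proj_norm (f m - f n) < e / 2"
    using proj_CauchyD[OF assms(1) e2] by blast
  obtain M' where M': "\<And>m n. m \<ge> M' \<Longrightarrow> n \<ge> M' \<Longrightarrow> proj_norm (g m - g n) < e / 2"
    using proj_CauchyD[OF assms(2) e2] by blast
  have "proj_norm (f m + g m - (f n + g n)) < e" if "m \<ge> max M M'" "n \<ge> max M M'" for m n
  proof -
    have "proj_norm (f m + g m - (f n + g n)) \<le> proj_norm (f m - f n) + proj_norm (g m - g n)"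
      using proj_norm_add[of "f m - f n" "g m - g n"] by (simp add: add_diff_add)
    then show ?thesis using M[of m n] M'[of m n] that by simp
  qed
  then show "\<exists>M. \<forall>m\<ge>M. \<forall>n\<ge>M. proj_norm (f m + g m - (f n + g n)) < e" by blast
qed

lemma proj_Cauchy_lipschitz:
  assumes "proj_Cauchy f" "\<And>m n. proj_norm (g m - g n) \<le> K * proj_norm (f m - f n)"
  shows "proj_Cauchy g"
  unfolding proj_Cauchy_def
proof (intro allI impI)
  fix e :: real assume "e > 0"
  then have "e / (\<bar>K\<bar> + 1) > 0" by simp
  then obtain M where M: "\<And>m n. m \<ge> M \<Longrightarrow> n \<ge> M \<Longrightarrow> proj_norm (f m - f n) < e / (\<bar>K\<bar> + 1)"
    using proj_CauchyD[OF assms(1)] by blast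
  have "proj_norm (g m - g n) < e" if "m \<ge> M" "n \<ge> M" for m n
  proof -
    have "proj_norm (g m - g n) \<le> (\<bar>K\<bar> + 1) * proj_norm (f m - f n)"
      by (rule order.trans[OF assms(2)]) (auto intro: mult_right_mono)
    also have "\<dots> < e" using M[OF that] by (simp add: field_simps)
    finally show ?thesis .
  qed
  then show "\<exists>M. \<forall>m\<ge>M. \<forall>n\<ge>M. proj_norm (g m - g n) < e" by blast
qed

lemma proj_Cauchy_bounded:
  assumes "proj_Cauchy f"
  obtains K where "K \<ge> 0" "\<And>n. proj_norm (f n) \<le> K"
proof -
  obtain M where M: "\<And>m n. m \<ge> M \<Longrightarrow> n \<ge> M \<Longrightarrow> proj_norm (f m - f n) < 1"
    using proj_CauchyD[OF assms, of 1] by auto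
  define K where "K = Max (insert 0 ((\<lambda>n. proj_norm (f n)) ` {..M})) + 1"
  have K1: "proj_norm (f n) \<le> K - 1" if "n \<le> M" for n
    unfolding K_def using that Max_ge[of "insert 0 ((\<lambda>n. proj_norm (f n)) ` {..M})"]
    by (simp del: Max_insert)
  have "proj_norm (f n) \<le> K" for n
  proof (cases "n \<le> M")
    case False
    have "proj_norm (f n) \<le> proj_norm (f n - f M) + proj_norm (f M)"
      using proj_norm_add[of "f n - f M" "f M"] by simp
    then show ?thesis using M[of n M] K1[of M] False by simp
  qed (use K1 in fastforce)
  moreover have "K \<ge> 0" using K1[of 0] proj_norm_nonneg[of "f 0"] by linarith
  ultimately show ?thesis using that by blast
qed

lemma proj_Cauchy_norm: "proj_Cauchy f \<Longrightarrow> Cauchy (\<lambda>n. proj_norm (f n))"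
  unfolding Cauchy_def proj_Cauchy_def dist_real_def
  by (meson proj_norm_diff_le order.strict_trans1)

lemma proj_norm_convergent: "proj_Cauchy f \<Longrightarrow> (\<lambda>n. proj_norm (f n)) \<longlonglongrightarrow> lim (\<lambda>n. proj_norm (f n))"
  using proj_Cauchy_norm Cauchy_convergent_iff convergent_LIMSEQ_iff by blast

lemma proj_rel_norm:
  assumes "proj_rel f g"
  shows "lim (\<lambda>n. proj_norm (f n)) = lim (\<lambda>n. proj_norm (g n))"
proof -
  have "(\<lambda>n. \<bar>proj_norm (f n) - proj_norm (g n)\<bar>) \<longlonglongrightarrow> 0"
    by (rule null_le[of "\<lambda>n. proj_norm (f n - g n)"])
      (use assms in \<open>auto simp: proj_rel_def proj_norm_diff_le\<close>)
  then have "(\<lambda>n. proj_norm (f n) - proj_norm (g n)) \<longlonglongrightarrow> 0"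
    by (simp add: tendsto_rabs_zero_iff)
  moreover have "(\<lambda>n. proj_norm (f n) - proj_norm (g n)) \<longlonglongrightarrow>
      lim (\<lambda>n. proj_norm (f n)) - lim (\<lambda>n. proj_norm (g n))"
    by (intro tendsto_diff proj_norm_convergent) (use assms in \<open>auto simp: proj_rel_def\<close>)
  ultimately show ?thesis using LIMSEQ_unique by fastforce
qed

lemma proj_rel_refl: "proj_Cauchy f \<Longrightarrow> proj_rel f f"
  by (simp add: proj_rel_def)

lemma part_equivp_proj_rel: "part_equivp proj_rel"
proof (rule part_equivpI)
  show "\<exists>f. proj_rel f f" using proj_rel_refl proj_Cauchy_const by blast
  show "symp proj_rel"
    by (rule sympI) (simp add: proj_rel_def proj_norm_minus_commute)
  show "transp proj_rel"
  proof (rule transpI)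
    fix f g h
    assume a: "proj_rel f g" "proj_rel g h"
    then have "(\<lambda>n. proj_norm (f n - g n) + proj_norm (g n - h n)) \<longlonglongrightarrow> 0"
      using tendsto_add[of "\<lambda>n. proj_norm (f n - g n)" 0 _ "\<lambda>n. proj_norm (g n - h n)" 0]
      by (auto simp: proj_rel_def)
    then have "(\<lambda>n. proj_norm (f n - h n)) \<longlonglongrightarrow> 0"
      by (rule null_le) (auto simp: proj_norm_triangle)
    then show "proj_rel f h" using a by (simp add: proj_rel_def)
  qed
qed

quotient_type (overloaded) ('a, 'b) ptensor =
  "nat \<Rightarrow> ('a::complex_normed_vector, 'b::complex_normed_vector) tensor" / partial: proj_rel
  by (rule part_equivp_proj_rel)

lemma proj_rel_add:
  assumes "proj_rel f f'" "proj_rel g g'"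
  shows "proj_rel (\<lambda>n. f n + g n) (\<lambda>n. f' n + g' n)"
proof -
  have "(\<lambda>n. proj_norm (f n - f' n) + proj_norm (g n - g' n)) \<longlonglongrightarrow> 0"
    using assms tendsto_add[of "\<lambda>n. proj_norm (f n - f' n)" 0 _ "\<lambda>n. proj_norm (g n - g' n)" 0]
    by (auto simp: proj_rel_def)
  then have "(\<lambda>n. proj_norm (f n + g n - (f' n + g' n))) \<longlonglongrightarrow> 0"
    by (rule null_le) (auto simp: add_diff_add proj_norm_add)
  then show ?thesis using assms by (auto simp: proj_rel_def proj_Cauchy_add)
qed

lemma proj_rel_lipschitz:
  assumes "proj_rel f g" "\<And>s t. proj_norm (F s - F t) \<le> K * proj_norm (s - t)"
  shows "proj_rel (\<lambda>n. F (f n)) (\<lambda>n. F (g n))"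
proof -
  have "(\<lambda>n. K * proj_norm (f n - g n)) \<longlonglongrightarrow> 0"
    using assms(1) tendsto_mult_right_zero by (auto simp: proj_rel_def)
  then have "(\<lambda>n. proj_norm (F (f n) - F (g n))) \<longlonglongrightarrow> 0"
    by (rule null_le) (auto simp: assms)
  then show ?thesis
    using assms proj_Cauchy_lipschitz[of f "\<lambda>n. F (f n)" K] proj_Cauchy_lipschitz[of g "\<lambda>n. F (g n)" K]
    by (auto simp: proj_rel_def)
qed

instantiation ptensor :: (complex_normed_vector, complex_normed_vector) complex_vector
begin

lift_definition zero_ptensor :: "('a, 'b) ptensor" is "\<lambda>_. 0"
  by (intro proj_rel_refl proj_Cauchy_const)

lift_definition plus_ptensor :: "('a, 'b) ptensor \<Rightarrow> ('a, 'b) ptensor \<Rightarrow> ('a, 'b) ptensor" is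
  "\<lambda>f g n. f n + g n"
  by (rule proj_rel_add)

lift_definition scaleC_ptensor :: "complex \<Rightarrow> ('a, 'b) ptensor \<Rightarrow> ('a, 'b) ptensor" is
  "\<lambda>c f n. c *\<^sub>C f n"
  by (rule proj_rel_lipschitz) (auto simp: proj_norm_scaleC simp flip: scaleC_diff_right)

definition uminus_ptensor :: "('a, 'b) ptensor \<Rightarrow> ('a, 'b) ptensor" where
  "uminus_ptensor x = (- 1) *\<^sub>C x"

definition minus_ptensor :: "('a, 'b) ptensor \<Rightarrow> ('a, 'b) ptensor \<Rightarrow> ('a, 'b) ptensor" where
  "minus_ptensor x y = x + - y"

instance
proof
  fix x y z :: "('a, 'b) ptensor" and c d :: complex
  show "x + y + z = x + (y + z)"
    by transfer (simp add: add.assoc proj_rel_add)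
  show "x + y = y + x"
    by transfer (simp add: add.commute proj_rel_add)
  show "0 + x = x" by transfer simp
  show "- x + x = 0"
    unfolding uminus_ptensor_def
    by transfer (simp add: scaleC_minus_one proj_rel_refl proj_Cauchy_const)
  show "x - y = x + - y" by (rule minus_ptensor_def)
  show "c *\<^sub>C (x + y) = c *\<^sub>C x + c *\<^sub>C y"
  proof transfer
    fix c and f g :: "nat \<Rightarrow> ('a, 'b) tensor"
    assume "proj_rel f f" "proj_rel g g"
    then have "proj_rel (\<lambda>n. f n + g n) (\<lambda>n. f n + g n)" by (rule proj_rel_add)
    then have "proj_rel (\<lambda>n. c *\<^sub>C (f n + g n)) (\<lambda>n. c *\<^sub>C (f n + g n))"
      by (rule proj_rel_lipschitz) (auto simp: proj_norm_scaleC simp flip: scaleC_diff_right)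
    then show "proj_rel (\<lambda>n. c *\<^sub>C (f n + g n)) (\<lambda>n. c *\<^sub>C f n + c *\<^sub>C g n)"
      by (simp add: scaleC_add_right)
  qed
  have scale: "proj_rel (\<lambda>n. c *\<^sub>C f n) (\<lambda>n. c *\<^sub>C f n)"
    if "proj_rel f f" for f :: "nat \<Rightarrow> ('a, 'b) tensor" and c
    using that by (rule proj_rel_lipschitz)
      (auto simp: proj_norm_scaleC simp flip: scaleC_diff_right)
  show "(c + d) *\<^sub>C x = c *\<^sub>C x + d *\<^sub>C x"
    by transfer (simp add: scaleC_add_left scale proj_rel_add)
  show "c *\<^sub>C d *\<^sub>C x = (c * d) *\<^sub>C x"
    by transfer (simp add: scaleC_scaleC scale)
  show "1 *\<^sub>C x = x"
    by transfer (simp add: scaleC_one)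
qed

end

lemma proj_rel_diff:
  assumes "proj_rel f f'" "proj_rel g g'"
  shows "proj_rel (\<lambda>n. f n - g n) (\<lambda>n. f' n - g' n)"
proof -
  have "proj_rel (\<lambda>n. - g n) (\<lambda>n. - g' n)"
    by (rule proj_rel_lipschitz[OF assms(2), of _ 1])
      (simp add: proj_norm_minus_commute)
  from proj_rel_add[OF assms(1) this] show ?thesis by simp
qed


lemma ptensor_cases: "\<exists>f. proj_Cauchy f \<and> x = abs_ptensor f"
proof -
  have "proj_rel (rep_ptensor x) (rep_ptensor x)" "x = abs_ptensor (rep_ptensor x)"
    using Quotient3_rep_reflp[OF Quotient3_ptensor] Quotient3_abs_rep[OF Quotient3_ptensor] by metis+
  then show ?thesis by (auto simp: proj_rel_def)
qed

lemma abs_ptensor_eqI: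
  assumes "proj_Cauchy f" "proj_Cauchy g" "(\<lambda>n. proj_norm (f n - g n)) \<longlonglongrightarrow> 0"
  shows "abs_ptensor f = abs_ptensor g"
  using assms by (intro Quotient3_rel_abs[OF Quotient3_ptensor]) (simp add: proj_rel_def)

lemma abs_ptensor_add:
  "proj_Cauchy f \<Longrightarrow> proj_Cauchy g \<Longrightarrow>
    abs_ptensor f + abs_ptensor g = abs_ptensor (\<lambda>n. f n + g n)"
  by (simp add: plus_ptensor.abs_eq eq_onp_def proj_rel_refl)

lemma abs_ptensor_scaleC: "proj_Cauchy f \<Longrightarrow> c *\<^sub>C abs_ptensor f = abs_ptensor (\<lambda>n. c *\<^sub>C f n)"
  by (simp add: scaleC_ptensor.abs_eq proj_rel_refl)

lemma proj_Cauchy_scaleC: "proj_Cauchy f \<Longrightarrow> proj_Cauchy (\<lambda>n. c *\<^sub>C f n)"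
  by (rule proj_Cauchy_lipschitz[where K = "cmod c"])
    (auto simp: proj_norm_scaleC simp flip: scaleC_diff_right)

lemma proj_Cauchy_diff: "proj_Cauchy f \<Longrightarrow> proj_Cauchy g \<Longrightarrow> proj_Cauchy (\<lambda>n. f n - g n)"
  using proj_rel_diff proj_rel_refl proj_rel_def by blast

lemma abs_ptensor_diff:
  assumes "proj_Cauchy f" "proj_Cauchy g"
  shows "abs_ptensor f - abs_ptensor g = abs_ptensor (\<lambda>n. f n - g n)"
proof -
  have "abs_ptensor (\<lambda>n. f n - g n) + abs_ptensor g = abs_ptensor f"
    using assms by (simp add: abs_ptensor_add proj_Cauchy_diff)
  then show ?thesis by (metis add_diff_cancel)
qed

instantiation ptensor :: (complex_normed_vector, complex_normed_vector) real_vector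
begin

definition scaleR_ptensor :: "real \<Rightarrow> ('a, 'b) ptensor \<Rightarrow> ('a, 'b) ptensor" where
  "scaleR_ptensor r x = complex_of_real r *\<^sub>C x"

instance
proof
  fix x y :: "('a, 'b) ptensor" and a b :: real
  show "a *\<^sub>R (x + y) = a *\<^sub>R x + a *\<^sub>R y"
    by (simp add: scaleR_ptensor_def scaleC_add_right)
  show "(a + b) *\<^sub>R x = a *\<^sub>R x + b *\<^sub>R x"
    by (simp add: scaleR_ptensor_def scaleC_add_left)
  show "a *\<^sub>R b *\<^sub>R x = (a * b) *\<^sub>R x"
    by (simp add: scaleR_ptensor_def scaleC_scaleC)
  show "1 *\<^sub>R x = x"
    by (simp add: scaleR_ptensor_def scaleC_one)
qed

end

instantiation ptensor :: (complex_normed_vector, complex_normed_vector) complex_normed_vector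
begin

lift_definition norm_ptensor :: "('a, 'b) ptensor \<Rightarrow> real" is "\<lambda>f. lim (\<lambda>n. proj_norm (f n))"
  by (rule proj_rel_norm)

definition sgn_ptensor :: "('a, 'b) ptensor \<Rightarrow> ('a, 'b) ptensor" where
  "sgn_ptensor x = scaleR (inverse (norm x)) x"

definition dist_ptensor :: "('a, 'b) ptensor \<Rightarrow> ('a, 'b) ptensor \<Rightarrow> real" where
  "dist_ptensor x y = norm (x - y)"

definition uniformity_ptensor :: "(('a, 'b) ptensor \<times> ('a, 'b) ptensor) filter" where
  "uniformity_ptensor = (INF e\<in>{0 <..}. principal {(x, y). dist x y < e})"

definition open_ptensor :: "('a, 'b) ptensor set \<Rightarrow> bool" where
  "open_ptensor S \<longleftrightarrow> (\<forall>x\<in>S. \<forall>\<^sub>F (x', y) in uniformity. x' = x \<longrightarrow> y \<in> S)"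

lemma norm_abs_ptensor:
  assumes "proj_Cauchy (f :: nat \<Rightarrow> ('a, 'b) tensor)"
  shows "(\<lambda>n. proj_norm (f n)) \<longlonglongrightarrow> norm (abs_ptensor f)"
  using assms by (simp add: norm_ptensor.abs_eq proj_rel_refl proj_norm_convergent)

lemma norm_ptensor_scaleC: "norm (c *\<^sub>C x) = cmod c * norm (x :: ('a, 'b) ptensor)"
proof -
  obtain f where f: "proj_Cauchy f" "x = abs_ptensor f" using ptensor_cases by blast
  have "(\<lambda>n. proj_norm (c *\<^sub>C f n)) \<longlonglongrightarrow> cmod c * norm x"
    using tendsto_mult_left[OF norm_abs_ptensor[OF f(1)], of "cmod c"] f(2)
    by (simp add: proj_norm_scaleC)
  then show ?thesis
    using norm_abs_ptensor[OF proj_Cauchy_scaleC[OF f(1), of c]] LIMSEQ_unique f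
    by (simp add: abs_ptensor_scaleC) 
qed

instance
proof
  fix x y :: "('a, 'b) ptensor" and a b r :: real and c :: complex
  obtain f where f: "proj_Cauchy f" "x = abs_ptensor f" using ptensor_cases by blast
  obtain g where g: "proj_Cauchy g" "y = abs_ptensor g" using ptensor_cases by blast
  show "r *\<^sub>R x = complex_of_real r *\<^sub>C x" by (rule scaleR_ptensor_def)
  show "norm (c *\<^sub>C x) = cmod c * norm x" by (rule norm_ptensor_scaleC)
  show "norm (a *\<^sub>R x) = \<bar>a\<bar> * norm x"
    by (simp add: scaleR_ptensor_def norm_ptensor_scaleC)
  show "norm (x + y) \<le> norm x + norm y"
  proof (rule LIMSEQ_le)
    show "(\<lambda>n. proj_norm (f n + g n)) \<longlonglongrightarrow> norm (x + y)"
      using norm_abs_ptensor[OF proj_Cauchy_add[OF f(1) g(1)]] f g by (simp add: abs_ptensor_add)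
    show "(\<lambda>n. proj_norm (f n) + proj_norm (g n)) \<longlonglongrightarrow> norm x + norm y"
      using f g by (simp add: tendsto_add norm_abs_ptensor)
  qed (auto simp: proj_norm_add)
  have z: "0 = abs_ptensor (\<lambda>_. 0 :: ('a, 'b) tensor)" by (rule zero_ptensor.abs_eq)
  show "norm x = 0 \<longleftrightarrow> x = 0"
  proof
    assume "norm x = 0"
    then have "(\<lambda>n. proj_norm (f n - 0)) \<longlonglongrightarrow> 0" using norm_abs_ptensor f by fastforce
    then show "x = 0" unfolding z f(2) by (intro abs_ptensor_eqI f(1) proj_Cauchy_const)
  next
    assume "x = 0"
    then show "norm x = 0"
      using norm_ptensor_scaleC[of 0 x] by simp
  qed
  show "dist x y = norm (x - y)" by (rule dist_ptensor_def)
  show "sgn x = x /\<^sub>R norm x" by (rule sgn_ptensor_def)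
qed (rule uniformity_ptensor_def open_ptensor_def)+

end

definition tensor_incl ::
  "('a::complex_normed_vector, 'b::complex_normed_vector) tensor \<Rightarrow> ('a, 'b) ptensor" where
  "tensor_incl t = abs_ptensor (\<lambda>_. t)"

definition ptens ::
  "'a::complex_normed_vector \<Rightarrow> 'b::complex_normed_vector \<Rightarrow> ('a, 'b) ptensor"
  (infixr "\<otimes>\<^sub>\<gamma>" 70) where
  "x \<otimes>\<^sub>\<gamma> y = tensor_incl (pure_tensor x y)"

lemma tensor_incl_add: "tensor_incl (s + t) = tensor_incl s + tensor_incl t"
  by (simp add: tensor_incl_def abs_ptensor_add proj_Cauchy_const)

lemma tensor_incl_scaleC: "tensor_incl (c *\<^sub>C t) = c *\<^sub>C tensor_incl t"
  by (simp add: tensor_incl_def abs_ptensor_scaleC proj_Cauchy_const)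

lemma norm_tensor_incl: "norm (tensor_incl t) = proj_norm t"
  using norm_abs_ptensor[OF proj_Cauchy_const[of t]] LIMSEQ_unique[OF _ tendsto_const]
  by (fastforce simp: tensor_incl_def)

lemma tensor_incl_diff: "tensor_incl (s - t) = tensor_incl s - tensor_incl t"
  by (simp add: tensor_incl_def abs_ptensor_diff proj_Cauchy_const)

lemma tensor_incl_tendsto:
  assumes "proj_Cauchy f"
  shows "(\<lambda>n. tensor_incl (f n)) \<longlonglongrightarrow> abs_ptensor f"
  unfolding LIMSEQ_def
proof (intro allI impI)
  fix e :: real assume "e > 0"
  then have e2: "e / 2 > 0" by simp
  obtain M where M: "\<And>m n. m \<ge> M \<Longrightarrow> n \<ge> M \<Longrightarrow> proj_norm (f m - f n) < e / 2"
    using proj_CauchyD[OF assms e2] by blast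
  have "dist (tensor_incl (f m)) (abs_ptensor f) < e" if m: "m \<ge> M" for m
  proof -
    have "(\<lambda>n. proj_norm (f m - f n)) \<longlonglongrightarrow> norm (tensor_incl (f m) - abs_ptensor f)"
      using norm_abs_ptensor[OF proj_Cauchy_diff[OF proj_Cauchy_const assms]]
      by (simp add: tensor_incl_def abs_ptensor_diff proj_Cauchy_const assms)
    then have "norm (tensor_incl (f m) - abs_ptensor f) \<le> e / 2"
      by (rule LIMSEQ_le_const2) (use M m in \<open>auto intro!: exI[of _ M] less_imp_le\<close>)
    then show ?thesis using \<open>e > 0\<close> by (simp add: dist_norm)
  qed
  then show "\<exists>no. \<forall>n\<ge>no. dist (tensor_incl (f n)) (abs_ptensor f) < e" by blast
qed

lemma tensor_incl_dense: "e > 0 \<Longrightarrow> \<exists>t. norm (x - tensor_incl t) < e"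
proof -
  assume e: "e > 0"
  obtain f where f: "proj_Cauchy f" "x = abs_ptensor f" using ptensor_cases by blast
  then obtain n where "dist (tensor_incl (f n)) x < e"
    using tensor_incl_tendsto[OF f(1)] e unfolding LIMSEQ_def by blast
  then show ?thesis by (auto simp: dist_norm norm_minus_commute)
qed

instance ptensor :: (complex_normed_vector, complex_normed_vector) banach
proof
  fix X :: "nat \<Rightarrow> ('a, 'b) ptensor"
  assume X: "Cauchy X"
  have "\<exists>t. norm (X n - tensor_incl t) < inverse (real (Suc n))" for n
    by (rule tensor_incl_dense) simp
  then obtain f where f: "\<And>n. norm (X n - tensor_incl (f n)) < inverse (real (Suc n))" by metis
  have lim0: "(\<lambda>n. X n - tensor_incl (f n)) \<longlonglongrightarrow> 0"
    by (rule LIMSEQ_norm_0) (use f in \<open>simp add: inverse_eq_divide\<close>)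
  have "Cauchy (\<lambda>n. tensor_incl (f n))"
  proof (rule CauchyI)
    fix e :: real assume "e > 0"
    then have e2: "e / 2 > 0" by simp
    obtain M where M: "\<And>m n. m \<ge> M \<Longrightarrow> n \<ge> M \<Longrightarrow> norm (X m - X n) < e / 2"
      using CauchyD[OF X e2] by blast
    obtain M' where M': "\<And>m n. m \<ge> M' \<Longrightarrow> n \<ge> M' \<Longrightarrow>
        norm (X m - tensor_incl (f m) - (X n - tensor_incl (f n))) < e / 2"
      using CauchyD[OF LIMSEQ_imp_Cauchy[OF lim0] e2] by blast
    have "norm (tensor_incl (f m) - tensor_incl (f n)) < e"
      if "m \<ge> max M M'" "n \<ge> max M M'" for m n
    proof -
      have "tensor_incl (f m) - tensor_incl (f n) =
          (X m - X n) - (X m - tensor_incl (f m) - (X n - tensor_incl (f n)))" by simp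
      also have "norm \<dots> < e"
        using norm_triangle_ineq4[of "X m - X n"] M[of m n] M'[of m n] that
        by (smt (verit) field_sum_of_halves max.bounded_iff)
      finally show ?thesis .
    qed
    then show "\<exists>M. \<forall>m\<ge>M. \<forall>n\<ge>M. norm (tensor_incl (f m) - tensor_incl (f n)) < e" by blast
  qed
  then have "proj_Cauchy f"
    by (simp add: Cauchy_def proj_Cauchy_def dist_norm norm_tensor_incl flip: tensor_incl_diff)
  then have "(\<lambda>n. tensor_incl (f n) + (X n - tensor_incl (f n))) \<longlonglongrightarrow> abs_ptensor f + 0"
    by (intro tendsto_add tensor_incl_tendsto lim0)
  then show "convergent X" by (auto simp: convergent_def)
qed

lemma ptens_add_left: "(x + x') \<otimes>\<^sub>\<gamma> y = x \<otimes>\<^sub>\<gamma> y + x' \<otimes>\<^sub>\<gamma> y"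
  by (simp add: ptens_def pure_tensor_add_left tensor_incl_add)

lemma ptens_add_right: "x \<otimes>\<^sub>\<gamma> (y + y') = x \<otimes>\<^sub>\<gamma> y + x \<otimes>\<^sub>\<gamma> y'"
  by (simp add: ptens_def pure_tensor_add_right tensor_incl_add)

lemma ptens_scaleC_left: "(c *\<^sub>C x) \<otimes>\<^sub>\<gamma> y = c *\<^sub>C (x \<otimes>\<^sub>\<gamma> y)"
  by (simp add: ptens_def tensor_incl_scaleC flip: scaleC_pure_tensor)

lemma ptens_scaleC_right: "x \<otimes>\<^sub>\<gamma> (c *\<^sub>C y) = c *\<^sub>C (x \<otimes>\<^sub>\<gamma> y)"
  by (simp add: ptens_def tensor_incl_scaleC flip: scaleC_pure_tensor_right)

lemma norm_ptens_le: "norm (x \<otimes>\<^sub>\<gamma> y) \<le> norm x * norm y"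
  by (simp add: ptens_def norm_tensor_incl proj_norm_pure_le)

lemma norm_sum_list_ptens:
  "norm (\<Sum>(x, y)\<leftarrow>k. x \<otimes>\<^sub>\<gamma> y) = proj_norm (\<Sum>(x, y)\<leftarrow>k. pure_tensor x y)"
proof -
  have "(\<Sum>(x, y)\<leftarrow>k. x \<otimes>\<^sub>\<gamma> y) = tensor_incl (\<Sum>(x, y)\<leftarrow>k. pure_tensor x y)"
    by (induction k)
      (auto simp: ptens_def tensor_incl_add, simp add: tensor_incl_def zero_ptensor.abs_eq)
  then show ?thesis by (simp add: norm_tensor_incl)
qed

lemma proj_norm_mult_diff:
  fixes s t s' t' :: "('a::unital_banach_star_algebra, 'b::unital_banach_star_algebra) tensor"
  shows "proj_norm (s * t - s' * t') \<le>
    proj_norm (s - s') * proj_norm t + proj_norm s' * proj_norm (t - t')"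
proof -
  have "s * t - s' * t' = (s - s') * t + s' * (t - t')" by (simp add: algebra_simps)
  then show ?thesis
    using proj_norm_add[of "(s - s') * t" "s' * (t - t')"]
      proj_norm_mult[of "s - s'" t] proj_norm_mult[of s' "t - t'"] by simp
qed

lemma proj_Cauchy_mult:
  fixes f g :: "nat \<Rightarrow> ('a::unital_banach_star_algebra, 'b::unital_banach_star_algebra) tensor"
  assumes f: "proj_Cauchy f" and g: "proj_Cauchy g"
  shows "proj_Cauchy (\<lambda>n. f n * g n)"
  unfolding proj_Cauchy_def
proof (intro allI impI)
  fix e :: real assume e: "e > 0"
  obtain K where K: "K \<ge> 0" "\<And>n. proj_norm (f n) \<le> K" using proj_Cauchy_bounded[OF f] by blast
  obtain L where L: "L \<ge> 0" "\<And>n. proj_norm (g n) \<le> L" using proj_Cauchy_bounded[OF g] by blast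
  define d where "d = e / (K + L + 1)"
  have d: "d > 0" "d * (K + L) < e" using e K L by (auto simp: d_def field_simps)
  obtain M where M: "\<And>m n. m \<ge> M \<Longrightarrow> n \<ge> M \<Longrightarrow> proj_norm (f m - f n) < d"
    using proj_CauchyD[OF f d(1)] by blast
  obtain M' where M': "\<And>m n. m \<ge> M' \<Longrightarrow> n \<ge> M' \<Longrightarrow> proj_norm (g m - g n) < d"
    using proj_CauchyD[OF g d(1)] by blast
  have "proj_norm (f m * g m - f n * g n) < e" if "m \<ge> max M M'" "n \<ge> max M M'" for m n
  proof -
    have "proj_norm (f m * g m - f n * g n) \<le> d * L + K * d"
      by (rule order.trans[OF proj_norm_mult_diff])
        (intro add_mono mult_mono K L less_imp_le[OF M] less_imp_le[OF M'];
          use that d in simp)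
    then show ?thesis using d(2) by (simp add: algebra_simps)
  qed
  then show "\<exists>M. \<forall>m\<ge>M. \<forall>n\<ge>M. proj_norm (f m * g m - f n * g n) < e" by blast
qed

lemma proj_rel_mult:
  fixes f g :: "nat \<Rightarrow> ('a::unital_banach_star_algebra, 'b::unital_banach_star_algebra) tensor"
  assumes "proj_rel f f'" "proj_rel g g'"
  shows "proj_rel (\<lambda>n. f n * g n) (\<lambda>n. f' n * g' n)"
proof -
  have C: "proj_Cauchy f" "proj_Cauchy f'" "proj_Cauchy g" "proj_Cauchy g'"
    using assms by (auto simp: proj_rel_def)
  obtain K where K: "K \<ge> 0" "\<And>n. proj_norm (f' n) \<le> K" using proj_Cauchy_bounded[OF C(2)] by blast
  obtain L where L: "L \<ge> 0" "\<And>n. proj_norm (g n) \<le> L" using proj_Cauchy_bounded[OF C(3)] by blast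
  have "(\<lambda>n. proj_norm (f n - f' n) * L + K * proj_norm (g n - g' n)) \<longlonglongrightarrow> 0"
    by (intro tendsto_add_zero tendsto_mult_left_zero tendsto_mult_right_zero)
      (use assms in \<open>auto simp: proj_rel_def\<close>)
  then have "(\<lambda>n. proj_norm (f n * g n - f' n * g' n)) \<longlonglongrightarrow> 0"
    by (rule null_le)
      (auto intro!: order.trans[OF proj_norm_mult_diff] add_mono mult_mono K L)
  then show ?thesis using C by (simp add: proj_rel_def proj_Cauchy_mult)
qed

instantiation ptensor :: (unital_banach_star_algebra, unital_banach_star_algebra) unital_banach_star_algebra
begin

lift_definition one_ptensor :: "('a, 'b) ptensor" is "\<lambda>_. 1"
  by (intro proj_rel_refl proj_Cauchy_const)

lift_definition times_ptensor :: "('a, 'b) ptensor \<Rightarrow> ('a, 'b) ptensor \<Rightarrow> ('a, 'b) ptensor" is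
  "\<lambda>f g n. f n * g n"
  by (rule proj_rel_mult)

lift_definition star_ptensor :: "('a, 'b) ptensor \<Rightarrow> ('a, 'b) ptensor" is
  "\<lambda>f n. star (f n)"
  by (rule proj_rel_lipschitz[where K = 1]) (auto simp: proj_norm_star simp flip: star_diff)

lemma abs_ptensor_mult:
  "proj_Cauchy f \<Longrightarrow> proj_Cauchy g \<Longrightarrow>
    abs_ptensor f * abs_ptensor g = abs_ptensor (\<lambda>n. f n * g n :: ('a, 'b) tensor)"
  by (simp add: times_ptensor.abs_eq proj_rel_refl)

lemma abs_ptensor_star:
  "proj_Cauchy f \<Longrightarrow> star (abs_ptensor f) = abs_ptensor (\<lambda>n. star (f n) :: ('a, 'b) tensor)"
  by (simp add: star_ptensor.abs_eq proj_rel_refl)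

lemma proj_Cauchy_star: "proj_Cauchy f \<Longrightarrow> proj_Cauchy (\<lambda>n. star (f n) :: ('a, 'b) tensor)"
  by (rule proj_Cauchy_lipschitz[where K = 1]) (auto simp: proj_norm_star simp flip: star_diff)

instance
proof
  fix x y z :: "('a, 'b) ptensor" and c :: complex and r :: real
  obtain f where f: "proj_Cauchy f" "x = abs_ptensor f" using ptensor_cases by blast
  obtain g where g: "proj_Cauchy g" "y = abs_ptensor g" using ptensor_cases by blast
  obtain h where h: "proj_Cauchy h" "z = abs_ptensor h" using ptensor_cases by blast
  note C = f(1) g(1) h(1) proj_Cauchy_const proj_Cauchy_add proj_Cauchy_scaleC proj_Cauchy_mult
    proj_Cauchy_star
  note A = f(2) g(2) h(2) abs_ptensor_add abs_ptensor_scaleC abs_ptensor_mult abs_ptensor_star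
    one_ptensor.abs_eq
  show "x * y * z = x * (y * z)" by (simp add: A C mult.assoc)
  show "1 * x = x" by (simp add: A C)
  show "x * 1 = x" by (simp add: A C)
  show "(x + y) * z = x * z + y * z" by (simp add: A C distrib_right)
  show "x * (y + z) = x * y + x * z" by (simp add: A C distrib_left)
  show ml: "(c *\<^sub>C x) * y = c *\<^sub>C (x * y)" for c by (simp add: A C mult_scaleC_left)
  show mr: "x * (c *\<^sub>C y) = c *\<^sub>C (x * y)" for c by (simp add: A C mult_scaleC_right)
  show "(r *\<^sub>R x) * y = r *\<^sub>R (x * y)" by (simp add: scaleR_scaleC ml)
  show "x * (r *\<^sub>R y) = r *\<^sub>R (x * y)" by (simp add: scaleR_scaleC mr)
  show "star (x + y) = star x + star y" by (simp add: A C star_add)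
  show "star (c *\<^sub>C x) = cnj c *\<^sub>C star x" by (simp add: A C star_scaleC)
  show "star (x * y) = star y * star x" by (simp add: A C star_mult)
  show "star (star x) = x" by (simp add: A C star_star)
  show "norm (x * y) \<le> norm x * norm y"
  proof (rule LIMSEQ_le)
    show "(\<lambda>n. proj_norm (f n * g n)) \<longlonglongrightarrow> norm (x * y)"
      using norm_abs_ptensor[OF proj_Cauchy_mult[OF f(1) g(1)]] by (simp add: A C)
    show "(\<lambda>n. proj_norm (f n) * proj_norm (g n)) \<longlonglongrightarrow> norm x * norm y"
      using f g by (simp add: tendsto_mult norm_abs_ptensor)
  qed (auto simp: proj_norm_mult)
  show "norm (star x) = norm x"
    using norm_abs_ptensor[OF proj_Cauchy_star[OF f(1)]] norm_abs_ptensor[OF f(1)]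
    by (simp add: A C proj_norm_star LIMSEQ_unique)
qed

end

lemma ptens_mult: "(a \<otimes>\<^sub>\<gamma> b) * (c \<otimes>\<^sub>\<gamma> d) = (a * c) \<otimes>\<^sub>\<gamma> (b * d)"
  by (simp add: ptens_def tensor_incl_def abs_ptensor_mult proj_Cauchy_const times_pure_tensor)

lemma star_ptens: "star (a \<otimes>\<^sub>\<gamma> b) = star a \<otimes>\<^sub>\<gamma> star b"
  by (simp add: ptens_def tensor_incl_def abs_ptensor_star proj_Cauchy_const star_pure_tensor)

lemma ptens_one: "1 \<otimes>\<^sub>\<gamma> 1 = 1"
  by (simp add: ptens_def tensor_incl_def one_ptensor.abs_eq one_tensor_def)


section \<open>Continuous linear extensions from elementary tensors\<close>

definition ptensor_ext ::
  "('a::complex_normed_vector \<Rightarrow> 'b::complex_normed_vector \<Rightarrow> 'c::complex_normed_vector) \<Rightarrow>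
    ('a, 'b) ptensor \<Rightarrow> 'c" where
  "ptensor_ext G = (THE h. clinear h \<and> continuous_on UNIV h \<and> (\<forall>x y. h (x \<otimes>\<^sub>\<gamma> y) = G x y))"

lemma ptensor_ext_unique:
  fixes h h' :: "('a::complex_normed_vector, 'b::complex_normed_vector) ptensor \<Rightarrow>
    'c::complex_normed_vector"
  assumes "clinear h" "continuous_on UNIV h" "clinear h'" "continuous_on UNIV h'"
    and "\<And>x y. h (x \<otimes>\<^sub>\<gamma> y) = h' (x \<otimes>\<^sub>\<gamma> y)"
  shows "h = h'"
proof
  fix z :: "('a, 'b) ptensor"
  have incl: "h (tensor_incl t) = h' (tensor_incl t)" for t
    by (rule tensor_additive_eqI[where t = t])
      (use assms in \<open>simp_all add: tensor_incl_add clinear_def flip: ptens_def\<close>)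
  obtain f where f: "proj_Cauchy f" "z = abs_ptensor f" using ptensor_cases by blast
  have "(\<lambda>n. h (tensor_incl (f n))) \<longlonglongrightarrow> h z" "(\<lambda>n. h' (tensor_incl (f n))) \<longlonglongrightarrow> h' z"
    using tensor_incl_tendsto[OF f(1)] assms(2,4) f(2)
    by (auto simp: continuous_on_eq_continuous_at intro: isCont_tendsto_compose)
  then show "h z = h' z" using incl LIMSEQ_unique by simp
qed

lemma ptensor_ext_exists:
  fixes G :: "'a::complex_normed_vector \<Rightarrow> 'b::complex_normed_vector \<Rightarrow>
    'c::{complex_normed_vector, banach}"
  assumes G: "\<And>x. clinear (G x)" "\<And>y. clinear (\<lambda>x. G x y)"
    and K: "K \<ge> 0" "\<And>x y. norm (G x y) \<le> K * (norm x * norm y)"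
  shows "\<exists>h. clinear h \<and> continuous_on UNIV h \<and> (\<forall>x y. h (x \<otimes>\<^sub>\<gamma> y) = G x y)"
proof -
  have bal: "balanced G" using G by (simp add: balanced_def clinear_def)
  define L where "L = tensor_lift G"
  have L_add: "L (s + t) = L s + L t" for s t
    using bal by (simp add: L_def tensor_lift_add)
  have L_pure: "L (pure_tensor x y) = G x y" for x y
    using bal by (simp add: L_def tensor_lift_pure)
  have L_scale: "L (c *\<^sub>C t) = c *\<^sub>C L t" for c t
    by (rule tensor_additive_eqI[where t = t])
      (use G in \<open>simp_all add: L_add L_pure scaleC_add_right scaleC_pure_tensor clinear_def\<close>)
  have L_bound: "norm (L t) \<le> K * proj_norm t" for t
    by (rule proj_norm_additive_bound[where N = norm])
      (use K in \<open>simp_all add: L_add L_pure norm_triangle_ineq\<close>)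
  have L_diff: "L (s - t) = L s - L t" for s t
    using L_add[of "s - t" t] by simp
  have L_Cauchy: "Cauchy (\<lambda>n. L (f n))" if f: "proj_Cauchy f" for f
  proof (rule CauchyI)
    fix e :: real assume e: "e > 0"
    then have d: "e / (K + 1) > 0" using K by simp
    obtain M where M: "\<And>m n. m \<ge> M \<Longrightarrow> n \<ge> M \<Longrightarrow> proj_norm (f m - f n) < e / (K + 1)"
      using proj_CauchyD[OF f d] by blast
    have "norm (L (f m) - L (f n)) < e" if "m \<ge> M" "n \<ge> M" for m n
    proof -
      have "norm (L (f m) - L (f n)) \<le> K * proj_norm (f m - f n)"
        using L_bound[of "f m - f n"] by (simp add: L_diff)
      also have "\<dots> \<le> (K + 1) * proj_norm (f m - f n)" by (simp add: mult_right_mono)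
      also have "\<dots> < e" using M[OF that] K by (simp add: field_simps)
      finally show ?thesis .
    qed
    then show "\<exists>M. \<forall>m\<ge>M. \<forall>n\<ge>M. norm (L (f m) - L (f n)) < e" by blast
  qed
  define h where "h z = lim (\<lambda>n. L (rep_ptensor z n))" for z
  have rep: "proj_Cauchy (rep_ptensor z)" "abs_ptensor (rep_ptensor z) = z" for z :: "('a, 'b) ptensor"
    using Quotient3_rep_reflp[OF Quotient3_ptensor, of z] Quotient3_abs_rep[OF Quotient3_ptensor, of z]
    by (auto simp: proj_rel_def)
  have h0: "(\<lambda>n. L (rep_ptensor z n)) \<longlonglongrightarrow> h z" for z
    unfolding h_def using L_Cauchy[OF rep(1)] Cauchy_convergent_iff convergent_LIMSEQ_iff by blast
  have h: "(\<lambda>n. L (f n)) \<longlonglongrightarrow> h (abs_ptensor f)" if f: "proj_Cauchy f" for f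
  proof -
    let ?r = "rep_ptensor (abs_ptensor f)"
    have "(\<lambda>n. proj_norm (f n - ?r n)) \<longlonglongrightarrow> norm (abs_ptensor f - abs_ptensor ?r)"
      using norm_abs_ptensor[OF proj_Cauchy_diff[OF f rep(1)]]
      by (simp add: abs_ptensor_diff f rep(1))
    then have "(\<lambda>n. K * proj_norm (f n - ?r n)) \<longlonglongrightarrow> 0"
      by (intro tendsto_mult_right_zero) (simp add: rep(2))
    then have "(\<lambda>n. norm (L (f n) - L (?r n))) \<longlonglongrightarrow> 0"
      by (rule null_le) (simp_all add: L_bound flip: L_diff)
    then have "(\<lambda>n. L (f n) - L (?r n)) \<longlonglongrightarrow> 0" by (simp add: tendsto_norm_zero_iff)
    from tendsto_add[OF this h0[of "abs_ptensor f"]] show ?thesis by simp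
  qed
  have h_add: "h (y + z) = h y + h z" for y z
  proof -
    obtain f g where fg: "proj_Cauchy f" "y = abs_ptensor f" "proj_Cauchy g" "z = abs_ptensor g"
      using ptensor_cases by metis
    show ?thesis
      using h[OF proj_Cauchy_add[OF fg(1,3)]] tendsto_add[OF h[OF fg(1)] h[OF fg(3)]] fg
      by (simp add: L_add abs_ptensor_add LIMSEQ_unique)
  qed
  have h_scale: "h (c *\<^sub>C z) = c *\<^sub>C h z" for c z
  proof -
    obtain f where f: "proj_Cauchy f" "z = abs_ptensor f" using ptensor_cases by metis
    have "(\<lambda>n. norm (c *\<^sub>C L (f n) - c *\<^sub>C h z)) \<longlonglongrightarrow> 0"
      using tendsto_mult_right_zero[OF tendsto_norm_zero[OF LIM_zero[OF h[OF f(1)]]], of "cmod c"]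
      by (simp add: norm_scaleC f(2) flip: scaleC_diff_right)
    then have "(\<lambda>n. c *\<^sub>C L (f n)) \<longlonglongrightarrow> c *\<^sub>C h z"
      using LIM_zero_cancel tendsto_norm_zero_iff by blast
    then show ?thesis
      using h[OF proj_Cauchy_scaleC[OF f(1)], of c] f
      by (simp add: L_scale abs_ptensor_scaleC LIMSEQ_unique)
  qed
  have h_bound: "norm (h z) \<le> norm z * K" for z
  proof -
    obtain f where f: "proj_Cauchy f" "z = abs_ptensor f" using ptensor_cases by metis
    show ?thesis
      by (rule LIMSEQ_le[OF tendsto_norm[OF h[OF f(1)]]
            tendsto_mult_right[OF norm_abs_ptensor[OF f(1)], of K], folded f(2)])
        (use L_bound in \<open>simp add: mult.commute\<close>)
  qed
  have "bounded_linear h"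
    by (rule bounded_linear_intro[OF h_add _ h_bound]) (simp add: scaleR_scaleC h_scale)
  then have "continuous_on UNIV h"
    by (rule bounded_linear.continuous_on[OF _ continuous_on_id])
  moreover have "h (x \<otimes>\<^sub>\<gamma> y) = G x y" for x y
    using h[OF proj_Cauchy_const[of "pure_tensor x y"]]
    by (simp add: L_pure LIMSEQ_const_iff ptens_def tensor_incl_def)
  ultimately show ?thesis using h_add h_scale by (auto simp: clinear_def)
qed

theorem ptensor_ext:
  fixes G :: "'a::complex_normed_vector \<Rightarrow> 'b::complex_normed_vector \<Rightarrow>
    'c::{complex_normed_vector, banach}"
  assumes "\<And>x. clinear (G x)" "\<And>y. clinear (\<lambda>x. G x y)"
    and "K \<ge> 0" "\<And>x y. norm (G x y) \<le> K * (norm x * norm y)"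
  shows "clinear (ptensor_ext G)" "continuous_on UNIV (ptensor_ext G)"
    "ptensor_ext G (x \<otimes>\<^sub>\<gamma> y) = G x y"
proof -
  have "\<exists>!h. clinear h \<and> continuous_on UNIV h \<and> (\<forall>x y. h (x \<otimes>\<^sub>\<gamma> y) = G x y)"
  proof (rule ex_ex1I)
    show "\<exists>h. clinear h \<and> continuous_on UNIV h \<and> (\<forall>x y. h (x \<otimes>\<^sub>\<gamma> y) = G x y)"
      using ptensor_ext_exists[OF assms] .
  qed (auto intro: ptensor_ext_unique)
  from theI'[OF this, folded ptensor_ext_def]
  show "clinear (ptensor_ext G)" "continuous_on UNIV (ptensor_ext G)"
    "ptensor_ext G (x \<otimes>\<^sub>\<gamma> y) = G x y" by auto
qed

text \<open>For *-isomorphisms of C*-algebras, which are automatically isometric, the map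
  \<open>(x, y) \<mapsto> f x \<otimes> g y\<close> is bounded and bilinear, so that \<open>ptensor_map f g\<close> is a genuine extension.\<close>

definition ptensor_map ::
  "('a::complex_normed_vector \<Rightarrow> 'c::complex_normed_vector) \<Rightarrow>
   ('b::complex_normed_vector \<Rightarrow> 'd::complex_normed_vector) \<Rightarrow>
   ('a, 'b) ptensor \<Rightarrow> ('c, 'd) ptensor" where
  "ptensor_map f g = ptensor_ext (\<lambda>x y. f x \<otimes>\<^sub>\<gamma> g y)"

definition flip ::
  "('a::complex_normed_vector, 'b::complex_normed_vector) ptensor \<Rightarrow> ('b, 'a) ptensor" where
  "flip = ptensor_ext (\<lambda>x y. y \<otimes>\<^sub>\<gamma> x)"

lemma flip:
  shows "clinear flip" "continuous_on UNIV flip" "flip (x \<otimes>\<^sub>\<gamma> y) = y \<otimes>\<^sub>\<gamma> x"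
  unfolding flip_def
  by (rule ptensor_ext[where K = 1];
      auto simp: clinear_def ptens_add_left ptens_add_right ptens_scaleC_left ptens_scaleC_right
        mult.commute intro: order.trans[OF norm_ptens_le])+

lemma ptensor_map:
  assumes "clinear f" "clinear g" "\<And>x. norm (f x) \<le> K * norm x" "\<And>y. norm (g y) \<le> L * norm y"
    and "K \<ge> 0" "L \<ge> 0"
  shows "clinear (ptensor_map f g)" "continuous_on UNIV (ptensor_map f g)"
    "ptensor_map f g (x \<otimes>\<^sub>\<gamma> y) = f x \<otimes>\<^sub>\<gamma> g y"
proof -
  have "norm (f x \<otimes>\<^sub>\<gamma> g y) \<le> (K * L) * (norm x * norm y)" for x y
  proof -
    have "norm (f x \<otimes>\<^sub>\<gamma> g y) \<le> norm (f x) * norm (g y)" by (rule norm_ptens_le)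
    also have "\<dots> \<le> (K * norm x) * (L * norm y)" using assms by (intro mult_mono) auto
    finally show ?thesis by (simp add: algebra_simps)
  qed
  note ext = ptensor_ext[where G = "\<lambda>x y. f x \<otimes>\<^sub>\<gamma> g y", OF _ _ _ this]
  show "clinear (ptensor_map f g)" "continuous_on UNIV (ptensor_map f g)"
    "ptensor_map f g (x \<otimes>\<^sub>\<gamma> y) = f x \<otimes>\<^sub>\<gamma> g y"
    unfolding ptensor_map_def
    by (rule ext; use assms in \<open>auto simp: clinear_def ptens_add_left ptens_add_right
      ptens_scaleC_left ptens_scaleC_right\<close>)+
qed

end

theory Submission
  imports Defs "HOL-Complex_Analysis.Complex_Analysis"
begin

text \<open>Write \<open>D\<close> for the projective tensor product of \<open>A\<close> and \<open>B\<close>, and call a functional of norm at most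
one with value \<open>1\<close> at \<open>1\<close> a state. The difficulty of working in \<open>D\<close> is that its elements are known
only through the slices \<open>A \<leftarrow> D \<rightarrow> B\<close> given by functionals of the other factor. This
shapes each of the three arguments.

Isometric automorphisms. If \<open>h\<close> is self-adjoint, then \<open>1 + i t h\<close> has norm \<open>1 + O(t\<^sup>2)\<close>, so that
\<open>\<theta> (h \<otimes> 1)\<close> is a Hermitian element of \<open>D\<close>: all states of \<open>D\<close> are real on it. The Kaijser-Sinclair theorem
(\<open>hermitian_decomposition\<close>) says that a self-adjoint Hermitian element has the form \<open>a \<otimes> 1 + 1 \<otimes> b\<close>.
Its proof uses that a state \<open>\<Phi>\<close> of \<open>D\<close> with marginals \<open>f, g\<close> satisfies, on self-adjoint \<open>h, k\<close>, the
covariance bound \<open>|Re \<Phi>(h \<otimes> k) - f(h) g(k)|\<^sup>2 \<le> var\<^sub>f(h) var\<^sub>g(k)\<close>; therefore the covariance form may be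
multiplied by any small complex number without leaving the states, and reality forces it to vanish on
Hermitian elements. The same perturbation argument with product states shows that a Hermitian element minus
suitable one-sided terms is annihilated by every state, and such an element is zero
(\<open>numerical_range_zero_imp_zero\<close>). Now \<open>\<theta>\<close> maps \<open>A \<otimes> 1\<close> into \<open>A \<otimes> 1 + 1 \<otimes> B\<close>, and since the image is
closed under squares, every \<open>\<theta> (a \<otimes> 1)\<close> lies in \<open>A \<otimes> 1\<close> or in \<open>1 \<otimes> B\<close>. As a group is not the union of
two proper subgroups, \<open>\<theta>\<close> preserves or exchanges the two factors (\<open>isometric_automorphism_cases\<close>).

Inner tensor products. If a unitary \<open>u\<close> of \<open>D\<close> implements \<open>\<phi> \<otimes> \<psi>\<close>, then the slices of \<open>u\<close> in \<open>B\<close>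
intertwine the identity with \<open>\<psi>\<close>, so that products \<open>v\<^sup>* w\<close> of them are central. Choose a state \<open>F\<close> of \<open>B\<close> that
is multiplicative on the centre (\<open>central_state_exists\<close>); it makes all these slices proportional to a
single one, and the slice of \<open>u\<close> by \<open>F(v\<^sup>* \<cdot>)\<close> is then a multiple of a unitary of \<open>A\<close> implementing \<open>\<phi>\<close>
(\<open>tensor_intertwiner_imp_inner\<close>).

The flip. If a unitary \<open>u\<close> satisfies \<open>u (a \<otimes> 1) = (1 \<otimes> \<rho> a) u\<close>, approximate \<open>u\<close> by a finite sum of
elementary tensors; slicing \<open>u\<^sup>* (1 \<otimes> \<rho> a) u = a \<otimes> 1\<close> shows that the identity of \<open>A\<close> is within distance less
than one of a finite rank map. Hence \<open>A\<close> is finite-dimensional. The same relation shows that \<open>A\<close> is prime,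
and a prime finite-dimensional C*-algebra is a matrix algebra. So a map of flip type is always outer under
the hypothesis of the theorem.

Functionals come from one source, an application of Zorn's lemma to convex cones (\<open>cone_functional\<close>),
which yields the Hahn-Banach theorem, states with a prescribed value, and states multiplicative on the
centre. That *-isomorphisms are isometric, and that squares of self-adjoint elements are positive in the sense needed,
is derived from square roots of \<open>1 - x\<close> for \<open>\<parallel>x\<parallel> < 1\<close>, without spectral theory.\<close>

section \<open>Linear maps and the involution\<close>

instance unital_cstar_algebra \<subseteq> real_normed_algebra_1
  by standard (rule cstar_norm_one)

lemma clinear_add: "clinear f \<Longrightarrow> f (x + y) = f x + f y"
  and clinear_scaleC: "clinear f \<Longrightarrow> f (c *\<^sub>C x) = c *\<^sub>C f x"
  by (simp_all add: clinear_def)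

lemma clinear_zero: "clinear f \<Longrightarrow> f 0 = 0"
  using clinear_scaleC[of f 0 0] by simp

lemma clinear_diff: "clinear f \<Longrightarrow> f (x - y) = f x - f y"
  using clinear_add[of f "x - y" y] by (simp add: algebra_simps)

lemma clinear_scaleR:
  fixes f :: "'a::complex_normed_vector \<Rightarrow> 'b::complex_normed_vector"
  shows "clinear f \<Longrightarrow> f (r *\<^sub>R x) = r *\<^sub>R f x"
  by (simp add: scaleR_scaleC clinear_scaleC)

lemma clinear_sum: "clinear f \<Longrightarrow> f (sum g I) = (\<Sum>i\<in>I. f (g i))"
  by (induction I rule: infinite_finite_induct) (auto simp: clinear_zero clinear_add)

lemma clinear_bounded_linear:
  fixes f :: "'a::complex_normed_vector \<Rightarrow> 'b::complex_normed_vector"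
  assumes "clinear f" "\<And>x. norm (f x) \<le> K * norm x"
  shows "bounded_linear f"
  by (rule bounded_linear_intro[where K = K])
    (use assms in \<open>auto simp: clinear_add clinear_scaleR mult.commute\<close>)

lemma scaleC_complex [simp]: "(c::complex) *\<^sub>C d = c * d"
  by (simp add: scaleC_complex_def)

lemma star_complex [simp]: "star (c::complex) = cnj c"
  by (simp add: star_complex_def)

lemma scaleC_minus_left: "(- c) *\<^sub>C x = - (c *\<^sub>C (x::'a::complex_vector))"
  using scaleC_add_left[of c "- c" x] by (simp add: eq_neg_iff_add_eq_0 add.commute)

lemma star_minus: "star (- x) = - star (x::'a::unital_star_algebra)"
  using star_diff[of 0 x] by simp

lemma star_scaleR: "star (r *\<^sub>R x) = r *\<^sub>R star (x::'a::unital_banach_star_algebra)"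
  by (simp add: scaleR_scaleC star_scaleC)

lemma bounded_linear_star: "bounded_linear (star :: 'a \<Rightarrow> 'a::unital_banach_star_algebra)"
  by (rule bounded_linear_intro[where K = 1]) (simp_all add: star_add star_scaleR norm_star)

lemma star_mult_self_eq_0: "star x * x = 0 \<Longrightarrow> x = (0::'a::unital_cstar_algebra)"
  using norm_star_mult_self[of x] by simp

lemma norm_selfadjoint_square:
  "star h = h \<Longrightarrow> norm (h * h) = (norm (h::'a::unital_cstar_algebra))\<^sup>2"
  using norm_star_mult_self[of h] by simp

lemma norm_unitary: "star u * u = 1 \<Longrightarrow> norm (u::'a::unital_cstar_algebra) = 1"
  using norm_star_mult_self[of u] norm_ge_zero[of u] by (simp add: power2_eq_1_iff)

section \<open>Square roots, and isometry of *-isomorphisms\<close>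

text \<open>The element \<open>y = 1 - w\<close> solves \<open>y = (x + y\<^sup>2) / 2\<close>. On the ball of radius \<open>\<parallel>x\<parallel>\<close> the right-hand side is a
contraction that preserves self-adjointness and the commutant of \<open>x\<close>, so that the fixed point has these
properties without any computation.\<close>

lemma sqrt_one_minus:
  fixes x :: "'a::unital_cstar_algebra"
  assumes "norm x < 1" "star x = x"
  obtains w where "star w = w" "w * w = 1 - x" "\<And>c. c * x = x * c \<Longrightarrow> c * w = w * c"
proof -
  define S where "S = cball 0 (norm x) \<inter> {y. star y = y} \<inter> (\<Inter>c\<in>{c. c * x = x * c}. {y. c * y = y * c})"
  define T where "T y = (1/2) *\<^sub>R (x + y * y)" for y
  have "closed S"
    unfolding S_def
    by (intro closed_Int closed_INT ballI closed_cball closed_Collect_eq continuous_intros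
        linear_continuous_on bounded_linear_star)
  have "\<exists>!y\<in>S. T y = y"
  proof (rule Banach_fix[where c = "norm x"])
    show "complete S" using \<open>closed S\<close> by (simp add: complete_eq_closed)
    have "0 \<in> S" by (simp add: S_def)
    then show "S \<noteq> {}" by blast
    show "T ` S \<subseteq> S"
    proof (safe, unfold S_def, safe)
      fix y assume y: "y \<in> cball 0 (norm x)" "star y = y"
        and c: "y \<in> (\<Inter>c\<in>{c. c * x = x * c}. {y. c * y = y * c})"
      have "norm (y * y) \<le> norm x * norm x"
        using y by (intro order.trans[OF norm_mult_ineq] mult_mono) auto
      also have "\<dots> \<le> norm x" using assms by (simp add: mult_left_le)
      finally have "norm (x + y * y) \<le> 2 * norm x" by (intro order.trans[OF norm_triangle_ineq]) simp
      then show "T y \<in> cball 0 (norm x)" by (simp add: T_def)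
      show "star (T y) = T y" using y assms by (simp add: T_def star_scaleR star_add star_mult)
      show "d * T y = T y * d" if d: "d * x = x * d" for d
      proof -
        have e: "d * y = y * d" using c d by auto
        have "d * (y * y) = y * y * d" by (metis e mult.assoc)
        then show ?thesis using d by (simp add: T_def algebra_simps)
      qed
    qed
    show "dist (T y) (T z) \<le> norm x * dist y z" if "y \<in> S" "z \<in> S" for y z
    proof -
      have "T y - T z = (1/2) *\<^sub>R (y * (y - z) + (y - z) * z)" by (simp add: T_def algebra_simps)
      also have "norm \<dots> \<le> (1/2) * (norm y * norm (y - z) + norm (y - z) * norm z)"
        by (simp add: norm_triangle_le add_mono norm_mult_ineq)
      also have "\<dots> \<le> (1/2) * (norm x * norm (y - z) + norm (y - z) * norm x)"
        using that by (intro mult_left_mono add_mono mult_right_mono) (auto simp: S_def)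
      finally show ?thesis by (simp add: dist_norm)
    qed
  qed (use assms in auto)
  then obtain y where y: "y \<in> S" "T y = y" by blast
  have eq: "x + y * y = 2 *\<^sub>R y"
  proof -
    have "2 *\<^sub>R T y = x + y * y" by (simp add: T_def)
    then show ?thesis using y by simp
  qed
  show ?thesis
  proof (rule that[of "1 - y"])
    have "(1 - y) * (1 - y) = 1 - (2 *\<^sub>R y - y * y)" by (simp add: algebra_simps scaleR_2)
    then show "(1 - y) * (1 - y) = 1 - x" by (simp flip: eq)
    show "c * (1 - y) = (1 - y) * c" if "c * x = x * c" for c
      using y(1) that by (auto simp: S_def algebra_simps)
  qed (use y in \<open>simp add: S_def star_diff\<close>)
qed

text \<open>The hypotheses say that \<open>h + i w\<close> is unitary; \<open>h\<close> and \<open>w\<close> are its real and imaginary parts.\<close>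

lemma norm_le_1_of_sum_squares:
  fixes h w :: "'a::unital_cstar_algebra"
  assumes "star h = h" "star w = w" "h * w = w * h" "h * h + w * w = 1"
  shows "norm h \<le> 1" "norm w \<le> 1"
proof -
  define u where "u = h + \<i> *\<^sub>C w"
  have su: "star u = h - \<i> *\<^sub>C w"
    using assms by (simp add: u_def star_add star_scaleC scaleC_minus_left)
  have "star u * u = 1" "u * star u = 1"
    using assms by (simp_all add: su, simp_all add: u_def algebra_simps mult_scaleC_left mult_scaleC_right scaleC_scaleC scaleC_minus_one
        scaleC_add_right scaleC_diff_right)
  then have n: "norm u = 1" "norm (star u) = 1" by (simp_all add: norm_unitary norm_star)
  have "2 *\<^sub>R h = u + star u" by (simp add: su scaleR_2, simp add: u_def)
  then have "2 * norm h \<le> 2" using norm_triangle_ineq[of u "star u"] n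
    by (metis norm_scaleR abs_numeral one_add_one)
  then show "norm h \<le> 1" by simp
  have "(2 * \<i>) *\<^sub>C w = u - star u" 
    by (simp add: su, simp add: u_def mult.commute flip: scaleC_add_left)
  then have "2 * norm w \<le> 2" using norm_triangle_ineq4[of u "star u"] n
    by (metis norm_scaleC norm_mult norm_ii norm_numeral mult.right_neutral one_add_one)
  then show "norm w \<le> 1" by simp
qed

lemma scaleR_4: "4 *\<^sub>R x = 2 *\<^sub>R x + 2 *\<^sub>R (x::'a::real_vector)"
  by (simp flip: scaleR_left_distrib)

text \<open>With \<open>w\<close> the square root of \<open>1 - h\<^sup>2\<close>, the pair \<open>(h, w)\<close> is a sine and a cosine: \<open>1 - h\<^sup>2 = w\<^sup>2\<close>, and
\<open>1 - 2 h\<^sup>2 = w\<^sup>2 - h\<^sup>2\<close> is the cosine of the doubled angle, whose sine is \<open>2 h w\<close>. These two estimates are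
the substitute for the positivity of \<open>h\<^sup>2\<close>.\<close>

lemma norm_one_minus_square:
  fixes h :: "'a::unital_cstar_algebra"
  assumes "star h = h" "norm h < 1"
  shows "norm (1 - h * h) \<le> 1" "norm (1 - 2 *\<^sub>R (h * h)) \<le> 1"
proof -
  have n: "norm (h * h) < 1"
    using assms by (simp add: norm_selfadjoint_square power_less_one_iff)
  have s: "star (h * h) = h * h" by (simp add: assms star_mult)
  obtain w where w: "star w = w" "w * w = 1 - h * h" "\<And>c. c * (h * h) = (h * h) * c \<Longrightarrow> c * w = w * c"
    by (rule sqrt_one_minus[OF n s]) metis
  have c: "h * w = w * h" using w(3)[of h] by (simp add: mult.assoc)
  have "norm w \<le> 1" by (rule norm_le_1_of_sum_squares(2)[of h w]) (simp_all add: assms w(1,2) c)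
  then show "norm (1 - h * h) \<le> 1"
    using w(1,2) norm_selfadjoint_square[OF w(1)] by (simp add: power_le_one)
  have c2: "w * (h * z) = h * (w * z)" for z by (simp add: c flip: mult.assoc)
  have "norm (w * w - h * h) \<le> 1"
  proof (rule norm_le_1_of_sum_squares(1)[of _ "2 *\<^sub>R (h * w)"])
    show "star (w * w - h * h) = w * w - h * h" by (simp add: star_diff star_mult w(1,2) assms)
    show "star (2 *\<^sub>R (h * w)) = 2 *\<^sub>R (h * w)" by (simp add: star_scaleR star_mult w(1,2) assms c)
    have "w * w * (h * w) = h * w * (w * w)" "h * h * (h * w) = h * w * (h * h)"
      by (simp_all add: mult.assoc c2 flip: c)
    then show "(w * w - h * h) * (2 *\<^sub>R (h * w)) = 2 *\<^sub>R (h * w) * (w * w - h * h)"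
      by (simp add: algebra_simps)
    have "h * w * (h * w) = h * h * (w * w)" "w * w * (h * h) = h * h * (w * w)"
      by (simp_all add: mult.assoc c2 flip: c)
    then have "(w * w - h * h) * (w * w - h * h) + 2 *\<^sub>R (h * w) * (2 *\<^sub>R (h * w))
        = (w * w + h * h) * (w * w + h * h)"
      by (simp add: algebra_simps scaleR_2 scaleR_4)
    then show "(w * w - h * h) * (w * w - h * h) + 2 *\<^sub>R (h * w) * (2 *\<^sub>R (h * w)) = 1"
      by (simp add: w(2))
  qed
  then show "norm (1 - 2 *\<^sub>R (h * h)) \<le> 1"
    by (simp add: w(2) scaleR_2 algebra_simps)
qed

definition real_part :: "'a::unital_banach_star_algebra \<Rightarrow> 'a" where
  "real_part x = (1/2) *\<^sub>R (x + star x)"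

definition imag_part :: "'a::unital_banach_star_algebra \<Rightarrow> 'a" where
  "imag_part x = (1/2) *\<^sub>R (- \<i> *\<^sub>C (x - star x))"

lemma star_real_part [simp]: "star (real_part x) = real_part x"
  by (simp add: real_part_def star_scaleR star_add star_star add.commute)

lemma star_imag_part [simp]: "star (imag_part x) = imag_part x"
  by (simp add: imag_part_def star_scaleR star_scaleC star_minus star_diff star_star scaleC_diff_right
      scaleC_minus_left)

lemma real_imag_part: "real_part x + \<i> *\<^sub>C imag_part x = x"
  by (simp add: real_part_def imag_part_def scaleR_scaleC scaleC_scaleC scaleC_diff_right
      scaleC_minus_left scaleC_minus_right scaleC_add_right flip: scaleC_add_left)
    (simp add: scaleC_one flip: scaleC_add_left)

lemma star_isomorphism_clinear: "star_isomorphism f \<Longrightarrow> clinear f"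
  and star_isomorphism_bij: "star_isomorphism f \<Longrightarrow> bij f"
  and star_isomorphism_mult: "star_isomorphism f \<Longrightarrow> f (x * y) = f x * f y"
  and star_isomorphism_star: "star_isomorphism f \<Longrightarrow> f (star x) = star (f x)"
  by (simp_all add: star_isomorphism_def)

lemma star_isomorphism_one:
  assumes "star_isomorphism f"
  shows "f 1 = 1"
proof -
  obtain e where e: "f e = 1" using star_isomorphism_bij[OF assms] by (metis bij_pointE)
  have "f 1 = f 1 * f e" by (simp add: e)
  also have "\<dots> = f e" using star_isomorphism_mult[OF assms, of 1 e] by simp
  finally show ?thesis by (simp add: e)
qed

lemma star_isomorphism_inv:
  assumes "star_isomorphism f"
  shows "star_isomorphism (inv_into UNIV f)"
proof -
  have f: "bij f" by (rule star_isomorphism_bij[OF assms])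
  have i: "inv_into UNIV f y = x \<longleftrightarrow> y = f x" for x y using f by (metis bij_inv_eq_iff)
  have s: "f (inv_into UNIV f y) = y" for y using f by (simp add: bij_is_surj surj_f_inv_f)
  show ?thesis
    using assms f unfolding star_isomorphism_def clinear_def
    by (auto simp: bij_imp_bij_inv i s)
qed

text \<open>If \<open>h\<close> is self-adjoint with \<open>\<parallel>h\<parallel> < 1\<close> and \<open>w\<close> is the square root of \<open>1 - h\<^sup>2\<close>, then \<open>h + i w\<close> is unitary. An
isomorphism maps it to a unitary with real part \<open>f h\<close>, whence \<open>\<parallel>f h\<parallel> \<le> 1\<close>. The C*-identity extends the
bound to all elements.\<close>

lemma star_isomorphism_contractive:
  fixes f :: "'a::unital_cstar_algebra \<Rightarrow> 'b::unital_cstar_algebra"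
  assumes f: "star_isomorphism f"
  shows "norm (f x) \<le> norm x"
proof -
  note [simp] = clinear_scaleR[OF star_isomorphism_clinear[OF f]] star_isomorphism_one[OF f]
    clinear_add[OF star_isomorphism_clinear[OF f]] clinear_diff[OF star_isomorphism_clinear[OF f]]
  have small: "norm (f h) \<le> 1" if h: "star h = h" "norm h < 1" for h
  proof -
    have n: "norm (h * h) < 1"
      using h by (simp add: norm_selfadjoint_square power_less_one_iff)
    have s: "star (h * h) = h * h" by (simp add: h star_mult)
    obtain w where w: "star w = w" "w * w = 1 - h * h" "\<And>c. c * (h * h) = (h * h) * c \<Longrightarrow> c * w = w * c"
      by (rule sqrt_one_minus[OF n s]) metis
    have c: "h * w = w * h" using w(3)[of h] by (simp add: mult.assoc)
    show ?thesis
    proof (rule norm_le_1_of_sum_squares(1)[of _ "f w"])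
      show "star (f h) = f h" "star (f w) = f w"
        using h w(1) by (simp_all flip: star_isomorphism_star[OF f])
      show "f h * f w = f w * f h" using c by (simp flip: star_isomorphism_mult[OF f])
      show "f h * f h + f w * f w = 1" using w(2) by (simp flip: star_isomorphism_mult[OF f])
    qed
  qed
  have sa: "norm (f h) \<le> norm h" if h: "star h = h" for h
  proof (rule field_le_epsilon)
    fix e :: real assume e: "e > 0"
    have p: "norm h + e > 0" using e norm_ge_zero[of h] by linarith
    have "norm (f ((1 / (norm h + e)) *\<^sub>R h)) \<le> 1"
      by (rule small) (use h e p in \<open>auto simp: star_scaleR\<close>)
    then show "norm (f h) \<le> norm h + e" using p by (simp add: divide_le_eq)
  qed
  have "(norm (f x))\<^sup>2 = norm (f (star x * x))"
    by (simp add: norm_star_mult_self star_isomorphism_mult[OF f] star_isomorphism_star[OF f])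
  also have "\<dots> \<le> (norm x)\<^sup>2"
    using sa[of "star x * x"] by (simp add: star_mult star_star norm_star_mult_self)
  finally show ?thesis by simp
qed

lemma star_isomorphism_isometric:
  fixes f :: "'a::unital_cstar_algebra \<Rightarrow> 'b::unital_cstar_algebra"
  assumes f: "star_isomorphism f"
  shows "norm (f x) = norm x"
proof (rule antisym)
  show "norm x \<le> norm (f x)"
    using star_isomorphism_contractive[OF star_isomorphism_inv[OF f], of "f x"]
    by (simp add: bij_is_inj[OF star_isomorphism_bij[OF f]])
qed (rule star_isomorphism_contractive[OF f])

section \<open>Functionals positive on a cone\<close>

text \<open>A maximal convex cone \<open>T\<close> that contains \<open>C\<close>, is stable under the commuting operators \<open>S\<close> and does not contain
\<open>- e\<close> satisfies \<open>T \<union> - T = UNIV\<close>, by the argument that gives the real points of an Archimedean real ring.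
Hence \<open>f v = sup {r. v - r e \<in> T}\<close> is linear. Since \<open>T\<close> is stable under \<open>\<sigma> \<in> S\<close>, the condition \<open>v - r e \<in> T\<close> implies
\<open>\<sigma> v - r \<sigma> e \<in> T\<close>, which is half of the multiplicativity property; the other half is the same for \<open>- v\<close>.\<close>

lemma cone_functional:
  fixes C :: "'v::real_vector set" and S :: "('v \<Rightarrow> 'v) set"
  assumes add: "\<And>x y. x \<in> C \<Longrightarrow> y \<in> C \<Longrightarrow> x + y \<in> C"
    and unit: "\<And>v. \<exists>r. r *\<^sub>R e - v \<in> C" "e \<in> C" "- e \<notin> C"
    and linS: "\<And>\<sigma> x y. \<sigma> \<in> S \<Longrightarrow> \<sigma> (x + y) = \<sigma> x + \<sigma> y"
    and CS: "\<And>\<sigma> x. \<sigma> \<in> S \<Longrightarrow> x \<in> C \<Longrightarrow> \<sigma> x \<in> C"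
    and compS: "\<And>\<sigma> \<tau>. \<sigma> \<in> S \<Longrightarrow> \<tau> \<in> S \<Longrightarrow> (\<lambda>x. \<sigma> (\<tau> x)) \<in> S"
    and addS: "\<And>\<sigma> \<tau>. \<sigma> \<in> S \<Longrightarrow> \<tau> \<in> S \<Longrightarrow> (\<lambda>x. \<sigma> x + \<tau> x) \<in> S"
    and commS: "\<And>\<sigma> \<tau> x. \<sigma> \<in> S \<Longrightarrow> \<tau> \<in> S \<Longrightarrow> \<sigma> (\<tau> x) = \<tau> (\<sigma> x)"
    and scaleS: "\<And>r. r \<ge> 0 \<Longrightarrow> (\<lambda>x. r *\<^sub>R x) \<in> S"
  obtains f :: "'v \<Rightarrow> real" where "linear f" "\<And>x. x \<in> C \<Longrightarrow> f x \<ge> 0" "f e = 1"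
    "\<And>\<sigma> x. \<sigma> \<in> S \<Longrightarrow> f (\<sigma> x) = f (\<sigma> e) * f x"
proof -
  have S0: "\<sigma> 0 = 0" if "\<sigma> \<in> S" for \<sigma> using linS[OF that, of 0 0] by simp
  have Sminus: "\<sigma> (- x) = - \<sigma> x" if "\<sigma> \<in> S" for \<sigma> x
    using linS[OF that, of x "- x"] S0[OF that] by (simp add: eq_neg_iff_add_eq_0 add.commute)
  have C0: "0 \<in> C" using CS[OF scaleS[of 0] unit(2)] by simp
  define \<T> where "\<T> = {T. C \<subseteq> T \<and> (\<forall>x\<in>T. \<forall>y\<in>T. x + y \<in> T) \<and> (\<forall>\<sigma>\<in>S. \<forall>x\<in>T. \<sigma> x \<in> T) \<and> - e \<notin> T}"
  have "\<exists>T\<in>\<T>. \<forall>X\<in>\<T>. T \<subseteq> X \<longrightarrow> X = T"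
  proof (rule subset_Zorn_nonempty)
    show "\<T> \<noteq> {}" using add unit CS by (auto simp: \<T>_def intro!: exI[of _ C])
    fix \<C> assume \<C>: "\<C> \<noteq> {}" "subset.chain \<T> \<C>"
    then have sub: "T \<in> \<T>" if "T \<in> \<C>" for T using that by (auto simp: subset.chain_def)
    have tot: "T \<subseteq> T' \<or> T' \<subseteq> T" if "T \<in> \<C>" "T' \<in> \<C>" for T T'
      using \<C> that by (auto simp: subset.chain_def)
    show "\<Union>\<C> \<in> \<T>"
      unfolding \<T>_def mem_Collect_eq
    proof (intro conjI ballI)
      obtain T where "T \<in> \<C>" using \<C>(1) by blast
      then show "C \<subseteq> \<Union>\<C>" using sub[of T] by (auto simp: \<T>_def)
      show "- e \<notin> \<Union>\<C>" using sub by (auto simp: \<T>_def)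
      fix x assume "x \<in> \<Union>\<C>"
      then obtain T where T: "x \<in> T" "T \<in> \<C>" by blast
      show "\<sigma> x \<in> \<Union>\<C>" if "\<sigma> \<in> S" for \<sigma>
        using sub[OF T(2)] T that unfolding \<T>_def by blast
      fix y assume "y \<in> \<Union>\<C>"
      then obtain T' where T': "y \<in> T'" "T' \<in> \<C>" by blast
      obtain T'' where "x \<in> T''" "y \<in> T''" "T'' \<in> \<C>" using tot[OF T(2) T'(2)] T T' by blast
      then show "x + y \<in> \<Union>\<C>" using sub[of T''] by (auto simp: \<T>_def)
    qed
  qed
  then obtain T where "T \<in> \<T>" and max: "\<And>X. X \<in> \<T> \<Longrightarrow> T \<subseteq> X \<Longrightarrow> X = T" by blast
  then have CT: "\<And>x. x \<in> C \<Longrightarrow> x \<in> T" and Tadd: "\<And>x y. x \<in> T \<Longrightarrow> y \<in> T \<Longrightarrow> x + y \<in> T"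
    and TS: "\<And>\<sigma> x. \<sigma> \<in> S \<Longrightarrow> x \<in> T \<Longrightarrow> \<sigma> x \<in> T" and Te: "- e \<notin> T"
    by (auto simp: \<T>_def)
  have Tscale: "r *\<^sub>R x \<in> T" if "r \<ge> 0" "x \<in> T" for r x using TS[OF scaleS[OF that(1)] that(2)] .
  have T0: "0 \<in> T" using CT C0 by blast
  \<comment> \<open>Maximality: adjoining \<open>b\<close> must produce \<open>- e\<close>.\<close>
  have extend: "\<exists>s\<in>T. \<exists>\<sigma>\<in>S. - e = s + \<sigma> b" if b: "b \<notin> T" for b
  proof (rule ccontr)
    assume no: "\<not> ?thesis"
    define X where "X = {s + \<sigma> b |s \<sigma>. s \<in> T \<and> \<sigma> \<in> S}"
    have TX: "T \<subseteq> X"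
    proof
      fix s assume "s \<in> T"
      then have "\<exists>s' \<sigma>. s = s' + \<sigma> b \<and> s' \<in> T \<and> \<sigma> \<in> S"
        using scaleS[of 0] by (intro exI[of _ s] exI[of _ "\<lambda>x. 0 *\<^sub>R x"]) auto
      then show "s \<in> X" by (simp add: X_def)
    qed
    have "X \<in> \<T>"
      unfolding \<T>_def
    proof (safe)
      show "x \<in> X" if "x \<in> C" for x using that CT TX by blast
      show "- e \<in> X \<Longrightarrow> False" using no by (auto simp: X_def)
      fix x assume "x \<in> X"
      then obtain s \<sigma> where x: "x = s + \<sigma> b" "s \<in> T" "\<sigma> \<in> S" by (auto simp: X_def)
      { fix y assume "y \<in> X"
        then obtain s' \<sigma>' where y: "y = s' + \<sigma>' b" "s' \<in> T" "\<sigma>' \<in> S" by (auto simp: X_def)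
        have "x + y = (s + s') + (\<lambda>x. \<sigma> x + \<sigma>' x) b" by (simp add: x y)
        then show "x + y \<in> X" unfolding X_def mem_Collect_eq
          using Tadd[OF x(2) y(2)] addS[OF x(3) y(3)] by (intro exI conjI) }
      { fix \<tau> assume t: "\<tau> \<in> S"
        have "\<tau> x = \<tau> s + (\<lambda>x. \<tau> (\<sigma> x)) b" by (simp add: x linS[OF t])
        then show "\<tau> x \<in> X" unfolding X_def mem_Collect_eq
          using TS[OF t x(2)] compS[OF t x(3)] by (intro exI conjI) }
    qed
    then have "X = T" using max TX by blast
    moreover have "b \<in> X"
      unfolding X_def using T0 scaleS[of 1] by (auto intro!: exI[of _ 0] exI[of _ "\<lambda>x. 1 *\<^sub>R x"])
    ultimately show False using b by blast
  qed
  have total: "b \<in> T \<or> - b \<in> T" for b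
  proof (rule ccontr)
    assume "\<not> ?thesis"
    then obtain s \<sigma> s' \<sigma>' where 1: "s \<in> T" "\<sigma> \<in> S" "- e = s + \<sigma> b"
      and 2: "s' \<in> T" "\<sigma>' \<in> S" "- e = s' + \<sigma>' (- b)" using extend by metis
    have b1: "\<sigma> b = - e - s" using 1(3) by simp
    have b2: "\<sigma>' b = e + s'" using 2(3) by (simp add: Sminus[OF 2(2)] algebra_simps)
    have "\<sigma>' (\<sigma> b) = \<sigma> (\<sigma>' b)" by (rule commS[OF 2(2) 1(2)])
    then have "- \<sigma>' e - \<sigma>' s = \<sigma> e + \<sigma> s'"
      using linS[OF 1(2)] linS[OF 2(2), of "- e" "- s"] by (simp add: b1 b2 Sminus[OF 2(2)])
    then have "\<sigma> e = - \<sigma>' e - \<sigma>' s - \<sigma> s'" by (metis add_diff_cancel_right')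
    then have "- \<sigma> e = \<sigma>' e + (\<sigma>' s + \<sigma> s')" by simp
    \<comment> \<open>The two representations of \<open>- e\<close> put \<open>\<plusminus> \<sigma> e\<close> into \<open>T\<close>; as \<open>b\<close> is bounded by a multiple of \<open>e\<close>,
      also \<open>\<sigma> b\<close> lies in \<open>T\<close>.\<close>
    then have m: "- \<sigma> e \<in> T" using Tadd TS 1 2 CT unit(2) by simp
    obtain K where K: "K *\<^sub>R e - (- b) \<in> C" using unit(1) by blast
    have ke: "\<bar>K\<bar> *\<^sub>R e + b \<in> T"
    proof -
      have "(\<bar>K\<bar> - K) *\<^sub>R e + (K *\<^sub>R e + b) \<in> T"
        using Tadd[OF Tscale[of "\<bar>K\<bar> - K" e]] CT[OF unit(2)] CT[OF K] by simp
      then show ?thesis by (simp add: algebra_simps)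
    qed
    have sK: "\<sigma> (\<bar>K\<bar> *\<^sub>R e) = \<bar>K\<bar> *\<^sub>R \<sigma> e" by (rule commS[OF 1(2) scaleS]) simp
    have "\<sigma> (\<bar>K\<bar> *\<^sub>R e + b) + \<bar>K\<bar> *\<^sub>R (- \<sigma> e) \<in> T"
      by (intro Tadd Tscale TS[OF 1(2)] ke m) simp
    then have "\<sigma> b \<in> T" by (simp add: linS[OF 1(2)] sK)
    then show False using Tadd[OF 1(1)] 1(3) Te by metis
  qed
  have not_both: "r \<le> 0" if "r *\<^sub>R (- e) \<in> T" for r
  proof (rule ccontr)
    assume "\<not> r \<le> 0"
    then have "(1 / r) *\<^sub>R (r *\<^sub>R (- e)) \<in> T" by (intro Tscale that) auto
    then show False using Te \<open>\<not> r \<le> 0\<close> by simp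
  qed
  define L where "L v = {r. v - r *\<^sub>R e \<in> T}" for v
  define f where "f v = Sup (L v)" for v
  have Ldown: "s \<in> L v" if "r \<in> L v" "s \<le> r" for r s v
  proof -
    have "(v - r *\<^sub>R e) + (r - s) *\<^sub>R e \<in> T"
      using that CT[OF unit(2)] by (intro Tadd Tscale) (auto simp: L_def)
    then show ?thesis by (simp add: L_def algebra_simps)
  qed
  have Lne: "L v \<noteq> {}" for v
  proof -
    obtain r where "r *\<^sub>R e - (- v) \<in> C" using unit(1) by blast
    then have "- r \<in> L v" using CT by (simp add: L_def add.commute)
    then show ?thesis by blast
  qed
  have Lbdd: "bdd_above (L v)" for v
  proof -
    obtain r where r: "r *\<^sub>R e - v \<in> C" using unit(1) by blast
    have "s \<le> r" if "s \<in> L v" for s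
    proof -
      have "(r *\<^sub>R e - v) + (v - s *\<^sub>R e) \<in> T" using that CT[OF r] by (intro Tadd) (auto simp: L_def)
      then have "(s - r) *\<^sub>R (- e) \<in> T" by (simp add: algebra_simps)
      then show ?thesis using not_both[of "s - r"] by simp
    qed
    then show ?thesis by (rule bdd_aboveI)
  qed
  have f_ge: "f v \<ge> r" if "r \<in> L v" for r v
    unfolding f_def by (rule cSup_upper[OF that Lbdd])
  have in_L: "r \<in> L v" if "r < f v" for r v
    using less_cSup_iff[OF Lne Lbdd, of r v] that Ldown by (auto simp: f_def intro: less_imp_le)
  have in_L_minus: "- r \<in> L (- v)" if "r > f v" for r v
  proof -
    have "r \<notin> L v" using f_ge that by force
    then have "- (v - r *\<^sub>R e) \<in> T" using total[of "v - r *\<^sub>R e"] by (auto simp: L_def)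
    then show ?thesis by (simp add: L_def)
  qed
  have fT: "f x \<ge> 0" if "x \<in> T" for x using that by (intro f_ge) (simp add: L_def)
  have fe: "f e = 1"
  proof (rule antisym)
    show "1 \<le> f e" by (rule f_ge) (simp add: L_def T0)
    show "f e \<le> 1" unfolding f_def
    proof (rule cSup_least[OF Lne])
      fix r assume "r \<in> L e"
      then have "(r - 1) *\<^sub>R (- e) \<in> T" by (simp add: L_def algebra_simps)
      then show "r \<le> 1" using not_both[of "r - 1"] by simp
    qed
  qed
  have super: "f v + f w \<le> f (v + w)" for v w
  proof (rule field_le_epsilon)
    fix d :: real assume d: "d > 0"
    have "f v - d/2 \<in> L v" "f w - d/2 \<in> L w" using d by (auto intro!: in_L)
    then have "(v - (f v - d/2) *\<^sub>R e) + (w - (f w - d/2) *\<^sub>R e) \<in> T" by (intro Tadd) (auto simp: L_def)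
    moreover have "(v - (f v - d/2) *\<^sub>R e) + (w - (f w - d/2) *\<^sub>R e) = v + w - (f v - d/2 + (f w - d/2)) *\<^sub>R e"
      unfolding scaleR_left_distrib by simp
    ultimately have "v + w - (f v - d/2 + (f w - d/2)) *\<^sub>R e \<in> T" by simp
    then have "f v - d/2 + (f w - d/2) \<le> f (v + w)" by (intro f_ge) (simp add: L_def)
    then show "f v + f w \<le> f (v + w) + d" by simp
  qed
  have f0: "f 0 = 0"
  proof -
    have "f 0 + f e \<le> f e" using super[of 0 e] by simp
    then show ?thesis using fT[OF T0] by simp
  qed
  have minus: "f (- v) = - f v" for v
  proof (rule antisym)
    show "f (- v) \<le> - f v" using super[of v "- v"] f0 by simp
    show "- f v \<le> f (- v)"
    proof (rule field_le_epsilon)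
      fix d :: real assume "d > 0"
      then show "- f v \<le> f (- v) + d" using f_ge[OF in_L_minus[of v "f v + d"]] by simp
    qed
  qed
  have fadd: "f (v + w) = f v + f w" for v w
    using super[of v w] super[of "- v" "- w"] minus[of "v + w"] minus[of v] minus[of w]
    by (simp add: algebra_simps)
  have opS: "f (\<sigma> v) = f (\<sigma> e) * f v" if s: "\<sigma> \<in> S" and hom: "\<And>r. f (\<sigma> (r *\<^sub>R e)) = r * f (\<sigma> e)" for \<sigma> v
  proof -
    have pos: "f (\<sigma> e) \<ge> 0" using TS[OF s CT[OF unit(2)]] fT by blast
    have ge: "f (\<sigma> e) * f v \<le> f (\<sigma> v)" for v
    proof (rule field_le_epsilon)
      fix d :: real assume d: "d > 0"
      define r where "r = f v - d / (f (\<sigma> e) + 1)"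
      have r: "r < f v" using d pos by (simp add: r_def)
      have "\<sigma> (v - r *\<^sub>R e) \<in> T" using in_L[OF r] TS[OF s] by (simp add: L_def)
      then have "r * f (\<sigma> e) \<le> f (\<sigma> v)"
        using fT[of "\<sigma> (v - r *\<^sub>R e)"] linS[OF s, of v "- (r *\<^sub>R e)"] fadd[of "\<sigma> v" "- \<sigma> (r *\<^sub>R e)"]
        by (simp add: Sminus[OF s] minus hom)
      moreover have "d * (f (\<sigma> e) / (f (\<sigma> e) + 1)) \<le> d * 1"
        using d pos by (intro mult_left_mono) auto
      moreover have "r * f (\<sigma> e) = f (\<sigma> e) * f v - d * (f (\<sigma> e) / (f (\<sigma> e) + 1))"
        unfolding r_def left_diff_distrib by simp
      ultimately show "f (\<sigma> e) * f v \<le> f (\<sigma> v) + d" by linarith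
    qed
    show ?thesis using ge[of v] ge[of "- v"] by (simp add: minus Sminus[OF s])
  qed
  have homp: "f (r *\<^sub>R v) = r * f v" if "r > 0" for r v
  proof -
    have ge: "r * f v \<le> f (r *\<^sub>R v)" for v
    proof (rule field_le_epsilon)
      fix d :: real assume "d > 0"
      then have "f v - d / r \<in> L v" using \<open>r > 0\<close> by (intro in_L) simp
      then have "r *\<^sub>R (v - (f v - d / r) *\<^sub>R e) \<in> T" using \<open>r > 0\<close> by (intro Tscale) (auto simp: L_def)
      then have "r * (f v - d / r) \<in> L (r *\<^sub>R v)" by (simp add: L_def scaleR_diff_right)
      then show "r * f v \<le> f (r *\<^sub>R v) + d" using f_ge \<open>r > 0\<close> by (fastforce simp: right_diff_distrib)
    qed
    show ?thesis using ge[of v] ge[of "- v"] by (simp add: minus)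
  qed
  have hom: "f (r *\<^sub>R v) = r * f v" for r v
    using homp[of r v] homp[of "- r" v] minus[of "r *\<^sub>R v"] f0 by (cases r "0::real" rule: linorder_cases) auto
  have homS: "f (\<sigma> (r *\<^sub>R e)) = r * f (\<sigma> e)" if s: "\<sigma> \<in> S" for \<sigma> r
  proof (cases "r \<ge> 0")
    case True
    then show ?thesis using commS[OF s scaleS[OF True], of e] by (simp add: hom)
  next
    case False
    then have "\<sigma> ((- r) *\<^sub>R e) = (- r) *\<^sub>R \<sigma> e" by (intro commS[OF s scaleS]) simp
    then have "\<sigma> (r *\<^sub>R e) = r *\<^sub>R \<sigma> e" using Sminus[OF s, of "r *\<^sub>R e"] by simp
    then show ?thesis by (simp add: hom)
  qed
  show ?thesis
  proof (rule that[of f])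
    show "linear f" using fadd hom by (simp add: linear_iff)
    show "f x \<ge> 0" if "x \<in> C" for x using that by (intro fT CT)
    show "f (\<sigma> x) = f (\<sigma> e) * f x" if "\<sigma> \<in> S" for \<sigma> x
      using that by (intro opS homS)
  qed (rule fe)
qed

section \<open>Bounded functionals and states\<close>

lemma complexify_functional:
  fixes f :: "'a::complex_normed_vector \<Rightarrow> real"
  assumes f: "linear f" and le: "\<And>v. f v \<le> norm v"
  obtains F :: "'a \<Rightarrow> complex" where "clinear F" "\<And>v. Re (F v) = f v" "\<And>v. cmod (F v) \<le> norm v"
proof -
  define F where "F v = Complex (f v) (- f (\<i> *\<^sub>C v))" for v
  have fadd: "f (x + y) = f x + f y" for x y using f by (simp add: linear_add)
  have fscale: "f (complex_of_real r *\<^sub>C x) = r * f x" for r x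
    using linear_scale[OF f, of r x] by (simp add: scaleR_scaleC)
  have Fadd: "F (x + y) = F x + F y" for x y
    by (simp add: F_def fadd scaleC_add_right complex_eq_iff)
  have Fscale: "F (c *\<^sub>C x) = c * F x" for c x
  proof -
    have c: "c *\<^sub>C x = complex_of_real (Re c) *\<^sub>C x + complex_of_real (Im c) *\<^sub>C (\<i> *\<^sub>C x)"
      by (subst complex_eq[of c]) (simp add: scaleC_add_left scaleC_scaleC mult.commute)
    have ic: "\<i> *\<^sub>C c *\<^sub>C x = complex_of_real (Re c) *\<^sub>C (\<i> *\<^sub>C x) + complex_of_real (- Im c) *\<^sub>C x"
      by (subst complex_eq[of c]) (simp add: scaleC_add_left scaleC_add_right scaleC_scaleC algebra_simps)
    have "f (c *\<^sub>C x) = Re c * f x + Im c * f (\<i> *\<^sub>C x)"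
      unfolding c fadd fscale ..
    moreover have "f (\<i> *\<^sub>C c *\<^sub>C x) = Re c * f (\<i> *\<^sub>C x) - Im c * f x"
      unfolding ic fadd fscale by simp
    ultimately show ?thesis by (simp add: F_def complex_eq_iff)
  qed
  have cl: "clinear F" by (simp add: clinear_def Fadd Fscale)
  have bound: "cmod (F v) \<le> norm v" for v
  proof (cases "F v = 0")
    case False
    define c where "c = cnj (F v) / cmod (F v)"
    have nc: "cmod c = 1" using False by (simp add: c_def norm_divide)
    have "F (c *\<^sub>C v) = complex_of_real (cmod (F v))"
      unfolding Fscale using False complex_norm_square[of "F v"]
      by (simp add: c_def field_simps power2_eq_square)
    then have "cmod (F v) = f (c *\<^sub>C v)" by (metis F_def Re_complex_of_real complex.sel(1))
    also have "\<dots> \<le> norm v" using le[of "c *\<^sub>C v"] by (simp add: norm_scaleC nc)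
    finally show ?thesis .
  qed simp
  show ?thesis by (rule that[OF cl _ bound]) (simp add: F_def)
qed

text \<open>The case in which the operators are the nonnegative scalars.\<close>

lemma positive_functional:
  fixes C :: "'v::real_vector set"
  assumes add: "\<And>x y. x \<in> C \<Longrightarrow> y \<in> C \<Longrightarrow> x + y \<in> C"
    and scale: "\<And>r x. r \<ge> 0 \<Longrightarrow> x \<in> C \<Longrightarrow> r *\<^sub>R x \<in> C"
    and unit: "\<And>v. \<exists>r. r *\<^sub>R e - v \<in> C" "e \<in> C" "- e \<notin> C"
  obtains f :: "'v \<Rightarrow> real" where "linear f" "\<And>x. x \<in> C \<Longrightarrow> f x \<ge> 0" "f e = 1"
proof -
  let ?S = "(\<lambda>r x. r *\<^sub>R x) ` {0..} :: ('v \<Rightarrow> 'v) set"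
  have S: "(\<lambda>x. r *\<^sub>R x) \<in> ?S" if "r \<ge> 0" for r using that by (intro imageI) simp
  have elim: "\<exists>r\<ge>0. \<sigma> = (\<lambda>x. r *\<^sub>R x)" if "\<sigma> \<in> ?S" for \<sigma> using that by auto
  show ?thesis
  proof (rule cone_functional[where C = C and e = e and S = ?S, OF add unit])
    fix \<sigma> \<tau> assume "\<sigma> \<in> ?S" "\<tau> \<in> ?S"
    then obtain r s where r: "r \<ge> 0" "\<sigma> = (\<lambda>x. r *\<^sub>R x)" "s \<ge> 0" "\<tau> = (\<lambda>x. s *\<^sub>R x)"
      using elim by meson
    show "(\<lambda>x. \<sigma> (\<tau> x)) \<in> ?S" "(\<lambda>x. \<sigma> x + \<tau> x) \<in> ?S"
      using S[of "r * s"] S[of "r + s"] r by (simp_all flip: scaleR_left_distrib)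
    show "\<sigma> (\<tau> x) = \<tau> (\<sigma> x)" for x using r by (simp add: mult.commute)
  next
    fix \<sigma> assume "\<sigma> \<in> ?S"
    then obtain r where r: "r \<ge> 0" "\<sigma> = (\<lambda>x. r *\<^sub>R x)" using elim by meson
    show "\<sigma> (x + y) = \<sigma> x + \<sigma> y" for x y by (simp add: r algebra_simps)
    show "\<sigma> x \<in> C" if "x \<in> C" for x using scale that r by simp
  next
    show "(\<lambda>x. r *\<^sub>R x) \<in> ?S" if "r \<ge> 0" for r by (rule S[OF that])
  next
    fix f :: "'v \<Rightarrow> real"
    assume "linear f" "\<And>x. x \<in> C \<Longrightarrow> f x \<ge> 0" "f e = 1"
    then show thesis by (rule that)
  qed
qed

text \<open>The Hahn-Banach theorem. For a unit vector \<open>e\<close>, the cone over the unit ball around \<open>e\<close> does not contain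
\<open>- e\<close>, and a functional that is nonnegative on this ball with value \<open>1\<close> at its centre has norm one.\<close>

lemma norming_functional:
  fixes x :: "'a::complex_normed_vector"
  assumes "x \<noteq> 0"
  obtains F :: "'a \<Rightarrow> complex" where "clinear F" "\<And>v. cmod (F v) \<le> norm v" "F x = norm x"
proof -
  define e where "e = (1 / norm x) *\<^sub>R x"
  have e: "norm e = 1" using assms by (simp add: e_def)
  define C where "C = {v. \<exists>r\<ge>0. norm (r *\<^sub>R e - v) \<le> r}"
  obtain f :: "'a \<Rightarrow> real" where f: "linear f" "\<And>x. x \<in> C \<Longrightarrow> f x \<ge> 0" "f e = 1"
  proof (rule positive_functional[where C = C and e = e])
    show "x + y \<in> C" if xy: "x \<in> C" "y \<in> C" for x y
    proof -
      obtain r s where rs: "r \<ge> 0" "s \<ge> 0" "norm (r *\<^sub>R e - x) \<le> r" "norm (s *\<^sub>R e - y) \<le> s"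
        using xy by (auto simp: C_def)
      have "norm ((r + s) *\<^sub>R e - (x + y)) \<le> r + s"
        using norm_triangle_ineq[of "r *\<^sub>R e - x" "s *\<^sub>R e - y"] rs by (simp add: algebra_simps)
      then show ?thesis using rs by (auto simp: C_def intro!: exI[of _ "r + s"])
    qed
    show "\<exists>r. r *\<^sub>R e - v \<in> C" for v
      by (intro exI[of _ "norm v"]) (auto simp: C_def intro!: exI[of _ "norm v"])
    show "e \<in> C" by (auto simp: C_def intro!: exI[of _ 1])
    show "- e \<notin> C"
    proof
      assume "- e \<in> C"
      then obtain r where r: "r \<ge> 0" "norm (r *\<^sub>R e + e) \<le> r" by (auto simp: C_def)
      moreover have "r *\<^sub>R e + e = (r + 1) *\<^sub>R e" by (simp add: algebra_simps)
      ultimately show False using e by simp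
    qed
    show "s *\<^sub>R x \<in> C" if s: "s \<ge> 0" and x: "x \<in> C" for s x
    proof -
      obtain r where r: "r \<ge> 0" "norm (r *\<^sub>R e - x) \<le> r" using x by (auto simp: C_def)
      have "norm ((s * r) *\<^sub>R e - s *\<^sub>R x) = s * norm (r *\<^sub>R e - x)"
        using s by (simp flip: scaleR_scaleR scaleR_diff_right)
      also have "\<dots> \<le> s * r" using r s by (intro mult_left_mono)
      finally show ?thesis using r s by (auto simp: C_def intro!: exI[of _ "s * r"])
    qed
  qed blast
  have "f v \<le> norm v" for v
  proof -
    have "norm v *\<^sub>R e - v \<in> C" by (auto simp: C_def intro!: exI[of _ "norm v"])
    from f(2)[OF this] show ?thesis by (simp add: linear_diff[OF f(1)] linear_scale[OF f(1)] f)
  qed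
  then obtain F where F: "clinear F" "\<And>v. Re (F v) = f v" "\<And>v. cmod (F v) \<le> norm v"
    using complexify_functional[OF f(1)] by blast
  have x: "x = norm x *\<^sub>R e" using assms by (simp add: e_def)
  have "Re (F x) = norm x" unfolding F(2) by (subst x) (simp add: linear_scale[OF f(1)] f)
  moreover have "(Re (F x))\<^sup>2 + (Im (F x))\<^sup>2 \<le> (norm x)\<^sup>2"
    unfolding cmod_power2[symmetric] using F(3)[of x] by (intro power_mono) auto
  ultimately have "F x = norm x" by (simp add: complex_eq_iff)
  then show ?thesis using that F by blast
qed

definition bounded_clinear :: "('a::complex_normed_vector \<Rightarrow> 'b::complex_normed_vector) \<Rightarrow> bool" where
  "bounded_clinear f \<longleftrightarrow> clinear f \<and> (\<exists>K. \<forall>x. norm (f x) \<le> K * norm x)"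

lemma bounded_clinearI: "clinear f \<Longrightarrow> (\<And>x. norm (f x) \<le> K * norm x) \<Longrightarrow> bounded_clinear f"
  by (auto simp: bounded_clinear_def)

lemma bounded_clinearD:
  assumes "bounded_clinear f"
  obtains K where "K \<ge> 0" "\<And>x. norm (f x) \<le> K * norm x"
proof -
  obtain K where K: "\<And>x. norm (f x) \<le> K * norm x" using assms by (auto simp: bounded_clinear_def)
  have "norm (f x) \<le> \<bar>K\<bar> * norm x" for x
    by (rule order.trans[OF K]) (simp add: mult_right_mono)
  then show ?thesis using that[of "\<bar>K\<bar>"] by simp
qed

lemma bounded_clinear_clinear: "bounded_clinear f \<Longrightarrow> clinear f"
  by (simp add: bounded_clinear_def)

lemmas bounded_clinear_add = clinear_add[OF bounded_clinear_clinear]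
lemmas bounded_clinear_diff = clinear_diff[OF bounded_clinear_clinear]
lemmas bounded_clinear_scaleC = clinear_scaleC[OF bounded_clinear_clinear]
lemmas bounded_clinear_zero = clinear_zero[OF bounded_clinear_clinear]

lemma bounded_clinear_bounded_linear: "bounded_clinear f \<Longrightarrow> bounded_linear f"
  by (metis bounded_clinear_def clinear_bounded_linear)

lemma bounded_clinear_continuous: "bounded_clinear f \<Longrightarrow> continuous_on UNIV f"
  by (intro linear_continuous_on bounded_clinear_bounded_linear)

lemma bounded_clinear_compose:
  assumes f: "bounded_clinear f" and g: "bounded_clinear g"
  shows "bounded_clinear (\<lambda>x. f (g x))"
proof -
  obtain K L where K: "K \<ge> 0" "\<And>x. norm (f x) \<le> K * norm x" and L: "\<And>x. norm (g x) \<le> L * norm x"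
    using bounded_clinearD[OF f] bounded_clinearD[OF g] by metis
  show ?thesis
  proof (rule bounded_clinearI)
    show "clinear (\<lambda>x. f (g x))" using f g by (simp add: bounded_clinear_def clinear_def)
    show "norm (f (g x)) \<le> (K * L) * norm x" for x
      by (rule order.trans[OF K(2)]) (use mult_left_mono[OF L K(1)] in \<open>simp add: mult.assoc\<close>)
  qed
qed

lemma bounded_clinear_mult_left: "bounded_clinear (\<lambda>x. a * x :: 'a::unital_banach_star_algebra)"
  by (rule bounded_clinearI[of _ "norm a"]) (auto simp: clinear_def distrib_left mult_scaleC_right norm_mult_ineq)

lemma bounded_clinear_mult_right: "bounded_clinear (\<lambda>x. x * a :: 'a::unital_banach_star_algebra)"
  by (rule bounded_clinearI[of _ "norm a"])
    (auto simp: clinear_def distrib_right mult_scaleC_left mult.commute[of "norm a"] norm_mult_ineq)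

lemma bounded_functionals_separate:
  fixes x y :: "'a::complex_normed_vector"
  assumes "\<And>f :: 'a \<Rightarrow> complex. bounded_clinear f \<Longrightarrow> f x = f y"
  shows "x = y"
proof (rule ccontr)
  assume "x \<noteq> y"
  then obtain F :: "'a \<Rightarrow> complex" where F: "clinear F" "\<And>v. cmod (F v) \<le> norm v" "F (x - y) = norm (x - y)"
    using norming_functional[of "x - y"] by auto
  have "bounded_clinear F" using F by (intro bounded_clinearI[of F 1]) simp_all
  then have "F (x - y) = 0" using assms[of F] F(1) by (simp add: clinear_diff)
  then show False using F(3) \<open>x \<noteq> y\<close> by simp
qed

definition state :: "('a::unital_banach_star_algebra \<Rightarrow> complex) \<Rightarrow> bool" where
  "state f \<longleftrightarrow> clinear f \<and> (\<forall>x. cmod (f x) \<le> norm x) \<and> f 1 = 1"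

lemma state_clinear: "state f \<Longrightarrow> clinear f"
  and state_bound: "state f \<Longrightarrow> cmod (f x) \<le> norm x"
  and state_one: "state f \<Longrightarrow> f 1 = 1"
  by (simp_all add: state_def)

lemma state_bounded_clinear: "state f \<Longrightarrow> bounded_clinear f"
  by (rule bounded_clinearI[of f 1]) (simp_all add: state_def)

lemma state_of_real_linear:
  fixes f :: "'a::unital_banach_star_algebra \<Rightarrow> real"
  assumes "linear f" "\<And>v. f v \<le> norm v" "f 1 = 1" "norm (1::'a) \<le> 1"
  obtains F where "state F" "\<And>v. Re (F v) = f v"
proof -
  obtain F where F: "clinear F" "\<And>v. Re (F v) = f v" "\<And>v. cmod (F v) \<le> norm v"
    using complexify_functional[OF assms(1,2)] by blast
  have "(Re (F 1))\<^sup>2 + (Im (F 1))\<^sup>2 \<le> 1\<^sup>2"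
    unfolding cmod_power2[symmetric] using F(3)[of 1] assms(4) by (intro power_mono) auto
  then have "F 1 = 1" using F(2)[of 1] assms(3) by (simp add: complex_eq_iff)
  then show ?thesis by (intro that[of F]) (use F in \<open>simp_all add: state_def\<close>)
qed

text \<open>By the C*-identity \<open>\<parallel>h + i t\<parallel>\<^sup>2 \<le> \<parallel>h\<parallel>\<^sup>2 + t\<^sup>2\<close>. A nonzero imaginary part \<open>y\<close> of \<open>F h\<close> would make \<open>|F (h + i t)|\<^sup>2\<close> at least
\<open>t\<^sup>2 + 2 t y\<close>, which is too large for large \<open>t y\<close>.\<close>

lemma state_selfadjoint_real:
  fixes h :: "'a::unital_cstar_algebra"
  assumes F: "state F" and h: "star h = h"
  shows "Im (F h) = 0"
proof -
  define y where "y = Im (F h)"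
  have ineq: "2 * t * y \<le> (norm h)\<^sup>2" for t
  proof -
    have "(norm (h + (\<i> * complex_of_real t) *\<^sub>C 1))\<^sup>2 = norm (h * h + (t\<^sup>2) *\<^sub>R 1)"
      unfolding norm_star_mult_self[symmetric]
      by (simp add: star_add h star_scaleC algebra_simps mult_scaleC_left mult_scaleC_right scaleC_scaleC
          scaleR_scaleC scaleC_minus_left scaleC_add_right scaleC_diff_right scaleC_minus_right power2_eq_square)
    also have "\<dots> \<le> (norm h)\<^sup>2 + t\<^sup>2"
      by (rule norm_triangle_le) (simp add: norm_selfadjoint_square h)
    finally have 1: "(norm (h + (\<i> * complex_of_real t) *\<^sub>C 1))\<^sup>2 \<le> (norm h)\<^sup>2 + t\<^sup>2" .
    have "F (h + (\<i> * complex_of_real t) *\<^sub>C 1) = F h + \<i> * t"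
      by (simp add: clinear_add[OF state_clinear[OF F]] clinear_scaleC[OF state_clinear[OF F]] state_one[OF F])
    then have "Im (F (h + (\<i> * complex_of_real t) *\<^sub>C 1)) = y + t" by (simp add: y_def)
    then have "\<bar>y + t\<bar> \<le> norm (h + (\<i> * complex_of_real t) *\<^sub>C 1)"
      using abs_Im_le_cmod state_bound[OF F] order_trans by metis
    then have "(y + t)\<^sup>2 \<le> (norm (h + (\<i> * complex_of_real t) *\<^sub>C 1))\<^sup>2" by (rule abs_le_square_iff[THEN iffD1, of "y + t", OF order_trans]) simp
    with 1 show ?thesis by (simp add: power2_eq_square algebra_simps) (smt (verit) zero_le_square)
  qed
  show ?thesis
  proof (rule ccontr)
    assume "Im (F h) \<noteq> 0"
    then have "y \<noteq> 0" by (simp add: y_def)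
    then show False using ineq[of "((norm h)\<^sup>2 + 1) / (2 * y)"] by simp
  qed
qed

lemma state_star:
  fixes x :: "'a::unital_cstar_algebra"
  assumes F: "state F"
  shows "F (star x) = cnj (F x)"
proof -
  have x: "x = real_part x + \<i> *\<^sub>C imag_part x" by (simp add: real_imag_part)
  have sx: "star x = real_part x - \<i> *\<^sub>C imag_part x"
    by (subst x) (simp add: star_add star_scaleC scaleC_minus_left)
  note l = clinear_add[OF state_clinear[OF F]] clinear_diff[OF state_clinear[OF F]] clinear_scaleC[OF state_clinear[OF F]]
  have r: "Im (F (real_part x)) = 0" "Im (F (imag_part x)) = 0" by (simp_all add: state_selfadjoint_real[OF F])
  have "F (star x) = F (real_part x) - \<i> * F (imag_part x)" by (simp add: sx l)
  moreover have "F x = F (real_part x) + \<i> * F (imag_part x)" by (subst x) (simp add: l)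
  ultimately show ?thesis using r by (simp add: complex_eq_iff)
qed

lemma state_square_nonneg:
  fixes h :: "'a::unital_cstar_algebra"
  assumes F: "state F" and h: "star h = h"
  shows "Re (F (h * h)) \<ge> 0"
proof -
  define t where "t = 1 / (norm h + 1)"
  have t: "t > 0" by (simp add: t_def add_nonneg_pos)
  have "norm (1 - (t *\<^sub>R h) * (t *\<^sub>R h)) \<le> 1"
    by (rule norm_one_minus_square) (use h t in \<open>auto simp: star_scaleR t_def divide_simps intro: add_nonneg_pos\<close>)
  then have "norm (1 - (t * t) *\<^sub>R (h * h)) \<le> 1" by simp
  then have "cmod (F (1 - (t * t) *\<^sub>R (h * h))) \<le> 1" using state_bound[OF F] order_trans by blast
  moreover have "F (1 - (t * t) *\<^sub>R (h * h)) = 1 - (t * t) *\<^sub>R F (h * h)"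
    by (simp add: clinear_diff[OF state_clinear[OF F]] clinear_scaleR[OF state_clinear[OF F]] state_one[OF F])
  ultimately have "Re (1 - (t * t) *\<^sub>R F (h * h)) \<le> 1" using complex_Re_le_cmod order_trans by metis
  then have "t * t * Re (F (h * h)) \<ge> 0" by simp
  then show ?thesis using t mult_pos_pos[OF t t] by (simp add: zero_le_mult_iff)
qed

section \<open>The numerical range\<close>

text \<open>The right derivative of \<open>\<parallel>1 + t k\<parallel>\<close> at \<open>0\<close> is the maximum of \<open>Re \<Phi>(k)\<close> over the states. Here: if \<open>- 1\<close> were not
in the cone generated by the unit ball around \<open>1\<close> and by \<open>k - d\<close>, a state with \<open>Re \<Phi>(k) \<ge> d\<close> would exist.
That \<open>- 1\<close> does lie in this cone is an estimate of \<open>\<parallel>1 + T k\<parallel>\<close> for one \<open>T > 0\<close>, and by convexity for all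
smaller ones.\<close>

lemma numerical_range_direction:
  fixes k :: "'a::{unital_banach_star_algebra, real_normed_algebra_1}"
  assumes states: "\<And>\<Phi>. state \<Phi> \<Longrightarrow> Re (\<Phi> k) < d" and d: "d > 0"
  shows "\<exists>T>0. \<forall>t. 0 \<le> t \<and> t \<le> T \<longrightarrow> norm (1 + t *\<^sub>R k) \<le> 1 + t * d"
proof -
  define C where "C = {v :: 'a. \<exists>r\<ge>0. \<exists>s\<ge>0. norm (r *\<^sub>R 1 - (v - s *\<^sub>R (k - d *\<^sub>R 1))) \<le> r}"
  have CI: "v \<in> C" if "r \<ge> 0" "s \<ge> 0" "norm (r *\<^sub>R 1 - (v - s *\<^sub>R (k - d *\<^sub>R 1))) \<le> r" for r s v
    using that by (auto simp: C_def)
  have bnd: "norm v *\<^sub>R 1 - v \<in> C" for v by (rule CI[of "norm v" 0]) simp_all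
  have "- 1 \<in> C"
  proof (rule ccontr)
    assume m: "- 1 \<notin> C"
    obtain f :: "'a \<Rightarrow> real" where f: "linear f" "\<And>x. x \<in> C \<Longrightarrow> f x \<ge> 0" "f 1 = 1"
    proof (rule positive_functional[where C = C and e = 1])
      show "x + y \<in> C" if xy: "x \<in> C" "y \<in> C" for x y
      proof -
        obtain r s r' s' where rs: "r \<ge> 0" "s \<ge> 0" "norm (r *\<^sub>R 1 - (x - s *\<^sub>R (k - d *\<^sub>R 1))) \<le> r"
          "r' \<ge> 0" "s' \<ge> 0" "norm (r' *\<^sub>R 1 - (y - s' *\<^sub>R (k - d *\<^sub>R 1))) \<le> r'"
          using xy by (auto simp: C_def)
        have "norm ((r *\<^sub>R 1 - (x - s *\<^sub>R (k - d *\<^sub>R 1))) + (r' *\<^sub>R 1 - (y - s' *\<^sub>R (k - d *\<^sub>R 1)))) \<le> r + r'"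
          using rs by (intro norm_triangle_mono)
        moreover have "(r *\<^sub>R 1 - (x - s *\<^sub>R (k - d *\<^sub>R 1))) + (r' *\<^sub>R 1 - (y - s' *\<^sub>R (k - d *\<^sub>R 1)))
            = (r + r') *\<^sub>R 1 - (x + y - (s + s') *\<^sub>R (k - d *\<^sub>R 1))"
          by (simp only: scaleR_left_distrib) (simp add: algebra_simps)
        ultimately show ?thesis using rs by (intro CI[of "r + r'" "s + s'"]) auto
      qed
      show "q *\<^sub>R x \<in> C" if q: "q \<ge> 0" and x: "x \<in> C" for q x
      proof -
        obtain r s where rs: "r \<ge> 0" "s \<ge> 0" "norm (r *\<^sub>R 1 - (x - s *\<^sub>R (k - d *\<^sub>R 1))) \<le> r"
          using x by (auto simp: C_def)
        have "(q * r) *\<^sub>R 1 - (q *\<^sub>R x - (q * s) *\<^sub>R (k - d *\<^sub>R 1)) = q *\<^sub>R (r *\<^sub>R 1 - (x - s *\<^sub>R (k - d *\<^sub>R 1)))"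
          by (simp add: scaleR_diff_right)
        then have "norm ((q * r) *\<^sub>R 1 - (q *\<^sub>R x - (q * s) *\<^sub>R (k - d *\<^sub>R 1))) \<le> q * r"
          using rs q by (simp add: mult_left_mono)
        then show ?thesis using rs q by (intro CI[of "q * r" "q * s"]) auto
      qed
      show "\<exists>r. r *\<^sub>R 1 - v \<in> C" for v using bnd by blast
      show "1 \<in> C" by (rule CI[of 1 0]) simp_all
    qed (use m in blast)+
    have "f v \<le> norm v" for v
      using f(2)[OF bnd[of v]] by (simp add: linear_diff[OF f(1)] linear_scale[OF f(1)] f(3))
    then obtain \<Phi> where \<Phi>: "state \<Phi>" "\<And>v. Re (\<Phi> v) = f v"
      using state_of_real_linear[OF f(1) _ f(3)] by auto
    have "k - d *\<^sub>R 1 \<in> C" by (rule CI[of 0 1]) simp_all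
    from f(2)[OF this] have "d \<le> f k" by (simp add: linear_diff[OF f(1)] linear_scale[OF f(1)] f(3))
    then show False using states[OF \<Phi>(1)] \<Phi>(2)[of k] by simp
  qed
  then obtain r s where rs: "r \<ge> 0" "s \<ge> 0" "norm (r *\<^sub>R 1 - (- 1 - s *\<^sub>R (k - d *\<^sub>R 1))) \<le> r"
    by (auto simp: C_def)
  have s: "s > 0"
  proof (rule ccontr)
    assume "\<not> s > 0"
    then have "s = 0" using rs by simp
    then have "norm ((r + 1) *\<^sub>R (1::'a)) \<le> r" using rs(3) by (simp add: algebra_simps)
    then show False using rs(1) by simp
  qed
  define T where "T = s / (r + 1)"
  have T: "T > 0" using s rs(1) by (simp add: T_def)
  have "norm (((r *\<^sub>R 1 - (- 1 - s *\<^sub>R (k - d *\<^sub>R 1)))) + (s * d) *\<^sub>R 1) \<le> r + s * d"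
    by (rule order.trans[OF norm_triangle_ineq]) (use rs s d in auto)
  moreover have "((r *\<^sub>R 1 - (- 1 - s *\<^sub>R (k - d *\<^sub>R 1)))) + (s * d) *\<^sub>R 1 = (r + 1) *\<^sub>R (1 + T *\<^sub>R k)"
    using rs(1) by (simp add: T_def scaleR_add_right scaleR_diff_right scaleR_left_distrib)
  ultimately have "(r + 1) * norm (1 + T *\<^sub>R k) \<le> r + s * d" using rs(1) by simp
  also have "\<dots> \<le> (r + 1) * (1 + T * d)" using rs(1) by (simp add: T_def field_simps)
  finally have nT: "norm (1 + T *\<^sub>R k) \<le> 1 + T * d" using rs(1) by simp
  show ?thesis
  proof (intro exI[of _ T] conjI allI impI; (elim conjE)?)
    show "T > 0" by (rule T)
    fix t assume t: "0 \<le> t" "t \<le> T"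
    define q where "q = t / T"
    have q: "0 \<le> q" "q \<le> 1" "q * T = t" using t T by (auto simp: q_def)
    have "1 + t *\<^sub>R k = (1 - q) *\<^sub>R 1 + q *\<^sub>R (1 + T *\<^sub>R k)"
      using q by (simp add: scaleR_add_right scaleR_diff_left)
    also have "norm \<dots> \<le> (1 - q) + q * (1 + T * d)"
      by (rule order.trans[OF norm_triangle_ineq]) (use q nT in \<open>auto intro!: mult_left_mono\<close>)
    also have "\<dots> = 1 + t * d" using q(3) by (simp add: algebra_simps)
    finally show "norm (1 + t *\<^sub>R k) \<le> 1 + t * d" .
  qed
qed

text \<open>The estimate in the four directions \<open>\<plusminus>1, \<plusminus>i\<close> gives it in all directions at once, since \<open>1 + z k\<close> is the mean
of \<open>1 + 2 (Re z) k\<close> and \<open>1 + 2 i (Im z) k\<close>.\<close>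

lemma numerical_range_zero_disc:
  fixes k :: "'a::{unital_banach_star_algebra, real_normed_algebra_1}"
  assumes states: "\<And>\<Phi>. state \<Phi> \<Longrightarrow> \<Phi> k = 0" and d: "d > 0"
  shows "\<exists>T>0. \<forall>z. cmod z \<le> T \<longrightarrow> norm (1 + z *\<^sub>C k) \<le> 1 + 2 * d * cmod z"
proof -
  have *: "\<exists>T>0. \<forall>t. 0 \<le> t \<and> t \<le> T \<longrightarrow> norm (1 + t *\<^sub>R (w *\<^sub>C k)) \<le> 1 + t * d" for w
  proof -
    have "Re (\<Phi> (w *\<^sub>C k)) < d" if "state \<Phi>" for \<Phi>
      using states[OF that] d by (simp add: clinear_scaleC[OF state_clinear[OF that]])
    then show ?thesis by (rule numerical_range_direction[OF _ d])
  qed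
  obtain T1 T2 T3 T4 where T: "T1 > 0" "T2 > 0" "T3 > 0" "T4 > 0"
    and 1: "\<And>t. 0 \<le> t \<Longrightarrow> t \<le> T1 \<Longrightarrow> norm (1 + t *\<^sub>R (1 *\<^sub>C k)) \<le> 1 + t * d"
    and 2: "\<And>t. 0 \<le> t \<Longrightarrow> t \<le> T2 \<Longrightarrow> norm (1 + t *\<^sub>R ((-1) *\<^sub>C k)) \<le> 1 + t * d"
    and 3: "\<And>t. 0 \<le> t \<Longrightarrow> t \<le> T3 \<Longrightarrow> norm (1 + t *\<^sub>R (\<i> *\<^sub>C k)) \<le> 1 + t * d"
    and 4: "\<And>t. 0 \<le> t \<Longrightarrow> t \<le> T4 \<Longrightarrow> norm (1 + t *\<^sub>R ((-\<i>) *\<^sub>C k)) \<le> 1 + t * d"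
  proof -
    obtain T1 where "T1 > 0" "\<forall>t. 0 \<le> t \<and> t \<le> T1 \<longrightarrow> norm (1 + t *\<^sub>R (1 *\<^sub>C k)) \<le> 1 + t * d" using *[of 1] by blast
    moreover obtain T2 where "T2 > 0" "\<forall>t. 0 \<le> t \<and> t \<le> T2 \<longrightarrow> norm (1 + t *\<^sub>R ((-1) *\<^sub>C k)) \<le> 1 + t * d" using *[of "-1"] by blast
    moreover obtain T3 where "T3 > 0" "\<forall>t. 0 \<le> t \<and> t \<le> T3 \<longrightarrow> norm (1 + t *\<^sub>R (\<i> *\<^sub>C k)) \<le> 1 + t * d" using *[of \<i>] by blast
    moreover obtain T4 where "T4 > 0" "\<forall>t. 0 \<le> t \<and> t \<le> T4 \<longrightarrow> norm (1 + t *\<^sub>R ((-\<i>) *\<^sub>C k)) \<le> 1 + t * d" using *[of "-\<i>"] by blast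
    ultimately show thesis by (intro that[of T1 T2 T3 T4]) blast+
  qed
  define T where "T = min (min T1 T2) (min T3 T4) / 2"
  have real: "norm (1 + t *\<^sub>R k) \<le> 1 + \<bar>t\<bar> * d" if "\<bar>t\<bar> \<le> 2 * T" for t
    using 1[of "\<bar>t\<bar>"] 2[of "\<bar>t\<bar>"] that T
    by (cases "t \<ge> 0") (auto simp: T_def scaleC_one scaleC_minus_one)
  have imag: "norm (1 + t *\<^sub>R (\<i> *\<^sub>C k)) \<le> 1 + \<bar>t\<bar> * d" if "\<bar>t\<bar> \<le> 2 * T" for t
    using 3[of "\<bar>t\<bar>"] 4[of "\<bar>t\<bar>"] that T
    by (cases "t \<ge> 0") (auto simp: T_def scaleC_minus_left)
  show ?thesis
  proof (intro exI[of _ T] conjI allI impI)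
    show "T > 0" using T by (simp add: T_def)
    fix z assume z: "cmod z \<le> T"
    have re: "\<bar>Re z\<bar> \<le> cmod z" and im: "\<bar>Im z\<bar> \<le> cmod z" by (simp_all add: abs_Re_le_cmod abs_Im_le_cmod)
    have zk: "z *\<^sub>C k = Re z *\<^sub>R k + Im z *\<^sub>R (\<i> *\<^sub>C k)"
      by (subst complex_eq[of z]) (simp add: scaleR_scaleC scaleC_add_left scaleC_scaleC mult.commute)
    have "2 *\<^sub>R (1 + z *\<^sub>C k) = (1 + (2 * Re z) *\<^sub>R k) + (1 + (2 * Im z) *\<^sub>R (\<i> *\<^sub>C k))"
      by (simp add: zk scaleR_add_right scaleR_2)
    then have "2 * norm (1 + z *\<^sub>C k) \<le> norm (1 + (2 * Re z) *\<^sub>R k) + norm (1 + (2 * Im z) *\<^sub>R (\<i> *\<^sub>C k))"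
      using norm_triangle_ineq[of "1 + (2 * Re z) *\<^sub>R k" "1 + (2 * Im z) *\<^sub>R (\<i> *\<^sub>C k)"]
      by (metis norm_scaleR abs_numeral)
    also have "\<dots> \<le> (1 + \<bar>2 * Re z\<bar> * d) + (1 + \<bar>2 * Im z\<bar> * d)"
      using re im z by (intro add_mono real imag) auto
    also have "\<dots> = 2 + 2 * (\<bar>Re z\<bar> * d) + 2 * (\<bar>Im z\<bar> * d)" by (simp add: abs_mult)
    also have "\<dots> \<le> 2 + 2 * (cmod z * d) + 2 * (cmod z * d)"
      using re im d by (intro add_mono mult_left_mono mult_right_mono) auto
    finally show "norm (1 + z *\<^sub>C k) \<le> 1 + 2 * d * cmod z" by (simp add: algebra_simps)
  qed
qed

text \<open>Only the linear coefficient matters below. The factor \<open>c\<close> makes the induction on \<open>n\<close> go through.\<close>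

lemma power_functional_polynomial:
  fixes k :: "'a::{unital_banach_star_algebra, real_normed_algebra_1}"
  assumes F: "clinear F"
  shows "\<exists>q. (\<forall>w. F (c * (1 + w *\<^sub>C k) ^ n) = poly q w) \<and> coeff q 0 = F c \<and> coeff q 1 = of_nat n * F (c * k)"
proof (induction n arbitrary: c)
  case 0
  then show ?case by (intro exI[of _ "[:F c:]"]) simp
next
  case (Suc n)
  obtain q where q: "\<And>w. F (c * (1 + w *\<^sub>C k) ^ n) = poly q w" "coeff q 0 = F c" "coeff q 1 = of_nat n * F (c * k)"
    using Suc by blast
  obtain p where p: "\<And>w. F (c * k * (1 + w *\<^sub>C k) ^ n) = poly p w" "coeff p 0 = F (c * k)"
    using Suc by blast
  have "F (c * (1 + w *\<^sub>C k) ^ Suc n) = poly (q + pCons 0 p) w" for w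
  proof -
    have "c * (1 + w *\<^sub>C k) ^ Suc n = c * (1 + w *\<^sub>C k) ^ n + w *\<^sub>C (c * k * (1 + w *\<^sub>C k) ^ n)"
      by (simp add: algebra_simps mult_scaleC_left mult_scaleC_right)
    then show ?thesis by (simp add: clinear_add[OF F] clinear_scaleC[OF F] q(1) p(1))
  qed
  then show ?case
    by (intro exI[of _ "q + pCons 0 p"] conjI allI) (simp_all add: q(2,3)[simplified] p(2) algebra_simps)
qed

text \<open>The polynomial \<open>w \<mapsto> F ((1 + w k)\<^sup>n)\<close> is bounded by \<open>exp 2\<close> on the circle of radius \<open>1 / (d n)\<close>, for every \<open>d > 0\<close> and
large \<open>n\<close>. Cauchy's estimate for its linear coefficient \<open>n F k\<close> gives \<open>|F k| \<le> d exp 2\<close>. This is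
Liouville's theorem for \<open>exp (z k)\<close>, in a form that needs polynomials only.\<close>

lemma numerical_range_zero_imp_zero:
  fixes k :: "'a::{unital_banach_star_algebra, real_normed_algebra_1}"
  assumes states: "\<And>\<Phi>. state \<Phi> \<Longrightarrow> \<Phi> k = 0"
  shows "k = 0"
proof (rule ccontr)
  assume k: "k \<noteq> 0"
  obtain F where F: "clinear F" "\<And>v. cmod (F v) \<le> norm v" "F k = norm k"
    using norming_functional[OF k] by blast
  have bound: "norm k \<le> d * exp 2" if d: "d > 0" for d
  proof -
    have "\<exists>T>0. \<forall>z. cmod z \<le> T \<longrightarrow> norm (1 + z *\<^sub>C k) \<le> 1 + 2 * d * cmod z"
    proof (rule numerical_range_zero_disc)
      show "\<Phi> k = 0" if "state \<Phi>" for \<Phi> by (rule states[OF that])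
    qed (rule d)
    then obtain T where T: "T > 0" "\<And>z. cmod z \<le> T \<Longrightarrow> norm (1 + z *\<^sub>C k) \<le> 1 + 2 * d * cmod z" by blast
    define n where "n = nat \<lceil>1 / (d * T)\<rceil> + 1"
    have n: "real n > 0" "1 / (d * T) \<le> real n"
      unfolding n_def by (auto simp: algebra_simps) linarith
    define r where "r = 1 / (d * real n)"
    have r: "r > 0" "r \<le> T"
      using n d T(1) by (auto simp: r_def field_simps)
    obtain q where q: "\<And>w. F (1 * (1 + w *\<^sub>C k) ^ n) = poly q w" "coeff q 1 = of_nat n * F (1 * k)"
      using power_functional_polynomial[OF F(1), of 1 k n] by blast
    have "cmod ((deriv ^^ 1) (poly q) 0) \<le> fact 1 * exp 2 / r ^ 1"
    proof (rule Cauchy_inequality)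
      show "poly q holomorphic_on ball 0 r" "continuous_on (cball 0 r) (poly q)"
        by (auto intro!: holomorphic_intros continuous_intros)
      fix w assume "cmod (0 - w) = r"
      then have w: "cmod w = r" by simp
      have "cmod (poly q w) \<le> norm ((1 + w *\<^sub>C k) ^ n)" using F(2)[of "(1 + w *\<^sub>C k) ^ n"] q(1)[of w] by simp
      also have "\<dots> \<le> norm (1 + w *\<^sub>C k) ^ n" by (rule norm_power_ineq)
      also have "\<dots> \<le> (1 + 2 * d * r) ^ n" using T(2)[of w] w r by (intro power_mono) auto
      also have "\<dots> \<le> exp (2 * d * r) ^ n"
        using d r by (intro power_mono exp_ge_add_one_self) auto
      also have "\<dots> = exp (real n * (2 * d * r))" by (rule exp_of_nat_mult[symmetric])
      also have "real n * (2 * d * r) = 2" using n d by (simp add: r_def)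
      finally show "cmod (poly q w) \<le> exp 2" .
    qed (rule r)
    also have "(deriv ^^ 1) (poly q) 0 = coeff q 1"
      using DERIV_imp_deriv[OF poly_DERIV, of q 0] by (simp add: poly_0_coeff_0 coeff_pderiv)
    finally have "real n * norm k \<le> exp 2 / r" using q(2) F(3) by (simp add: norm_mult)
    also have "\<dots> = real n * (d * exp 2)" using n d by (simp add: r_def)
    finally show ?thesis using n by simp
  qed
  have "norm k \<le> norm k / 2 / exp 2 * exp 2" by (rule bound) (use k in simp)
  then show False using k by simp
qed

section \<open>States multiplicative on the centre\<close>

definition central :: "'a::unital_star_algebra \<Rightarrow> bool" where
  "central z \<longleftrightarrow> (\<forall>b. z * b = b * z)"

lemma central_commute: "central z \<Longrightarrow> z * b = b * z"
  by (simp add: central_def)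

lemma central_mult:
  assumes "central x" "central y"
  shows "central (x * y)"
  unfolding central_def
proof
  fix b
  have "x * y * b = x * (b * y)" by (simp add: mult.assoc central_commute[OF assms(2), of b])
  also have "\<dots> = b * (x * y)" by (simp add: central_commute[OF assms(1), of b] flip: mult.assoc)
  finally show "x * y * b = b * (x * y)" .
qed

lemma central_add: "central x \<Longrightarrow> central y \<Longrightarrow> central (x + y)"
  by (simp add: central_def distrib_left distrib_right)

inductive_set sums_of_squares :: "'a::unital_star_algebra set \<Rightarrow> 'a set" for Z where
  zero: "0 \<in> sums_of_squares Z"
| add: "c \<in> Z \<Longrightarrow> x \<in> sums_of_squares Z \<Longrightarrow> c * c + x \<in> sums_of_squares Z"

lemma sums_of_squares_add:
  "x \<in> sums_of_squares Z \<Longrightarrow> y \<in> sums_of_squares Z \<Longrightarrow> x + y \<in> sums_of_squares Z"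
  by (induction rule: sums_of_squares.induct) (simp_all add: add.assoc sums_of_squares.add)

lemma sums_of_squares_square: "c \<in> Z \<Longrightarrow> c * c \<in> sums_of_squares Z"
  using sums_of_squares.add[OF _ sums_of_squares.zero, of c Z] by simp

lemma sums_of_squares_mult:
  assumes "q \<in> sums_of_squares Q" "x \<in> sums_of_squares Z"
    and "\<And>z. z \<in> Q \<Longrightarrow> central z" "\<And>z c. z \<in> Q \<Longrightarrow> c \<in> Z \<Longrightarrow> z * c \<in> Z"
  shows "q * x \<in> sums_of_squares Z"
  using assms(1)
proof induction
  case zero
  then show ?case by (simp add: sums_of_squares.zero)
next
  case (add z q)
  have "z * z * x \<in> sums_of_squares Z"
    using assms(2)
  proof induction
    case (add c x)
    have "z * (c * c) = c * (z * c)"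
      using arg_cong[OF central_commute[OF assms(3)[OF \<open>z \<in> Q\<close>], of c], of "\<lambda>t. t * c"]
      by (simp add: mult.assoc)
    then have "z * z * (c * c + x) = (z * c) * (z * c) + z * z * x"
      by (simp add: distrib_left mult.assoc)
    then show ?case
      using sums_of_squares.add[OF assms(4)[OF \<open>z \<in> Q\<close> \<open>c \<in> Z\<close>] add.IH] by simp
  qed (simp add: sums_of_squares.zero)
  then show ?case using add.IH by (simp add: distrib_right sums_of_squares_add)
qed

text \<open>The bound shows that \<open>- 1\<close> is not a sum of squares. It is stable under sums because \<open>1 - s (x + y)\<close> is the
mean of \<open>1 - 2 s x\<close> and \<open>1 - 2 s y\<close>.\<close>

lemma sums_of_squares_small:
  fixes x :: "'a::unital_cstar_algebra"
  assumes "x \<in> sums_of_squares {c. star c = c}"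
  shows "\<exists>t>0. norm (1 - t *\<^sub>R x) \<le> 1"
proof -
  have "\<exists>t>0. \<forall>s. 0 \<le> s \<and> s \<le> t \<longrightarrow> norm (1 - s *\<^sub>R x) \<le> 1"
    using assms
  proof induction
    case zero
    then show ?case by (intro exI[of _ 1]) simp
  next
    case (add c x)
    then obtain t where t: "t > 0" "\<And>s. 0 \<le> s \<Longrightarrow> s \<le> t \<Longrightarrow> norm (1 - s *\<^sub>R x) \<le> 1" by blast
    define T where "T = min (t / 2) (1 / (2 * ((norm c)\<^sup>2 + 1)))"
    have T: "T > 0" using t by (simp add: T_def add_nonneg_pos)
    have "norm (1 - s *\<^sub>R (c * c + x)) \<le> 1" if s: "0 \<le> s" "s \<le> T" for s
    proof -
      have x: "norm (1 - (2 * s) *\<^sub>R x) \<le> 1" using s by (intro t(2)) (auto simp: T_def)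
      have "2 * s * ((norm c)\<^sup>2 + 1) \<le> 1"
        using s add_nonneg_pos[of "(norm c)\<^sup>2" 1] by (simp add: T_def field_simps)
      then have "2 * s * (norm c)\<^sup>2 < 1 \<or> 2 * s * (norm c)\<^sup>2 = 1 \<and> s = 0" using s by (auto simp: algebra_simps)
      then have "2 * s * (norm c)\<^sup>2 < 1" by auto
      then have "(norm (sqrt (2 * s) *\<^sub>R c))\<^sup>2 < 1" using s by (simp add: power_mult_distrib)
      then have n: "norm (sqrt (2 * s) *\<^sub>R c) < 1" by (metis abs_norm_cancel abs_square_less_1)
      have "norm (1 - (sqrt (2 * s) *\<^sub>R c) * (sqrt (2 * s) *\<^sub>R c)) \<le> 1"
        by (rule norm_one_minus_square(1)[OF _ n]) (use add in \<open>simp add: star_scaleR\<close>)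
      then have c: "norm (1 - (2 * s) *\<^sub>R (c * c)) \<le> 1" using s by simp
      have "2 *\<^sub>R (1 - s *\<^sub>R (c * c + x)) = (1 - (2 * s) *\<^sub>R (c * c)) + (1 - (2 * s) *\<^sub>R x)"
        by (simp add: scaleR_2 scaleR_add_right scaleR_diff_right flip: scaleR_scaleR)
      then have "2 * norm (1 - s *\<^sub>R (c * c + x)) \<le> 1 + 1"
        using norm_triangle_mono[OF c x] by (metis norm_scaleR abs_numeral)
      then show ?thesis by simp
    qed
    then show ?case using T by blast
  qed
  then show ?thesis by force
qed

text \<open>In the cone lemma take the elements whose real part is a sum of squares of self-adjoint elements, and the
multiplications by sums of squares of central self-adjoint elements. The functional is then multiplicative
for \<open>z\<^sup>2\<close> with \<open>z\<close> central and self-adjoint, hence for \<open>z = ((z + 1)\<^sup>2 - (z - 1)\<^sup>2) / 4\<close>, hence for all central elements.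
Such a state plays the role of a pure state without the Krein-Milman theorem.\<close>

lemma central_state_exists:
  "\<exists>F :: 'a::unital_cstar_algebra \<Rightarrow> complex.
     state F \<and> (\<forall>z x. central z \<longrightarrow> F (z * x) = F z * F x)"
proof -
  define H where "H = {c :: 'a. star c = c}"
  define Z where "Z = {z :: 'a. star z = z \<and> central z}"
  define C where "C = {x :: 'a. x + star x \<in> sums_of_squares H}"
  define S where "S = (\<lambda>q x. q * x :: 'a) ` sums_of_squares Z"
  have cZ: "central q" if "q \<in> sums_of_squares Z" for q
    using that
  proof induction
    case (add c x)
    then show ?case by (intro central_add central_mult) (simp_all add: Z_def)
  qed (simp add: central_def)
  have sZ: "star q = q" if "q \<in> sums_of_squares Z" for q
    using that by induction (simp_all add: star_add star_mult Z_def)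
  have ZH: "z * c \<in> H" if "z \<in> Z" "c \<in> H" for z c
    using that by (simp add: Z_def H_def star_mult central_def)
  have ZZ: "z * c \<in> Z" if "z \<in> Z" "c \<in> Z" for z c
    using that by (auto simp: Z_def star_mult central_mult intro: central_commute[symmetric])
  have Zc: "central z" if "z \<in> Z" for z using that by (simp add: Z_def)
  have scale: "r *\<^sub>R x \<in> sums_of_squares H" if "r \<ge> 0" "x \<in> sums_of_squares H" for r x
    using that(2)
  proof induction
    case (add c x)
    have "r *\<^sub>R (c * c + x) = (sqrt r *\<^sub>R c) * (sqrt r *\<^sub>R c) + r *\<^sub>R x"
      using that(1) by (simp add: scaleR_add_right)
    moreover have "sqrt r *\<^sub>R c \<in> H" using add(1) by (simp add: H_def star_scaleR)
    ultimately show ?case using sums_of_squares.add[OF _ add(3)] by metis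
  qed (simp add: sums_of_squares.zero)
  have elim: "\<exists>q\<in>sums_of_squares Z. \<sigma> = (\<lambda>x. q * x)" if "\<sigma> \<in> S" for \<sigma> using that by (auto simp: S_def)
  have intro: "(\<lambda>x. q * x) \<in> S" if "q \<in> sums_of_squares Z" for q using that by (simp add: S_def)
  \<comment> \<open>\<open>2 r - (v + v\<^sup>*)\<close> is a square, by the square root of \<open>1 - (v + v\<^sup>*) / (2 r)\<close>.\<close>
  have order_unit: "r *\<^sub>R 1 - v \<in> C" if r: "r > norm v" for r v
  proof -
    define x where "x = (1 / (2 * r)) *\<^sub>R (v + star v)"
    have r0: "r > 0" using r norm_ge_zero[of v] by linarith
    have "norm (v + star v) \<le> 2 * norm v" using norm_triangle_ineq[of v "star v"] by (simp add: norm_star)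
    moreover have "norm x = (1 / (2 * r)) * norm (v + star v)" using r0 unfolding x_def norm_scaleR by simp
    ultimately have "norm x < 1" using r r0 by (simp add: divide_less_eq)
    moreover have "star x = x" by (simp add: x_def star_scaleR star_add star_star add.commute)
    ultimately obtain w where w: "star w = w" "w * w = 1 - x" using sqrt_one_minus[of x] by metis
    have "(sqrt (2 * r) *\<^sub>R w) * (sqrt (2 * r) *\<^sub>R w) = (2 * r) *\<^sub>R (1 - x)" using r0 by (simp add: w)
    also have "\<dots> = (r *\<^sub>R 1 - v) + star (r *\<^sub>R 1 - v)"
      using r0 by (simp add: x_def scaleR_diff_right star_diff star_scaleR) (simp add: scaleR_2 flip: scaleR_scaleR)
    finally have "(r *\<^sub>R 1 - v) + star (r *\<^sub>R 1 - v) = (sqrt (2 * r) *\<^sub>R w) * (sqrt (2 * r) *\<^sub>R w)" ..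
    moreover have "sqrt (2 * r) *\<^sub>R w \<in> H" by (simp add: H_def star_scaleR w)
    ultimately show ?thesis unfolding C_def mem_Collect_eq by (metis sums_of_squares_square)
  qed
  obtain f :: "'a \<Rightarrow> real" where f: "linear f" "\<And>x. x \<in> C \<Longrightarrow> f x \<ge> 0" "f 1 = 1"
    "\<And>\<sigma> x. \<sigma> \<in> S \<Longrightarrow> f (\<sigma> x) = f (\<sigma> 1) * f x"
  proof (rule cone_functional[where C = C and e = 1 and S = S])
    show "x + y \<in> C" if "x \<in> C" "y \<in> C" for x y
    proof -
      have "x + y + star (x + y) = (x + star x) + (y + star y)" by (simp add: star_add)
      then show ?thesis using that unfolding C_def mem_Collect_eq by (metis sums_of_squares_add)
    qed
    show "\<exists>r. r *\<^sub>R 1 - v \<in> C" for v using order_unit[of v "norm v + 1"] by auto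
    show "1 \<in> C"
      using order_unit[of "- 1" 2]
      using scale[of 2 "1 * 1"] sums_of_squares_square[of 1 H] by (simp add: C_def H_def scaleR_2)
    show "- 1 \<notin> C"
    proof
      assume "- 1 \<in> C"
      then have "(- 2) *\<^sub>R 1 \<in> sums_of_squares H" by (simp add: C_def star_minus scaleR_2)
      then obtain t where t: "t > 0" "norm (1 - t *\<^sub>R ((- 2) *\<^sub>R (1::'a))) \<le> 1"
        using sums_of_squares_small unfolding H_def by blast
      have "1 - t *\<^sub>R ((- 2) *\<^sub>R (1::'a)) = (1 + 2 * t) *\<^sub>R 1" by (simp add: scaleR_left_distrib mult.commute)
      then show False using t by simp
    qed
  next
    fix \<sigma> assume "\<sigma> \<in> S"
    then obtain q where q: "q \<in> sums_of_squares Z" "\<sigma> = (\<lambda>x. q * x)" using elim by blast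
    show "\<sigma> (x + y) = \<sigma> x + \<sigma> y" for x y by (simp add: q distrib_left)
    show "\<sigma> x \<in> C" if "x \<in> C" for x
    proof -
      have "star x * q = q * star x" using cZ[OF q(1)] by (simp add: central_def)
      then have "q * x + star (q * x) = q * (x + star x)"
        by (simp add: star_mult sZ[OF q(1)] distrib_left)
      then show ?thesis using sums_of_squares_mult[OF q(1) _ Zc ZH] that by (simp add: C_def q(2))
    qed
  next
    fix \<sigma> \<tau> assume "\<sigma> \<in> S" "\<tau> \<in> S"
    then obtain q p where q: "q \<in> sums_of_squares Z" "\<sigma> = (\<lambda>x. q * x)"
      and p: "p \<in> sums_of_squares Z" "\<tau> = (\<lambda>x. p * x)" using elim by meson
    show "(\<lambda>x. \<sigma> (\<tau> x)) \<in> S"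
      using intro[OF sums_of_squares_mult[OF q(1) p(1) Zc ZZ]] by (simp add: q(2) p(2) mult.assoc)
    show "(\<lambda>x. \<sigma> x + \<tau> x) \<in> S"
      using intro[OF sums_of_squares_add[OF q(1) p(1)]] by (simp add: q(2) p(2) distrib_right)
    have "q * p = p * q" using cZ[OF q(1)] by (simp add: central_def)
    then show "\<sigma> (\<tau> x) = \<tau> (\<sigma> x)" for x by (simp add: q(2) p(2) flip: mult.assoc)
  next
    fix r :: real assume r: "r \<ge> 0"
    have "sqrt r *\<^sub>R 1 \<in> Z" by (simp add: Z_def star_scaleR central_def)
    from intro[OF sums_of_squares_square[OF this]] show "(\<lambda>x. r *\<^sub>R x) \<in> S" using r by simp
  qed blast
  have "f v \<le> norm v" for v
  proof (rule field_le_epsilon)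
    fix e :: real assume "e > 0"
    then have "f ((norm v + e) *\<^sub>R 1 - v) \<ge> 0" by (intro f(2) order_unit) simp
    then show "f v \<le> norm v + e" by (simp add: linear_diff[OF f(1)] linear_scale[OF f(1)] f(3))
  qed
  then obtain F where F: "state F" "\<And>v. Re (F v) = f v"
    using state_of_real_linear[OF f(1) _ f(3)] by auto
  note Fadd = clinear_add[OF state_clinear[OF F(1)]] and Fdiff = clinear_diff[OF state_clinear[OF F(1)]]
    and Fscale = clinear_scaleC[OF state_clinear[OF F(1)]] and FscaleR = clinear_scaleR[OF state_clinear[OF F(1)]]
  have square: "F (z * z * x) = F (z * z) * F x" if z: "z \<in> Z" for z x
  proof -
    have fz: "f (z * z * x) = f (z * z) * f x" for x
      using f(4)[OF intro[OF sums_of_squares_square[OF z]], of x] by simp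
    have im: "Im (F y) = - f (\<i> *\<^sub>C y)" for y by (simp add: Fscale flip: F(2))
    have "star (z * z) = z * z" using z by (simp add: Z_def star_mult)
    then have r: "f (\<i> *\<^sub>C (z * z)) = 0" using state_selfadjoint_real[OF F(1)] im by force
    show ?thesis
      using fz[of x] fz[of "\<i> *\<^sub>C x"] by (simp add: complex_eq_iff F(2) r im mult_scaleC_right)
  qed
  have sa: "F (z * x) = F z * F x" if z: "z \<in> Z" for z x
  proof -
    have p: "z + 1 \<in> Z" "z - 1 \<in> Z"
      using z by (simp_all add: Z_def star_add star_diff central_def algebra_simps)
    have e: "4 *\<^sub>R (z * x) = (z + 1) * (z + 1) * x - (z - 1) * (z - 1) * x" for x
      by (simp add: algebra_simps scaleR_4 scaleR_2)
    have "4 *\<^sub>R F (z * x) = F ((z + 1) * (z + 1)) * F x - F ((z - 1) * (z - 1)) * F x"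
      unfolding FscaleR[symmetric] e Fdiff by (simp only: square p)
    also have "\<dots> = F (4 *\<^sub>R (z * 1)) * F x" unfolding e Fdiff by (simp add: left_diff_distrib)
    finally show ?thesis by (simp add: FscaleR)
  qed
  have "F (z * x) = F z * F x" if z: "central z" for z x
  proof -
    have sz: "central (star z)"
      unfolding central_def
    proof
      fix b
      have "z * star b = star b * z" using z by (simp add: central_def)
      then have "star (z * star b) = star (star b * z)" by simp
      then show "star z * b = b * star z" by (simp add: star_mult star_star)
    qed
    have "central (real_part z)" "central (imag_part z)"
      using z sz by (simp_all add: central_def real_part_def imag_part_def algebra_simps mult_scaleC_left mult_scaleC_right)
    then have Zz: "real_part z \<in> Z" "imag_part z \<in> Z" by (simp_all add: Z_def)
    have d: "z = real_part z + \<i> *\<^sub>C imag_part z" by (simp add: real_imag_part)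
    have "F (z * x) = F (real_part z * x) + \<i> * F (imag_part z * x)"
      by (subst d) (simp add: distrib_right mult_scaleC_left Fadd Fscale)
    also have "\<dots> = F z * F x"
      by (subst (3) d) (simp add: sa[OF Zz(1)] sa[OF Zz(2)] Fadd Fscale distrib_right)
    finally show ?thesis .
  qed
  then show ?thesis using F(1) by blast
qed

section \<open>Slice maps on the projective tensor product\<close>

lemma ptensor_eqI:
  fixes h h' :: "('a::complex_normed_vector, 'b::complex_normed_vector) ptensor \<Rightarrow> 'c::complex_normed_vector"
  assumes "bounded_clinear h" "bounded_clinear h'" "\<And>x y. h (x \<otimes>\<^sub>\<gamma> y) = h' (x \<otimes>\<^sub>\<gamma> y)"
  shows "h z = h' z"
proof -
  have "h = h'"
    by (rule ptensor_ext_unique)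
      (use assms in \<open>auto simp: bounded_clinear_clinear bounded_clinear_continuous\<close>)
  then show ?thesis by simp
qed

lemma ptensor_norm_bound:
  fixes h :: "('a::complex_normed_vector, 'b::complex_normed_vector) ptensor \<Rightarrow> 'c::complex_normed_vector"
  assumes h: "clinear h" "continuous_on UNIV h"
    and K: "K \<ge> 0" "\<And>x y. norm (h (x \<otimes>\<^sub>\<gamma> y)) \<le> K * (norm x * norm y)"
  shows "norm (h z) \<le> K * norm z"
proof -
  have incl: "norm (h (tensor_incl t)) \<le> K * proj_norm t" for t
  proof (rule proj_norm_additive_bound[where N = norm and F = "\<lambda>t. h (tensor_incl t)"])
    show "norm (h (tensor_incl (pure_tensor x y))) \<le> K * (norm x * norm y)" for x y
      using K(2) by (simp flip: ptens_def)
  qed (simp_all add: tensor_incl_add clinear_add[OF h(1)] norm_triangle_ineq K(1))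
  obtain f where f: "proj_Cauchy f" "z = abs_ptensor f" using ptensor_cases by blast
  show ?thesis
  proof (rule LIMSEQ_le)
    have "(\<lambda>n. h (tensor_incl (f n))) \<longlonglongrightarrow> h z"
      using tensor_incl_tendsto[OF f(1)] h(2) f(2)
      by (auto simp: continuous_on_eq_continuous_at intro: isCont_tendsto_compose)
    then show "(\<lambda>n. norm (h (tensor_incl (f n)))) \<longlonglongrightarrow> norm (h z)" by (rule tendsto_norm)
    show "(\<lambda>n. K * proj_norm (f n)) \<longlonglongrightarrow> K * norm z"
      unfolding f(2) by (intro tendsto_mult_left norm_abs_ptensor f(1))
  qed (use incl in blast)
qed

lemma bounded_clinear_ptens_left: "bounded_clinear (\<lambda>x. x \<otimes>\<^sub>\<gamma> y)"
  by (rule bounded_clinearI[of _ "norm y"])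
    (auto simp: clinear_def ptens_add_left ptens_scaleC_left mult.commute[of "norm y"] norm_ptens_le)

lemma bounded_clinear_ptens_right: "bounded_clinear (\<lambda>y. x \<otimes>\<^sub>\<gamma> y)"
  by (rule bounded_clinearI[of _ "norm x"])
    (auto simp: clinear_def ptens_add_right ptens_scaleC_right norm_ptens_le)

lemma ptens_diff:
  "(x - x') \<otimes>\<^sub>\<gamma> y = x \<otimes>\<^sub>\<gamma> y - x' \<otimes>\<^sub>\<gamma> y" "x \<otimes>\<^sub>\<gamma> (y - y') = x \<otimes>\<^sub>\<gamma> y - x \<otimes>\<^sub>\<gamma> y'"
  by (rule bounded_clinear_diff[OF bounded_clinear_ptens_left])
    (rule bounded_clinear_diff[OF bounded_clinear_ptens_right])

lemma ptens_scaleR: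
  "(r *\<^sub>R x) \<otimes>\<^sub>\<gamma> y = r *\<^sub>R (x \<otimes>\<^sub>\<gamma> y)" "x \<otimes>\<^sub>\<gamma> (r *\<^sub>R y) = r *\<^sub>R (x \<otimes>\<^sub>\<gamma> y)"
  by (simp_all add: scaleR_scaleC ptens_scaleC_left ptens_scaleC_right)

lemma bounded_clinear_flip:
  "bounded_clinear (flip :: ('a::complex_normed_vector, 'b::complex_normed_vector) ptensor \<Rightarrow> ('b, 'a) ptensor)"
  and norm_flip_le: "norm (flip z :: ('b, 'a) ptensor) \<le> norm (z :: ('a, 'b) ptensor)"
proof -
  have "norm (flip (x \<otimes>\<^sub>\<gamma> y)) \<le> 1 * (norm x * norm y)" for x :: 'a and y :: 'b
    using norm_ptens_le[of y x] by (simp add: flip(3) mult.commute)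
  from ptensor_norm_bound[OF flip(1,2) _ this]
  show le: "norm (flip z :: ('b, 'a) ptensor) \<le> norm (z :: ('a, 'b) ptensor)" for z by simp
  show "bounded_clinear (flip :: ('a, 'b) ptensor \<Rightarrow> ('b, 'a) ptensor)"
    by (rule bounded_clinearI[OF flip(1), of 1]) (simp add: le)
qed

lemma flip_flip [simp]: "flip (flip z) = (z :: ('a::complex_normed_vector, 'b::complex_normed_vector) ptensor)"
  by (rule ptensor_eqI[of "\<lambda>z. flip (flip z)" "\<lambda>z. z", OF bounded_clinear_compose[OF bounded_clinear_flip bounded_clinear_flip]])
    (auto simp: flip(3) clinear_def intro: bounded_clinearI[of _ 1])

text \<open>The index names the factor that the functional is applied to: \<open>slice_right f = id \<otimes> f\<close> has values in the
first factor.\<close>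

definition slice_right :: "('b \<Rightarrow> complex) \<Rightarrow> ('a::{complex_normed_vector, banach}, 'b::complex_normed_vector) ptensor \<Rightarrow> 'a" where
  "slice_right f = ptensor_ext (\<lambda>x y. f y *\<^sub>C x)"

definition slice_left :: "('a \<Rightarrow> complex) \<Rightarrow> ('a::complex_normed_vector, 'b::{complex_normed_vector, banach}) ptensor \<Rightarrow> 'b" where
  "slice_left f z = slice_right f (flip z)"

text \<open>The quantitative form is needed for states: slicing by a state is contractive.\<close>

lemma slice_right:
  fixes f :: "'b::complex_normed_vector \<Rightarrow> complex"
  assumes "clinear f" and K: "K \<ge> 0" "\<And>y. norm (f y) \<le> K * norm y"
  shows slice_right_ptens: "slice_right f (x \<otimes>\<^sub>\<gamma> y) = f y *\<^sub>C (x::'a::{complex_normed_vector, banach})"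
    and norm_slice_right: "norm (slice_right f z :: 'a) \<le> K * norm z"
    and clinear_slice_right: "clinear (slice_right f :: _ \<Rightarrow> 'a)"
proof -
  have b: "norm (f y *\<^sub>C x) \<le> K * (norm x * norm y)" for x :: 'a and y
    using mult_right_mono[OF K(2)[of y] norm_ge_zero[of x]] by (simp add: norm_scaleC algebra_simps)
  note ext = ptensor_ext[where G = "\<lambda>x y. f y *\<^sub>C x", OF _ _ K(1) b, folded slice_right_def]
  have c: "clinear (\<lambda>y. f y *\<^sub>C x)" "clinear (\<lambda>x. f y *\<^sub>C x)" for x :: 'a and y
    using assms(1) by (simp_all add: clinear_def scaleC_add_left scaleC_add_right scaleC_scaleC mult.commute)
  show s: "slice_right f (x \<otimes>\<^sub>\<gamma> y) = f y *\<^sub>C (x::'a)" for x y by (rule ext(3)[OF c])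
  show "clinear (slice_right f :: _ \<Rightarrow> 'a)" by (rule ext(1)[OF c])
  show "norm (slice_right f z :: 'a) \<le> K * norm z"
    by (rule ptensor_norm_bound[OF ext(1)[OF c] ext(2)[OF c] K(1)]) (simp add: s b)
qed

context
  fixes f :: "'b::complex_normed_vector \<Rightarrow> complex"
  assumes f: "bounded_clinear f"
begin

lemma bounded_clinear_slice_right:
  "bounded_clinear (slice_right f :: _ \<Rightarrow> 'a::{complex_normed_vector, banach})"
proof -
  obtain K where K: "K \<ge> 0" "\<And>x. norm (f x) \<le> K * norm x" using bounded_clinearD[OF f] by metis
  show ?thesis
    by (rule bounded_clinearI[OF clinear_slice_right norm_slice_right])
      (use K bounded_clinear_clinear[OF f] in auto)
qed

lemma slice_right_pure:
  "slice_right f (x \<otimes>\<^sub>\<gamma> y) = f y *\<^sub>C (x::'a::{complex_normed_vector, banach})"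
  using slice_right_ptens[OF bounded_clinear_clinear[OF f]] bounded_clinearD[OF f] by metis

lemma bounded_clinear_slice_left:
  "bounded_clinear (slice_left f :: _ \<Rightarrow> 'a::{complex_normed_vector, banach})"
  unfolding slice_left_def[abs_def]
  by (rule bounded_clinear_compose[OF bounded_clinear_slice_right bounded_clinear_flip])

lemma slice_left_pure:
  "slice_left f (x \<otimes>\<^sub>\<gamma> y) = f x *\<^sub>C (y::'a::{complex_normed_vector, banach})"
  by (simp add: slice_left_def flip(3) slice_right_pure)

end

lemma slice_swap:
  fixes f :: "'b::{complex_normed_vector, banach} \<Rightarrow> complex" and g :: "'a::{complex_normed_vector, banach} \<Rightarrow> complex"
  assumes f: "bounded_clinear f" and g: "bounded_clinear g"
  shows "g (slice_right f z) = f (slice_left g z)"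
  by (rule ptensor_eqI[of "\<lambda>z. g (slice_right f z)" "\<lambda>z. f (slice_left g z)"])
    (simp_all add: bounded_clinear_compose[OF g bounded_clinear_slice_right[OF f]]
      bounded_clinear_compose[OF f bounded_clinear_slice_left[OF g]] slice_right_pure[OF f]
      slice_left_pure[OF g] bounded_clinear_scaleC[OF f] bounded_clinear_scaleC[OF g])

text \<open>A product of two states separates \<open>1 \<otimes> 1\<close> from \<open>0\<close>.\<close>

instance ptensor :: (unital_cstar_algebra, unital_cstar_algebra) real_normed_algebra_1
proof
  obtain f :: "'a \<Rightarrow> complex" where f: "state f" using central_state_exists by blast
  obtain g :: "'b \<Rightarrow> complex" where g: "state g" using central_state_exists by blast
  have b: "bounded_clinear f" "bounded_clinear g" using f g by (simp_all add: state_bounded_clinear)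
  have "f (slice_right g (1 \<otimes>\<^sub>\<gamma> 1)) = 1"
    by (simp add: slice_right_pure[OF b(2)] state_one[OF f] state_one[OF g] scaleC_one)
  moreover have "f (slice_right g 0) = 0"
    by (simp add: bounded_clinear_zero[OF bounded_clinear_compose[OF b(1) bounded_clinear_slice_right[OF b(2)]]])
  ultimately show ne: "0 \<noteq> (1 :: ('a, 'b) ptensor)" unfolding ptens_one by auto
  have "norm (1 :: ('a, 'b) ptensor) \<le> 1" using norm_ptens_le[of "1::'a" "1::'b"] by (simp add: ptens_one)
  moreover have "norm (1 :: ('a, 'b) ptensor) \<le> norm (1 :: ('a, 'b) ptensor) * norm (1 :: ('a, 'b) ptensor)"
    using norm_mult_ineq[of "1 :: ('a, 'b) ptensor" 1] by simp
  moreover have "norm (1 :: ('a, 'b) ptensor) > 0" using ne by simp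
  ultimately show "norm (1 :: ('a, 'b) ptensor) = 1" by simp
qed

context
  fixes f :: "'b::unital_cstar_algebra \<Rightarrow> complex"
  assumes f: "bounded_clinear f"
begin

lemma bounded_clinear_mult_functional:
  "bounded_clinear (\<lambda>y. f (c * y))" "bounded_clinear (\<lambda>y. f (y * c))" "bounded_clinear (\<lambda>y. f (c * y * d))"
  using bounded_clinear_compose[OF f bounded_clinear_mult_left[of c]]
    bounded_clinear_compose[OF f bounded_clinear_mult_right[of c]]
    bounded_clinear_compose[OF bounded_clinear_compose[OF f bounded_clinear_mult_right[of d]] bounded_clinear_mult_left[of c]]
  by simp_all

lemma slice_right_mult_left:
  "slice_right f ((x \<otimes>\<^sub>\<gamma> c) * z) = (x::'a::unital_cstar_algebra) * slice_right (\<lambda>y. f (c * y)) z"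
proof (rule ptensor_eqI[of "\<lambda>z. slice_right f ((x \<otimes>\<^sub>\<gamma> c) * z)"])
  show "bounded_clinear (\<lambda>z. slice_right f ((x \<otimes>\<^sub>\<gamma> c) * z))"
    by (rule bounded_clinear_compose[OF bounded_clinear_slice_right[OF f] bounded_clinear_mult_left])
  show "bounded_clinear (\<lambda>z. x * slice_right (\<lambda>y. f (c * y)) z)"
    by (rule bounded_clinear_compose[OF bounded_clinear_mult_left
          bounded_clinear_slice_right[OF bounded_clinear_mult_functional(1)]])
qed (simp add: ptens_mult slice_right_pure[OF f] slice_right_pure[OF bounded_clinear_mult_functional(1)] mult_scaleC_right)

lemma slice_right_mult_right:
  "slice_right f (z * (x \<otimes>\<^sub>\<gamma> c)) = slice_right (\<lambda>y. f (y * c)) z * (x::'a::unital_cstar_algebra)"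
proof (rule ptensor_eqI[of "\<lambda>z. slice_right f (z * (x \<otimes>\<^sub>\<gamma> c))"])
  show "bounded_clinear (\<lambda>z. slice_right f (z * (x \<otimes>\<^sub>\<gamma> c)))"
    by (rule bounded_clinear_compose[OF bounded_clinear_slice_right[OF f] bounded_clinear_mult_right])
  show "bounded_clinear (\<lambda>z. slice_right (\<lambda>y. f (y * c)) z * x)"
    by (rule bounded_clinear_compose[OF bounded_clinear_mult_right
          bounded_clinear_slice_right[OF bounded_clinear_mult_functional(2)]])
qed (simp add: ptens_mult slice_right_pure[OF f] slice_right_pure[OF bounded_clinear_mult_functional(2)] mult_scaleC_left)

end

lemma slice_left_mult:
  fixes g :: "'a::unital_cstar_algebra \<Rightarrow> complex"
  assumes g: "bounded_clinear g"
  shows "slice_left g ((1 \<otimes>\<^sub>\<gamma> c) * z) = (c::'b::unital_cstar_algebra) * slice_left g z"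
    and "slice_left g (z * (1 \<otimes>\<^sub>\<gamma> c)) = slice_left g z * c"
proof -
  show "slice_left g ((1 \<otimes>\<^sub>\<gamma> c) * z) = c * slice_left g z"
    by (rule ptensor_eqI[of "\<lambda>z. slice_left g ((1 \<otimes>\<^sub>\<gamma> c) * z)"
          "\<lambda>z. c * slice_left g z", OF
          bounded_clinear_compose[OF bounded_clinear_slice_left[OF g] bounded_clinear_mult_left]
          bounded_clinear_compose[OF bounded_clinear_mult_left bounded_clinear_slice_left[OF g]]])
      (simp add: ptens_mult slice_left_pure[OF g] mult_scaleC_right)
  show "slice_left g (z * (1 \<otimes>\<^sub>\<gamma> c)) = slice_left g z * c"
    by (rule ptensor_eqI[of "\<lambda>z. slice_left g (z * (1 \<otimes>\<^sub>\<gamma> c))"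
          "\<lambda>z. slice_left g z * c", OF
          bounded_clinear_compose[OF bounded_clinear_slice_left[OF g] bounded_clinear_mult_right]
          bounded_clinear_compose[OF bounded_clinear_mult_right bounded_clinear_slice_left[OF g]]])
      (simp add: ptens_mult slice_left_pure[OF g] mult_scaleC_left)
qed

lemma bounded_clinear_star_conj:
  fixes h :: "'a::unital_banach_star_algebra \<Rightarrow> 'b::unital_banach_star_algebra"
  assumes h: "bounded_clinear h"
  shows "bounded_clinear (\<lambda>x. star (h (star x)))"
proof -
  obtain K where K: "K \<ge> 0" "\<And>x. norm (h x) \<le> K * norm x" using bounded_clinearD[OF h] by metis
  show ?thesis
  proof (rule bounded_clinearI)
    show "clinear (\<lambda>x. star (h (star x)))"
      by (simp add: clinear_def star_add star_scaleC bounded_clinear_add[OF h] bounded_clinear_scaleC[OF h])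
    show "norm (star (h (star x))) \<le> K * norm x" for x using K(2)[of "star x"] by (simp add: norm_star)
  qed
qed

lemma slice_right_star:
  fixes f :: "'b::unital_cstar_algebra \<Rightarrow> complex"
  assumes f: "bounded_clinear f"
  shows "slice_right f (star z) = star (slice_right (\<lambda>y. cnj (f (star y))) z :: 'a::unital_cstar_algebra)"
proof -
  have f': "bounded_clinear (\<lambda>y. cnj (f (star y)))" using bounded_clinear_star_conj[OF f] by simp
  have "star (slice_right f (star z)) = slice_right (\<lambda>y. cnj (f (star y))) z"
    by (rule ptensor_eqI[OF bounded_clinear_star_conj[OF bounded_clinear_slice_right[OF f]]
          bounded_clinear_slice_right[OF f']])
      (simp add: star_ptens slice_right_pure[OF f] slice_right_pure[OF f'] star_scaleC star_star)
  then show ?thesis by (metis star_star)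
qed

section \<open>Inner automorphisms of the tensor product\<close>

text \<open>For \<open>h = v\<^sup>* v\<close> and \<open>k = v v\<^sup>*\<close> centrality gives \<open>h\<^sup>2 = h k = k\<^sup>2\<close>, so that the self-adjoint element \<open>h - k\<close>
has square zero.\<close>

lemma normal_if_central:
  fixes v :: "'a::unital_cstar_algebra"
  assumes "central (star v * v)" "central (v * star v)"
  shows "star v * v = v * star v"
proof -
  define h k where "h = star v * v" and "k = v * star v"
  have hk: "h * k = k * h" using central_commute[OF assms(1)] by (simp add: h_def k_def)
  have "h * h = star v * (k * v)" by (simp add: h_def k_def mult.assoc)
  also have "\<dots> = h * k" using central_commute[OF assms(2), of v] by (simp add: h_def k_def mult.assoc)
  finally have hh: "h * h = h * k" .
  have "k * k = v * (h * star v)" by (simp add: h_def k_def mult.assoc)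
  also have "\<dots> = k * h" using central_commute[OF assms(1), of "star v"] by (simp add: h_def k_def mult.assoc)
  finally have kk: "k * k = k * h" .
  have "star (h - k) * (h - k) = 0"
    by (simp add: h_def k_def star_diff star_mult star_star) (simp add: algebra_simps hh kk hk flip: h_def k_def)
  then have "h - k = 0" by (rule star_mult_self_eq_0)
  then show ?thesis by (simp add: h_def k_def)
qed

lemma star_real_imag: "star v = real_part v - \<i> *\<^sub>C imag_part v"
  by (subst real_imag_part[of v, symmetric]) (simp only: star_add star_scaleC star_real_part star_imag_part, simp add: scaleC_minus_left)

lemma normal_star_mult_self:
  fixes v :: "'a::unital_cstar_algebra"
  assumes "star v * v = v * star v"
  shows "star v * v = real_part v * real_part v + imag_part v * imag_part v"
proof -
  define a b where "a = real_part v" and "b = imag_part v"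
  have v: "v = a + \<i> *\<^sub>C b" and sv: "star v = a - \<i> *\<^sub>C b"
    by (simp_all add: a_def b_def real_imag_part star_real_imag)
  have 1: "star v * v = a * a + b * b + \<i> *\<^sub>C (a * b - b * a)"
    unfolding sv unfolding v
    by (simp add: algebra_simps mult_scaleC_left mult_scaleC_right scaleC_scaleC scaleC_diff_right
        scaleC_add_right scaleC_minus_one)
  have 2: "v * star v = a * a + b * b - \<i> *\<^sub>C (a * b - b * a)"
    unfolding sv unfolding v
    by (simp add: algebra_simps mult_scaleC_left mult_scaleC_right scaleC_scaleC scaleC_diff_right
        scaleC_add_right scaleC_minus_one)
  have "2 *\<^sub>R (star v * v) = star v * v + v * star v" using assms by (simp add: scaleR_2)
  also have "\<dots> = 2 *\<^sub>R (a * a + b * b)" unfolding 1 2 by (simp add: scaleR_2)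
  finally show ?thesis by (simp add: a_def b_def)
qed

lemma norm_real_part: "norm (real_part x) \<le> norm x"
  and norm_imag_part: "norm (imag_part x) \<le> norm x"
  using norm_triangle_ineq[of x "star x"] norm_triangle_ineq4[of x "star x"]
  by (simp_all add: real_part_def imag_part_def norm_star norm_scaleC norm_minus_commute)

lemma telescope_power: "(1 - s) * (\<Sum>j<n. s ^ j) = 1 - (s::'a::ring_1) ^ n"
proof (induction n)
  case (Suc n)
  have "(1 - s) * (\<Sum>j<Suc n. s ^ j) = (1 - s) * (\<Sum>j<n. s ^ j) + (1 - s) * s ^ n" by (simp add: distrib_left)
  also have "\<dots> = 1 - s ^ n + (s ^ n - s * s ^ n)" by (simp only: Suc left_diff_distrib[of 1 s "s ^ n"] mult_1_left)
  finally show ?case by simp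
qed simp

lemma central_power: "central s \<Longrightarrow> central (s ^ n)"
  by (induction n) (simp_all add: central_mult, simp add: central_def)

text \<open>A replacement for the Cauchy-Schwarz inequality. Let \<open>k = v\<^sup>* v\<close> be small and \<open>s = 1 - 2 k\<close>. The means
\<open>c\<^sub>n = (1 + s + \<dots> + s\<^sup>n\<^sup>-\<^sup>1) / n\<close> are central with \<open>F c\<^sub>n = 1\<close>, while \<open>\<parallel>k c\<^sub>n\<parallel> \<le> 1 / n\<close> by telescoping. Hence
\<open>F (c v) = F (c v c\<^sub>n)\<close> and \<open>\<parallel>v c\<^sub>n\<parallel>\<^sup>2 = \<parallel>c\<^sub>n\<^sup>* k c\<^sub>n\<parallel> \<le> 1 / n\<close> tends to zero. Below, \<open>C n\<close> is \<open>n c\<^sub>n\<close>.\<close>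

lemma central_state_normal_kernel:
  fixes F :: "'a::unital_cstar_algebra \<Rightarrow> complex"
  assumes F: "state F" "\<And>z x. central z \<Longrightarrow> F (z * x) = F z * F x"
    and v: "central (star v * v)" "central (v * star v)" and F0: "F (star v * v) = 0"
  shows "F (c * v) = 0"
proof -
  note Fl = state_clinear[OF F(1)]
  have small: "F (c * v) = 0"
    if c1: "central (star v * v)" "central (v * star v)" and F0: "F (star v * v) = 0" and n: "norm v < 1/2" for v
  proof -
    define a b where "a = real_part v" and "b = imag_part v"
    define k where "k = star v * v"
    have k: "k = a * a + b * b"
      unfolding k_def a_def b_def by (rule normal_star_mult_self[OF normal_if_central[OF c1]])
    define s where "s = 1 - 2 *\<^sub>R k"
    \<comment> \<open>\<open>v\<close> is normal, so \<open>k\<close> is the sum of the squares of its real and imaginary parts, and \<open>s\<close> is the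
      mean of \<open>1 - 4 a\<^sup>2\<close> and \<open>1 - 4 b\<^sup>2\<close>.\<close>
    have sq: "norm (1 - 4 *\<^sub>R (h * h)) \<le> 1" if "star h = h" "norm h \<le> norm v" for h :: 'a
      using norm_one_minus_square(1)[of "2 *\<^sub>R h"] that n by (simp add: star_scaleR)
    have "2 *\<^sub>R s = (1 - 4 *\<^sub>R (a * a)) + (1 - 4 *\<^sub>R (b * b))"
      by (simp add: s_def k scaleR_diff_right scaleR_add_right scaleR_2 scaleR_4)
    moreover have "norm \<dots> \<le> 1 + 1"
      by (intro norm_triangle_mono sq) (simp_all add: a_def b_def norm_real_part norm_imag_part)
    ultimately have "norm (2 *\<^sub>R s) \<le> 2" by simp
    then have s1: "norm s \<le> 1" by simp
    have sc: "central s" using c1(1) by (simp add: s_def k_def central_def algebra_simps)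
    have Fs: "F s = 1" using F0 by (simp add: s_def k_def clinear_diff[OF Fl] clinear_scaleR[OF Fl] state_one[OF F(1)])
    have Fsj: "F (s ^ j) = 1" for j
      by (induction j) (simp_all add: state_one[OF F(1)] F(2)[OF sc] Fs)
    define C where "C n = (\<Sum>j<n. s ^ j)" for n
    have Cc: "central (C n)" for n
      by (induction n) (simp_all add: C_def central_add central_power sc, simp add: central_def)
    have FC: "F (C n) = of_nat n" for n by (simp add: C_def clinear_sum[OF Fl] Fsj)
    have sn: "norm (s ^ j) \<le> 1" for j
      by (rule order.trans[OF norm_power_ineq]) (use s1 in \<open>simp add: power_le_one\<close>)
    have nC: "norm (C n) \<le> real n" for n
      unfolding C_def by (rule order.trans[OF sum_norm_le[where g = "\<lambda>_. 1"]]) (simp_all add: sn)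
    have kC: "norm (k * C n) \<le> 1" for n
    proof -
      have "2 *\<^sub>R (k * C n) = 1 - s ^ n"
        using telescope_power[of s n] by (simp add: s_def C_def)
      moreover have "norm (1 - s ^ n) \<le> 1 + 1"
        by (rule order.trans[OF norm_triangle_ineq4]) (use sn[of n] in simp)
      ultimately have "norm (2 *\<^sub>R (k * C n)) \<le> 2" by simp
      then show ?thesis by simp
    qed
    have "real n * (cmod (F (c * v)))\<^sup>2 \<le> (norm c)\<^sup>2" for n
    proof (cases "n = 0")
      case False
      have "of_nat n * F (c * v) = F (c * (v * C n))"
        using F(2)[OF Cc, of n "c * v"] central_commute[OF Cc, of n "c * v"] by (simp add: FC mult.assoc)
      then have "real n * cmod (F (c * v)) = cmod (F (c * (v * C n)))" by (metis norm_mult norm_of_nat)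
      also have "\<dots> \<le> norm c * norm (v * C n)"
        by (rule order.trans[OF state_bound[OF F(1)] norm_mult_ineq])
      finally have "(real n * cmod (F (c * v)))\<^sup>2 \<le> (norm c * norm (v * C n))\<^sup>2"
        by (intro power_mono) auto
      also have "\<dots> = (norm c)\<^sup>2 * (norm (v * C n))\<^sup>2" by (rule power_mult_distrib)
      also have "\<dots> \<le> (norm c)\<^sup>2 * real n"
      proof (rule mult_left_mono)
        have "(norm (v * C n))\<^sup>2 = norm (star (C n) * (k * C n))"
          by (simp add: k_def star_mult mult.assoc flip: norm_star_mult_self)
        also have "\<dots> \<le> norm (star (C n)) * norm (k * C n)" by (rule norm_mult_ineq)
        also have "\<dots> \<le> real n * 1" using nC[of n] kC[of n] by (intro mult_mono) (auto simp: norm_star)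
        finally show "(norm (v * C n))\<^sup>2 \<le> real n" by simp
      qed simp
      finally have "(real n * cmod (F (c * v)))\<^sup>2 \<le> (norm c)\<^sup>2 * real n" .
      then have "real n * (real n * (cmod (F (c * v)))\<^sup>2) \<le> real n * (norm c)\<^sup>2"
        by (simp add: power2_eq_square algebra_simps)
      then show ?thesis using False by simp
    qed simp
    then have bd: "real n * (cmod (F (c * v)))\<^sup>2 \<le> (norm c)\<^sup>2" for n .
    show ?thesis
    proof (rule ccontr)
      assume "F (c * v) \<noteq> 0"
      then have p: "(cmod (F (c * v)))\<^sup>2 > 0" by simp
      then obtain n where "(norm c)\<^sup>2 < real n * (cmod (F (c * v)))\<^sup>2" using reals_Archimedean3 by blast
      then show False using bd[of n] by simp
    qed
  qed
  define t where "t = 1 / (2 * (norm v + 1))"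
  have t: "t > 0" by (simp add: t_def add_nonneg_pos)
  have sc: "central (r *\<^sub>R x)" if "central x" for r and x :: 'a using that by (simp add: central_def)
  have "F (c * (t *\<^sub>R v)) = 0"
  proof (rule small)
    show "central (star (t *\<^sub>R v) * (t *\<^sub>R v))" "central (t *\<^sub>R v * star (t *\<^sub>R v))"
      using v by (simp_all add: star_scaleR sc)
    show "F (star (t *\<^sub>R v) * (t *\<^sub>R v)) = 0" using F0 by (simp add: star_scaleR clinear_scaleR[OF Fl])
    show "norm (t *\<^sub>R v) < 1 / 2" using t by (simp add: t_def field_simps add_nonneg_pos)
  qed
  then show ?thesis using t by (simp add: clinear_scaleR[OF Fl])
qed

text \<open>Let \<open>I\<close> be the space of intertwiners of the identity with \<open>\<psi>\<close>; all slices of \<open>u\<close> in \<open>B\<close> belong to it. For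
\<open>v, w \<in> I\<close> the elements \<open>v\<^sup>* w\<close> and \<open>v v\<^sup>*\<close> are central, whence
\<open>F (v\<^sup>* v) F (c w d) = F (v\<^sup>* w) F (c v d)\<close> for a state \<open>F\<close> that is multiplicative on the centre. Read as a
statement about slices of \<open>u\<close>, this says that under \<open>id \<otimes> F\<close> the element \<open>u\<close> behaves like an elementary
tensor \<open>W \<otimes> v\<close>, and the unitarity of \<open>u\<close> becomes unitarity of \<open>W\<close> up to a scalar.\<close>

lemma tensor_intertwiner_imp_inner:
  fixes u :: "('a::unital_cstar_algebra, 'b::unital_cstar_algebra) ptensor"
  assumes \<psi>: "star_isomorphism \<psi>" and u: "unitary u"
    and u\<phi>: "\<And>a. u * (a \<otimes>\<^sub>\<gamma> 1) = (\<phi> a \<otimes>\<^sub>\<gamma> 1) * u"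
    and u\<psi>: "\<And>b. u * (1 \<otimes>\<^sub>\<gamma> b) = (1 \<otimes>\<^sub>\<gamma> \<psi> b) * u"
  shows "inner_map \<phi>"
proof -
  have uu: "star u * u = 1" "u * star u = 1" using u by (simp_all add: unitary_def)
  obtain F :: "'b \<Rightarrow> complex" where F: "state F" and Fc: "\<And>z x. central z \<Longrightarrow> F (z * x) = F z * F x"
    using central_state_exists by blast
  have Fb: "bounded_clinear F" by (rule state_bounded_clinear[OF F])
  note Fm = bounded_clinear_mult_functional[OF Fb]
  define I where "I = {v. \<forall>b. v * b = \<psi> b * v}"
  have Istar: "star v * \<psi> b = b * star v" if "v \<in> I" for v b
  proof -
    have "star (v * star b) = star (\<psi> (star b) * v)" using that by (simp add: I_def)
    then show ?thesis by (simp add: star_mult star_star star_isomorphism_star[OF \<psi>])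
  qed
  have Ic: "central (star v * w)" if "v \<in> I" "w \<in> I" for v w
    unfolding central_def
  proof
    fix b
    have wb: "w * b = \<psi> b * w" using that by (simp add: I_def)
    have "star v * w * b = star v * \<psi> b * w" by (simp only: wb mult.assoc)
    then show "star v * w * b = b * (star v * w)" by (simp only: Istar[OF that(1)] mult.assoc)
  qed
  have Ic': "central (v * star v)" if "v \<in> I" for v
    unfolding central_def
  proof
    fix b'
    obtain b where b: "b' = \<psi> b" using star_isomorphism_bij[OF \<psi>] by (metis bij_pointE)
    have vb: "v * b = \<psi> b * v" using that by (simp add: I_def)
    have "v * star v * \<psi> b = v * b * star v" by (simp only: Istar[OF that] mult.assoc)
    also have "\<dots> = \<psi> b * (v * star v)" by (simp only: vb mult.assoc)
    finally show "v * star v * b' = b' * (v * star v)" by (simp only: b)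
  qed
  have VI: "slice_left g u \<in> I" if g: "bounded_clinear g" for g
    by (simp add: I_def u\<psi> flip: slice_left_mult[OF g])
  \<comment> \<open>Some slice \<open>v\<close> of \<open>u\<close> has \<open>F (v\<^sup>* v) \<noteq> 0\<close>: otherwise \<open>F (c v) = 0\<close> for all slices \<open>v\<close> and all \<open>c\<close>, so that
    \<open>id \<otimes> F\<close> would vanish on \<open>D u = D\<close>.\<close>
  have "\<exists>g :: 'a \<Rightarrow> complex. bounded_clinear g \<and> F (star (slice_left g u) * slice_left g u) \<noteq> 0"
  proof (rule ccontr)
    assume "\<not> ?thesis"
    then have no: "F (star (slice_left g u) * slice_left g u) = 0" if "bounded_clinear g" for g :: "'a \<Rightarrow> complex"
      using that by blast
    have z: "slice_right (\<lambda>y. F (c * y)) u = 0" for c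
    proof (rule bounded_functionals_separate)
      fix g :: "'a \<Rightarrow> complex" assume g: "bounded_clinear g"
      have "F (c * slice_left g u) = 0"
        by (rule central_state_normal_kernel[OF F Fc Ic[OF VI[OF g] VI[OF g]] Ic'[OF VI[OF g]] no[OF g]])
      then show "g (slice_right (\<lambda>y. F (c * y)) u) = g 0"
        by (simp add: slice_swap[OF Fm(1) g] bounded_clinear_zero[OF g])
    qed
    have "slice_right F (star u * u) = (0::'a)"
      by (rule ptensor_eqI[of "\<lambda>z. slice_right F (z * u)" "\<lambda>_. 0", OF
            bounded_clinear_compose[OF bounded_clinear_slice_right[OF Fb] bounded_clinear_mult_right]])
        (simp_all add: slice_right_mult_left[OF Fb] z bounded_clinearI[of _ 0] clinear_def)
    moreover have "slice_right F (1 \<otimes>\<^sub>\<gamma> 1) = (1::'a)"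
      by (simp add: slice_right_pure[OF Fb] state_one[OF F] scaleC_one)
    ultimately show False by (simp add: uu ptens_one)
  qed
  then obtain g :: "'a \<Rightarrow> complex"
    where g: "bounded_clinear g" "F (star (slice_left g u) * slice_left g u) \<noteq> 0" by blast
  define v where "v = slice_left g u"
  have vI: "v \<in> I" using VI[OF g(1)] by (simp add: v_def)
  have normal: "star v * v = v * star v" by (rule normal_if_central[OF Ic[OF vI vI] Ic'[OF vI]])
  define \<kappa> where "\<kappa> = Re (F (star v * v))"
  have Im: "Im (F (star v * v)) = 0"
    by (rule state_selfadjoint_real[OF F]) (simp add: star_mult star_star)
  have Fk: "F (star v * v) = complex_of_real \<kappa>" by (simp add: \<kappa>_def complex_eq_iff Im)
  have Fk': "F (v * star v) = complex_of_real \<kappa>" using Fk normal by simp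
  have "\<kappa> \<ge> 0"
    unfolding \<kappa>_def normal_star_mult_self[OF normal] bounded_clinear_add[OF Fb]
    using state_square_nonneg[OF F star_real_part, of v] state_square_nonneg[OF F star_imag_part, of v] by simp
  moreover have "\<kappa> \<noteq> 0" using g(2) Fk by (auto simp: v_def)
  ultimately have \<kappa>: "\<kappa> > 0" by simp
  define W where "W = slice_right (\<lambda>y. F (star v * y)) u"
  have slice: "\<kappa> *\<^sub>R slice_right (\<lambda>y. F (c * y * d)) u = F (c * v * d) *\<^sub>C W" for c d
  proof (rule bounded_functionals_separate)
    fix h :: "'a \<Rightarrow> complex" assume h: "bounded_clinear h"
    define w where "w = slice_left h u"
    have wI: "w \<in> I" using VI[OF h] by (simp add: w_def)
    have "(v * star v) * (c * w * d) = c * (v * star v) * w * d"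
      using central_commute[OF Ic'[OF vI], of c] by (simp flip: mult.assoc)
    also have "\<dots> = c * v * (star v * w) * d" by (simp add: mult.assoc)
    also have "\<dots> = (star v * w) * (c * v * d)"
      using central_commute[OF Ic[OF vI wI], of "c * v"] by (simp flip: mult.assoc)
    finally have "F ((v * star v) * (c * w * d)) = F ((star v * w) * (c * v * d))" by simp
    then have "\<kappa> * F (c * w * d) = F (star v * w) * F (c * v * d)"
      by (simp only: Fc[OF Ic'[OF vI]] Fc[OF Ic[OF vI wI]] Fk')
    then show "h (\<kappa> *\<^sub>R slice_right (\<lambda>y. F (c * y * d)) u) = h (F (c * v * d) *\<^sub>C W)"
      by (simp add: W_def clinear_scaleR[OF bounded_clinear_clinear[OF h]] bounded_clinear_scaleC[OF h]
          slice_swap[OF Fm(1) h] slice_swap[OF Fm(3) h] scaleR_conv_of_real[where 'a = complex] mult.commute flip: w_def)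
  qed
  \<comment> \<open>Under \<open>id \<otimes> F\<close>, the element \<open>u\<close> may be replaced by \<open>W \<otimes> v\<close> as a left or as a right factor; below both
    are applied with \<open>z = u\<^sup>*\<close>.\<close>
  have left: "\<kappa> *\<^sub>R slice_right F (z * u) = slice_right F (z * (W \<otimes>\<^sub>\<gamma> v))" for z
  proof (rule ptensor_eqI[of "\<lambda>z. \<kappa> *\<^sub>R slice_right F (z * u)"])
    show "bounded_clinear (\<lambda>z. slice_right F (z * (W \<otimes>\<^sub>\<gamma> v)))"
      by (rule bounded_clinear_compose[OF bounded_clinear_slice_right[OF Fb] bounded_clinear_mult_right])
    have "bounded_clinear (\<lambda>z. slice_right F (z * (\<kappa> *\<^sub>R u)))"
      by (rule bounded_clinear_compose[OF bounded_clinear_slice_right[OF Fb] bounded_clinear_mult_right])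
    then show "bounded_clinear (\<lambda>z. \<kappa> *\<^sub>R slice_right F (z * u))"
      by (simp add: clinear_scaleR[OF bounded_clinear_clinear[OF bounded_clinear_slice_right[OF Fb]]])
    fix x :: 'a and c :: 'b
    show "\<kappa> *\<^sub>R slice_right F ((x \<otimes>\<^sub>\<gamma> c) * u) = slice_right F ((x \<otimes>\<^sub>\<gamma> c) * (W \<otimes>\<^sub>\<gamma> v))"
      using arg_cong[OF slice[of c 1], of "\<lambda>t. x * t"]
      by (simp add: slice_right_mult_left[OF Fb] slice_right_pure[OF Fm(1)] mult_scaleC_right)
  qed
  have right: "\<kappa> *\<^sub>R slice_right F (u * z) = slice_right F ((W \<otimes>\<^sub>\<gamma> v) * z)" for z
  proof (rule ptensor_eqI[of "\<lambda>z. \<kappa> *\<^sub>R slice_right F (u * z)"])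
    show "bounded_clinear (\<lambda>z. slice_right F ((W \<otimes>\<^sub>\<gamma> v) * z))"
      by (rule bounded_clinear_compose[OF bounded_clinear_slice_right[OF Fb] bounded_clinear_mult_left])
    have "bounded_clinear (\<lambda>z. slice_right F ((\<kappa> *\<^sub>R u) * z))"
      by (rule bounded_clinear_compose[OF bounded_clinear_slice_right[OF Fb] bounded_clinear_mult_left])
    then show "bounded_clinear (\<lambda>z. \<kappa> *\<^sub>R slice_right F (u * z))"
      by (simp add: clinear_scaleR[OF bounded_clinear_clinear[OF bounded_clinear_slice_right[OF Fb]]])
    fix x :: 'a and c :: 'b
    show "\<kappa> *\<^sub>R slice_right F (u * (x \<otimes>\<^sub>\<gamma> c)) = slice_right F ((W \<otimes>\<^sub>\<gamma> v) * (x \<otimes>\<^sub>\<gamma> c))"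
      using arg_cong[OF slice[of 1 c], of "\<lambda>t. t * x"]
      by (simp add: slice_right_mult_right[OF Fb] slice_right_pure[OF Fm(2)] mult_scaleC_left)
  qed
  have F1: "slice_right F 1 = (1::'a)"
    by (simp add: slice_right_pure[OF Fb] state_one[OF F] scaleC_one flip: ptens_one)
  have "\<kappa> *\<^sub>R 1 = slice_right (\<lambda>y. F (y * v)) (star u) * W"
    using left[of "star u"] by (simp add: uu F1 slice_right_mult_right[OF Fb])
  also have "slice_right (\<lambda>y. F (y * v)) (star u) = star W"
    by (simp add: slice_right_star[OF Fm(2)] W_def star_mult star_star flip: state_star[OF F])
  finally have WW1: "star W * W = \<kappa> *\<^sub>R 1" by simp
  have "\<kappa> *\<^sub>R slice_right (\<lambda>y. F (y * star v)) u = \<kappa> *\<^sub>R W"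
    using slice[of 1 "star v"] by (simp add: Fk scaleR_scaleC flip: normal)
  then have sv: "slice_right (\<lambda>y. F (y * star v)) u = W" using \<kappa> by simp
  have "\<kappa> *\<^sub>R 1 = W * slice_right (\<lambda>y. F (v * y)) (star u)"
    using right[of "star u"] by (simp add: uu F1 slice_right_mult_left[OF Fb])
  also have "slice_right (\<lambda>y. F (v * y)) (star u) = star W"
    by (simp add: slice_right_star[OF Fm(1)] star_mult star_star sv flip: state_star[OF F])
  finally have WW2: "W * star W = \<kappa> *\<^sub>R 1" by simp
  have W\<phi>: "W * a = \<phi> a * W" for a
    using slice_right_mult_right[OF Fm(1), of "star v" u a 1] slice_right_mult_left[OF Fm(1), of "star v" "\<phi> a" 1 u]
    by (simp add: W_def u\<phi>)
  define U where "U = (1 / sqrt \<kappa>) *\<^sub>R W"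
  have "unitary U"
    using \<kappa> by (simp add: U_def unitary_def star_scaleR WW1 WW2)
  moreover have "\<phi> a = U * a * star U" for a
    using \<kappa> by (simp add: U_def star_scaleR W\<phi>) (simp add: mult.assoc WW2)
  ultimately show ?thesis by (auto simp: inner_map_def)
qed

section \<open>Prime finite-dimensional C*-algebras\<close>

text \<open>Indexed families, so that repeated vectors count as dependent. Finite dimension is expressed below by a
bound \<open>N\<close> on the length of linearly independent families.\<close>

definition lin_indep :: "nat \<Rightarrow> (nat \<Rightarrow> 'a::complex_vector) \<Rightarrow> bool" where
  "lin_indep n f \<longleftrightarrow> (\<forall>c. (\<Sum>i<n. c i *\<^sub>C f i) = 0 \<longrightarrow> (\<forall>i<n. c i = 0))"

interpretation complex_vector: vector_space "(*\<^sub>C) :: complex \<Rightarrow> 'a \<Rightarrow> 'a::complex_vector"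
  by standard (simp_all add: scaleC_add_right scaleC_add_left scaleC_scaleC scaleC_one)

lemma lin_indep_le_card:
  assumes f: "lin_indep n f" and X: "finite X" "\<And>i. f i \<in> complex_vector.span X"
  shows "n \<le> card X"
proof -
  have inj: "inj_on f {..<n}"
  proof (rule inj_onI, rule ccontr)
    fix i j assume ij: "i \<in> {..<n}" "j \<in> {..<n}" "f i = f j" "i \<noteq> j"
    define c where "c k = (if k = i then 1 else if k = j then - 1 else 0 :: complex)" for k
    have "(\<Sum>k<n. c k *\<^sub>C f k) = (\<Sum>k\<in>{i, j}. c k *\<^sub>C f k)"
      by (rule sum.mono_neutral_right) (use ij in \<open>auto simp: c_def\<close>)
    also have "\<dots> = 0" using ij by (simp add: c_def scaleC_one scaleC_minus_left)
    finally have "c i = 0" using f ij by (simp add: lin_indep_def)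
    then show False by (simp add: c_def)
  qed
  have "complex_vector.independent (f ` {..<n})"
  proof
    assume "complex_vector.dependent (f ` {..<n})"
    then obtain u v where u: "v \<in> f ` {..<n}" "u v \<noteq> 0" "(\<Sum>v\<in>f ` {..<n}. u v *\<^sub>C v) = 0"
      by (subst (asm) complex_vector.dependent_finite) auto
    then have "(\<Sum>i<n. u (f i) *\<^sub>C f i) = 0" by (simp add: sum.reindex[OF inj])
    then have "\<forall>i<n. u (f i) = 0" using f unfolding lin_indep_def by (elim allE[of _ "\<lambda>i. u (f i)"]) blast
    then show False using u by auto
  qed
  from complex_vector.independent_span_bound[OF X(1) this] X(2)
  show ?thesis by (auto simp: card_image[OF inj])
qed

text \<open>The vector \<open>p(T) z\<close>, by Horner's rule.\<close>

definition poly_apply :: "('a::complex_vector \<Rightarrow> 'a) \<Rightarrow> 'a \<Rightarrow> complex poly \<Rightarrow> 'a" where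
  "poly_apply T z p = fold_coeffs (\<lambda>a w. a *\<^sub>C z + T w) p 0"

text \<open>Among all pairs of a nonzero polynomial \<open>p\<close> and a nonzero vector \<open>y \<in> L\<close> with \<open>p(T) y = 0\<close> take one of least
degree. If \<open>p = (X - l) q\<close>, then \<open>q(T) y\<close> is a nonzero eigenvector.\<close>

lemma eigenvector_exists:
  fixes T :: "'a::complex_vector \<Rightarrow> 'a"
  assumes T: "clinear T" and L: "0 \<in> L" "\<And>x y. x \<in> L \<Longrightarrow> y \<in> L \<Longrightarrow> x + y \<in> L" "\<And>c x. x \<in> L \<Longrightarrow> c *\<^sub>C x \<in> L"
    "\<And>x. x \<in> L \<Longrightarrow> T x \<in> L"
    and fd: "\<And>n f. lin_indep n (f :: nat \<Rightarrow> 'a) \<Longrightarrow> n \<le> N"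
    and z: "z \<in> L" "z \<noteq> 0"
  shows "\<exists>l y. y \<in> L \<and> y \<noteq> 0 \<and> T y = l *\<^sub>C y"
proof -
  define E where "E = poly_apply T"
  have E0: "E y 0 = 0" for y by (simp add: E_def poly_apply_def)
  have EC: "E y (pCons a p) = a *\<^sub>C y + T (E y p)" for y a p
    by (cases "a = 0 \<and> p = 0") (auto simp: E_def poly_apply_def clinear_zero[OF T])
  have Eadd: "E y (p + q) = E y p + E y q" for y p q
  proof (induction p q rule: poly_induct2)
    case (pCons a p b q)
    then show ?case by (simp add: EC clinear_add[OF T] scaleC_add_left)
  qed (simp add: E0)
  have Esmult: "E y (smult c p) = c *\<^sub>C E y p" for y c p
    by (induction p) (simp_all add: E0 EC clinear_scaleC[OF T] scaleC_add_right scaleC_scaleC)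
  have Esum: "E y (sum f I) = (\<Sum>i\<in>I. E y (f i))" for y f and I :: "nat set"
    by (induction I rule: infinite_finite_induct) (simp_all add: E0 Eadd)
  have EL: "E y p \<in> L" if "y \<in> L" for y p
    by (induction p) (simp_all add: E0 EC L that)
  have "\<exists>p. p \<noteq> 0 \<and> E z p = 0"
  proof (rule ccontr)
    assume no: "\<not> ?thesis"
    have "lin_indep (Suc N) (\<lambda>i. E z (monom 1 i))"
      unfolding lin_indep_def
    proof (intro allI impI)
      fix c i assume s: "(\<Sum>i<Suc N. c i *\<^sub>C E z (monom 1 i)) = 0" and i: "i < Suc N"
      have "E z (\<Sum>i<Suc N. smult (c i) (monom 1 i)) = 0"
        using s by (simp only: Esum Esmult)
      then have "(\<Sum>i<Suc N. smult (c i) (monom 1 i)) = 0" using no by blast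
      then have "coeff (\<Sum>i<Suc N. smult (c i) (monom 1 i)) i = 0" by simp
      then show "c i = 0" using i by (simp add: coeff_sum sum.delta if_distrib[of "\<lambda>x. _ * x"] cong: if_cong del: sum.lessThan_Suc)
    qed
    from fd[OF this] show False by simp
  qed
  then have "\<exists>d p y. degree p = d \<and> p \<noteq> 0 \<and> y \<in> L \<and> y \<noteq> 0 \<and> E y p = 0" using z by blast
  then obtain p y where p: "p \<noteq> 0" "y \<in> L" "y \<noteq> 0" "E y p = 0"
    and min: "\<And>q w. q \<noteq> 0 \<Longrightarrow> w \<in> L \<Longrightarrow> w \<noteq> 0 \<Longrightarrow> E w q = 0 \<Longrightarrow> degree p \<le> degree q"
    using exists_least_iff[of "\<lambda>d. \<exists>p y. degree p = d \<and> p \<noteq> 0 \<and> y \<in> L \<and> y \<noteq> 0 \<and> E y p = 0"] not_le_imp_less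
    by metis
  have "degree p \<noteq> 0"
  proof
    assume "degree p = 0"
    then obtain a where a: "p = [:a:]" by (rule degree_eq_zeroE)
    then have "a \<noteq> 0" "a *\<^sub>C y = 0" using p by (auto simp: EC E0 clinear_zero[OF T])
    then have "inverse a *\<^sub>C (a *\<^sub>C y) = 0" by simp
    then show False using \<open>a \<noteq> 0\<close> p(3) by (simp add: scaleC_scaleC scaleC_one)
  qed
  then obtain l where "poly p l = 0"
    using Fundamental_Theorem_Algebra.fundamental_theorem_of_algebra[of p] by (metis constant_degree)
  then obtain q where q: "p = [:- l, 1:] * q" by (metis poly_eq_0_iff_dvd dvdE)
  have q0: "q \<noteq> 0" using p(1) q by auto
  have pq: "p = pCons 0 q + smult (- l) q" by (simp add: q)
  have "degree q < degree p" using q0 unfolding q by (subst degree_mult_eq) auto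
  then have w0: "E y q \<noteq> 0" using min[OF q0 p(2,3)] by auto
  have "T (E y q) = l *\<^sub>C E y q"
    using p(4) unfolding pq Eadd Esmult EC by (simp add: scaleC_minus_left)
  then show ?thesis using EL[OF p(2)] w0 by blast
qed

text \<open>A generator of a minimal nonzero left ideal, obtained by minimising the dimension of \<open>A y\<close>.\<close>

lemma minimal_element:
  assumes fd: "\<And>n f. lin_indep n (f :: nat \<Rightarrow> 'a::unital_cstar_algebra) \<Longrightarrow> n \<le> N"
  shows "\<exists>y::'a. y \<noteq> 0 \<and> (\<forall>a. a * y \<noteq> 0 \<longrightarrow> (\<exists>b. y = b * (a * y)))"
proof -
  define P where "P y n \<longleftrightarrow> (\<exists>f. lin_indep n f \<and> (\<forall>i. f i \<in> range (\<lambda>a. a * (y::'a))))" for y n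
  define d where "d y = (GREATEST n. P y n)" for y
  have bd: "\<forall>n. P y n \<longrightarrow> n \<le> N" for y unfolding P_def using fd by blast
  have P0: "P y 0" for y by (auto simp: P_def lin_indep_def intro!: exI[of _ "\<lambda>_. 0"] image_eqI[of _ _ 0])
  have Pd: "P y (d y)" for y unfolding d_def by (rule GreatestI_nat[of "P y" 0 N, OF P0]) (use bd in blast)
  have dmax: "n \<le> d y" if "P y n" for y n
    unfolding d_def by (rule Greatest_le_nat[of "P y" n N, OF that]) (use bd in blast)
  obtain y where y: "y \<noteq> 0" and min: "\<And>w. w \<noteq> 0 \<Longrightarrow> d y \<le> d w"
    using ex_has_least_nat[of "\<lambda>y. y \<noteq> 0" 1 d] by auto
  have "\<exists>b. y = b * (a * y)" if a: "a * y \<noteq> 0" for a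
  proof (rule ccontr)
    assume no: "\<not> ?thesis"
    define w where "w = a * y"
    obtain f where f: "lin_indep (d w) f" "\<And>i. f i \<in> range (\<lambda>a. a * w)" using Pd[of w] by (auto simp: P_def)
    define g where "g = f (d w := y)"
    have "lin_indep (Suc (d w)) g"
      unfolding lin_indep_def
    proof (intro allI impI)
      fix c i assume s: "(\<Sum>i<Suc (d w). c i *\<^sub>C g i) = 0" and i: "i < Suc (d w)"
      have s': "(\<Sum>i<d w. c i *\<^sub>C f i) + c (d w) *\<^sub>C y = 0" using s by (simp add: g_def)
      have c0: "c (d w) = 0"
      proof (rule ccontr)
        assume c: "c (d w) \<noteq> 0"
        have "\<forall>i. \<exists>a. f i = a * w" using f(2) by blast
        then obtain h where h: "\<And>i. f i = h i * w" by metis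
        define b where "b = (- inverse (c (d w))) *\<^sub>C (\<Sum>i<d w. c i *\<^sub>C h i)"
        have "(\<Sum>i<d w. c i *\<^sub>C h i) * w = - (c (d w) *\<^sub>C y)"
          using s' by (simp add: h sum_distrib_right mult_scaleC_left eq_neg_iff_add_eq_0)
        then have "b * w = y" using c by (simp add: b_def mult_scaleC_left scaleC_minus_left scaleC_minus_right scaleC_scaleC scaleC_one)
        then have "y = b * (a * y)" by (simp add: w_def)
        then show False using no by blast
      qed
      then have "(\<Sum>i<d w. c i *\<^sub>C f i) = 0" using s' by simp
      then have "\<forall>i<d w. c i = 0" using f(1) unfolding lin_indep_def by blast
      then show "c i = 0" using c0 i less_Suc_eq by auto
    qed
    moreover have "g i \<in> range (\<lambda>a. a * y)" for i
    proof (cases "i = d w")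
      case True
      then show ?thesis by (auto simp: g_def intro!: image_eqI[of _ _ 1])
    next
      case False
      obtain b where "f i = b * w" using f(2)[of i] by auto
      then show ?thesis using False by (auto simp: g_def w_def mult.assoc[symmetric])
    qed
    ultimately have "P y (Suc (d w))" by (auto simp: P_def)
    then have "Suc (d w) \<le> d y" by (rule dmax)
    then show False using min[OF a] by (simp add: w_def)
  qed
  then show ?thesis using y by blast
qed

text \<open>Let \<open>y\<close> generate a minimal left ideal and \<open>h = y\<^sup>* y\<close>. Right multiplication by \<open>x h\<close> on \<open>A h\<close> has an eigenvector,
and its eigenspace is a left ideal, hence all of \<open>A h\<close> by minimality (Schur's lemma). This gives
\<open>h x h \<in> \<complex> h\<close>, and a multiple of \<open>h\<close> is the projection.\<close>

lemma minimal_projection_exists: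
  assumes fd: "\<And>n f. lin_indep n (f :: nat \<Rightarrow> 'a::unital_cstar_algebra) \<Longrightarrow> n \<le> N"
  shows "\<exists>p::'a. p \<noteq> 0 \<and> star p = p \<and> p * p = p \<and> (\<forall>x. \<exists>c. p * x * p = c *\<^sub>C p)"
proof -
  obtain y :: 'a where "y \<noteq> 0 \<and> (\<forall>a. a * y \<noteq> 0 \<longrightarrow> (\<exists>b. y = b * (a * y)))"
    by (rule exE[OF minimal_element[OF fd]])
  then have y: "y \<noteq> 0" and min: "\<And>a. a * y \<noteq> 0 \<Longrightarrow> \<exists>b. y = b * (a * y)" by (elim conjE; simp only:)+
  define h where "h = star y * y"
  have h0: "h \<noteq> 0" using y star_mult_self_eq_0[of y] by (auto simp: h_def)
  have sh: "star h = h" by (simp add: h_def star_mult star_star)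
  have hxh: "\<exists>c. h * x * h = c *\<^sub>C h" for x
  proof -
    define L where "L = range (\<lambda>a. a * h)"
    have "\<exists>l z. z \<in> L \<and> z \<noteq> 0 \<and> z * (x * h) = l *\<^sub>C z"
    proof (rule eigenvector_exists[where N = N])
      show "clinear (\<lambda>z. z * (x * h))" by (simp add: clinear_def distrib_right mult_scaleC_left)
      show "0 \<in> L" by (auto simp: L_def intro: image_eqI[of _ _ 0])
      show "v + w \<in> L" if "v \<in> L" "w \<in> L" for v w
        using that by (auto simp: L_def simp flip: distrib_right)
      show "c *\<^sub>C v \<in> L" if "v \<in> L" for c v
        using that by (auto simp: L_def simp flip: mult_scaleC_left)
      show "v * (x * h) \<in> L" for v by (simp add: L_def flip: mult.assoc)
      show "h \<in> L" by (auto simp: L_def intro: image_eqI[of _ _ 1])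
      show "n \<le> N" if "lin_indep n f" for n and f :: "nat \<Rightarrow> 'a" by (rule fd[OF that])
    qed (rule h0)
    then obtain l z where z: "z \<in> L" "z \<noteq> 0" "z * (x * h) = l *\<^sub>C z" by blast
    obtain a where a: "z = a * h" using z(1) by (auto simp: L_def)
    have "(a * star y) * y \<noteq> 0" using z(2) a by (simp add: h_def mult.assoc)
    then obtain b where "y = b * ((a * star y) * y)" by (rule exE[OF min])
    then have "y = b * z" unfolding a h_def mult.assoc .
    then have b: "h = (star y * b) * z" unfolding h_def mult.assoc by (rule arg_cong)
    have "h * x * h = (star y * b) * (z * (x * h))" by (subst b) (simp only: mult.assoc)
    also have "\<dots> = l *\<^sub>C h" unfolding z(3) mult_scaleC_right b[symmetric] ..
    finally show ?thesis by blast
  qed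
  obtain \<mu> where \<mu>: "h * h = \<mu> *\<^sub>C h" using hxh[of 1] by auto
  have m0: "\<mu> \<noteq> 0" using h0 star_mult_self_eq_0[of h] \<mu> by (auto simp: sh)
  have "cnj \<mu> *\<^sub>C h = \<mu> *\<^sub>C h" 
    using arg_cong[OF \<mu>, of star, unfolded star_mult star_scaleC sh] \<mu> by (rule HOL.trans[OF HOL.sym])
  then have m: "cnj \<mu> = \<mu>" using h0 complex_vector.scale_cancel_right[of "cnj \<mu>" h \<mu>] by blast
  define p where "p = inverse \<mu> *\<^sub>C h"
  have "\<exists>c. p * x * p = c *\<^sub>C p" for x
  proof -
    obtain c where "h * x * h = c *\<^sub>C h" using hxh by blast
    then have "p * x * p = (c * inverse \<mu>) *\<^sub>C p"
      by (simp add: p_def mult_scaleC_left mult_scaleC_right scaleC_scaleC mult.commute)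
    then show ?thesis by blast
  qed
  moreover have "star p = p" by (simp add: p_def star_scaleC sh m)
  moreover have "p * p = p" using m0 by (simp add: p_def mult_scaleC_left mult_scaleC_right scaleC_scaleC \<mu>)
  moreover have "p \<noteq> 0" using h0 m0 by (simp add: p_def)
  ultimately show ?thesis by blast
qed

text \<open>The Hermitian form \<open>x, y \<mapsto> y\<^sup>* x\<close> on \<open>A p\<close>, with values in \<open>\<complex> p\<close>, has no isotropic vectors by the C*-identity.
It is positive at \<open>p\<close>, so it is positive everywhere: between \<open>p\<close> and a vector \<open>x\<close> with negative value there
would be an isotropic combination, explicitly \<open>s p + \<omega> x\<close> with \<open>|\<omega>| = 1\<close> chosen to remove the mixed terms.\<close>

lemma minimal_projection_positive:
  fixes p :: "'a::unital_cstar_algebra"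
  assumes p: "p \<noteq> 0" "star p = p" "p * p = p" "\<And>x. \<exists>c. p * x * p = c *\<^sub>C p"
    and x: "x * p = x" "x \<noteq> 0"
  shows "\<exists>c>0. star x * x = complex_of_real c *\<^sub>C p"
proof -
  have px: "p * star x = star x" using arg_cong[OF x(1), of star] by (simp add: star_mult p)
  have "p * (star x * x) * p = (p * star x) * (x * p)" by (simp only: mult.assoc)
  then obtain c where c: "star x * x = c *\<^sub>C p" using p(4)[of "star x * x"] unfolding px x(1) by auto
  have "cnj c *\<^sub>C p = c *\<^sub>C p" 
    using arg_cong[OF c, of star, unfolded star_mult star_scaleC star_star p(2)] c by (rule HOL.trans[OF HOL.sym])
  then have "cnj c = c" using p(1) complex_vector.scale_cancel_right[of "cnj c" p c] by blast
  then obtain r where r: "c = complex_of_real r" by (metis Reals_cnj_iff Reals_cases)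
  have r0: "r \<noteq> 0" using c r x(2) star_mult_self_eq_0[of x] by auto
  have "r > 0"
  proof (rule ccontr)
    assume "\<not> r > 0"
    then have rn: "r < 0" using r0 by simp
    have "p * x * p = p * x" by (simp only: mult.assoc x(1))
    then obtain b where b: "p * x = b *\<^sub>C p" using p(4)[of x] by auto
    have bs: "star x * p = cnj b *\<^sub>C p" using arg_cong[OF b, of star] by (simp add: star_mult star_scaleC p)
    define \<omega> where "\<omega> = (if b = 0 then 1 else \<i> * cnj b / cmod b)"
    have w1: "\<omega> * cnj \<omega> = 1"
      using complex_norm_square[of b] by (auto simp: \<omega>_def power2_eq_square field_simps)
    have w2: "\<omega> * b + cnj (\<omega> * b) = 0"
      using complex_norm_square[of b] by (auto simp: \<omega>_def field_simps)
    define s where "s = sqrt (- r)"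
    have ss: "s * s = - r" using rn by (simp add: s_def)
    define w where "w = complex_of_real s *\<^sub>C p + \<omega> *\<^sub>C x"
    have "star w * w = complex_of_real (s * s) *\<^sub>C p + (s * \<omega>) *\<^sub>C (p * x) + (s * cnj \<omega>) *\<^sub>C (star x * p)
        + (\<omega> * cnj \<omega>) *\<^sub>C (star x * x)"
      by (simp add: w_def star_add star_scaleC p(2,3) distrib_left distrib_right mult_scaleC_left mult_scaleC_right
          scaleC_add_right scaleC_scaleC mult.commute)
    also have "\<dots> = (complex_of_real (s * s) + s * (\<omega> * b + cnj (\<omega> * b)) + (\<omega> * cnj \<omega>) * c) *\<^sub>C p"
      by (simp add: b bs c scaleC_scaleC scaleC_add_left algebra_simps)
    finally have "star w * w = (complex_of_real (s * s) + s * (\<omega> * b + cnj (\<omega> * b)) + (\<omega> * cnj \<omega>) * c) *\<^sub>C p" .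
    then have "star w * w = 0" unfolding w1 w2 ss r by simp
    then have "w = 0" by (rule star_mult_self_eq_0)
    then have e: "complex_of_real s *\<^sub>C p = - (\<omega> *\<^sub>C x)" by (simp add: w_def eq_neg_iff_add_eq_0)
    have "complex_of_real (s * s) *\<^sub>C p = star (complex_of_real s *\<^sub>C p) * (complex_of_real s *\<^sub>C p)"
      by (simp add: star_scaleC mult_scaleC_left mult_scaleC_right scaleC_scaleC p)
    also have "\<dots> = c *\<^sub>C p"
      unfolding e using w1
      by (simp add: star_minus star_scaleC mult_scaleC_left mult_scaleC_right scaleC_scaleC c mult.commute)
    finally have "complex_of_real (s * s) = c"
      using p(1) complex_vector.scale_cancel_right[of "complex_of_real (s * s)" p c] by blast
    then have "s * s = r" by (simp only: r of_real_eq_iff)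
    then show False using ss rn by simp
  qed
  then show ?thesis using c r by blast
qed

text \<open>The elements \<open>e\<^sub>i e\<^sub>j\<^sup>*\<close> are matrix units, and the \<open>(i, j)\<close> entry of \<open>x\<close> is the scalar \<open>g x i j\<close> with
\<open>e\<^sub>i\<^sup>* x e\<^sub>j = g x i j p\<close>.\<close>

lemma matrix_units_imp_matrix_algebra:
  fixes p :: "'a::unital_cstar_algebra" and e :: "nat \<Rightarrow> 'a"
  assumes p: "p \<noteq> 0" "p * p = p" "star p = p" "\<And>x. \<exists>c. p * x * p = c *\<^sub>C p"
    and e: "\<And>i. i < m \<Longrightarrow> e i * p = e i"
      "\<And>i j. i < m \<Longrightarrow> j < m \<Longrightarrow> star (e i) * e j = (if i = j then p else 0)"
      "(\<Sum>i<m. e i * star (e i)) = 1"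
  shows "matrix_algebra TYPE('a)"
proof -
  obtain l where l: "\<And>x. p * x * p = l x *\<^sub>C p" using p(4) by metis
  have cancel: "a = b" if "a *\<^sub>C p = b *\<^sub>C p" for a b
    using that p(1) complex_vector.scale_cancel_right[of a p b] by blast
  have pe: "p * star (e i) = star (e i)" if "i < m" for i
    using arg_cong[OF e(1)[OF that], of star] by (simp add: star_mult p(3))
  have le: "star (e i) * x * e j = l (star (e i) * x * e j) *\<^sub>C p" if "i < m" "j < m" for i j x
  proof -
    have "p * (star (e i) * x * e j) * p = (p * star (e i)) * x * (e j * p)" by (simp only: mult.assoc)
    then show ?thesis by (simp only: pe that e(1) l)
  qed
  define g where "g x i j = l (star (e i) * x * e j)" for x i j
  have g: "star (e i) * x * e j = g x i j *\<^sub>C p" if "i < m" "j < m" for i j x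
    using le[OF that] by (simp only: g_def)
  have gI: "g x i j = c" if "i < m" "j < m" "star (e i) * x * e j = c *\<^sub>C p" for x i j c
    using cancel g[OF that(1,2)] that(3) by metis
  have g_add: "g (x + y) i j = g x i j + g y i j" if "i < m" "j < m" for x y i j
    by (rule gI[OF that]) (simp add: distrib_left distrib_right g that scaleC_add_left)
  have g_scale: "g (c *\<^sub>C x) i j = c * g x i j" if "i < m" "j < m" for c x i j
    by (rule gI[OF that]) (simp add: mult_scaleC_left mult_scaleC_right g that scaleC_scaleC)
  have g_star: "g (star x) i j = cnj (g x j i)" if "i < m" "j < m" for x i j
  proof (rule gI[OF that])
    have "star (e i) * star x * e j = star (star (e j) * x * e i)" by (simp add: star_mult star_star mult.assoc)
    also have "\<dots> = cnj (g x j i) *\<^sub>C p" by (simp only: g[OF that(2,1)] star_scaleC p(3))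
    finally show "star (e i) * star x * e j = cnj (g x j i) *\<^sub>C p" .
  qed
  have g_mult: "g (x * y) i j = (\<Sum>k<m. g x i k * g y k j)" if "i < m" "j < m" for x y i j
  proof (rule gI[OF that])
    have "star (e i) * (x * y) * e j = star (e i) * x * (\<Sum>k<m. e k * star (e k)) * y * e j"
      by (simp add: e(3) mult.assoc)
    also have "\<dots> = (\<Sum>k<m. (star (e i) * x * e k) * (star (e k) * y * e j))"
      by (simp add: sum_distrib_left sum_distrib_right mult.assoc)
    also have "\<dots> = (\<Sum>k<m. (g x i k * g y k j) *\<^sub>C p)"
      by (intro sum.cong HOL.refl) (simp add: g that mult_scaleC_left mult_scaleC_right scaleC_scaleC p(2) mult.commute)
    also have "\<dots> = (\<Sum>k<m. g x i k * g y k j) *\<^sub>C p" by (simp only: complex_vector.scale_sum_left)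
    finally show "star (e i) * (x * y) * e j = (\<Sum>k<m. g x i k * g y k j) *\<^sub>C p" .
  qed
  have expand: "x = (\<Sum>i<m. \<Sum>j<m. g x i j *\<^sub>C (e i * star (e j)))" for x
  proof -
    have "x = (\<Sum>i<m. e i * star (e i)) * x * (\<Sum>j<m. e j * star (e j))" by (simp add: e(3))
    also have "\<dots> = (\<Sum>j<m. \<Sum>i<m. e i * (star (e i) * x * e j) * star (e j))"
      by (simp add: sum_distrib_left sum_distrib_right mult.assoc)
    also have "\<dots> = (\<Sum>i<m. \<Sum>j<m. e i * (star (e i) * x * e j) * star (e j))" by (rule sum.swap)
    also have "\<dots> = (\<Sum>i<m. \<Sum>j<m. g x i j *\<^sub>C (e i * star (e j)))"
      by (intro sum.cong HOL.refl) (simp add: g mult_scaleC_left mult_scaleC_right e(1))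
    finally show ?thesis .
  qed
  define F where "F x = Matrix.mat m m (\<lambda>(i, j). g x i j)" for x
  have FC: "F x \<in> carrier_mat m m" for x by (simp add: F_def)
  have "m \<noteq> 0" using e(3) by (intro notI) simp
  moreover have "bij_betw F UNIV (carrier_mat m m)"
    unfolding bij_betw_def
  proof
    show "inj F"
    proof (rule injI)
      fix x y assume "F x = F y"
      then have eq: "F x $$ (i, j) = F y $$ (i, j)" for i j by simp
      have "g x i j = g y i j" if "i < m" "j < m" for i j using eq[of i j] that by (simp add: F_def)
      then have "(\<Sum>i<m. \<Sum>j<m. g x i j *\<^sub>C (e i * star (e j))) = (\<Sum>i<m. \<Sum>j<m. g y i j *\<^sub>C (e i * star (e j)))"
        by (intro sum.cong HOL.refl) simp
      then show "x = y" using expand[of x] expand[of y] by metis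
    qed
    show "range F = carrier_mat m m"
    proof
      show "carrier_mat m m \<subseteq> range F"
      proof
        fix M :: "complex mat" assume M: "M \<in> carrier_mat m m"
        define x where "x = (\<Sum>i<m. \<Sum>j<m. (M $$ (i, j)) *\<^sub>C (e i * star (e j)))"
        have "g x k n = M $$ (k, n)" if kn: "k < m" "n < m" for k n
        proof (rule gI[OF kn])
          have "star (e k) * x * e n = (\<Sum>i<m. \<Sum>j<m. (M $$ (i, j)) *\<^sub>C ((star (e k) * e i) * (star (e j) * e n)))"
            by (simp add: x_def sum_distrib_left sum_distrib_right mult_scaleC_left mult_scaleC_right mult.assoc)
          also have "\<dots> = (\<Sum>i<m. \<Sum>j<m. if j = n then if i = k then (M $$ (i, j)) *\<^sub>C p else 0 else 0)"
            by (intro sum.cong HOL.refl) (simp add: e(2) kn p(2))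
          also have "\<dots> = (M $$ (k, n)) *\<^sub>C p" using kn by simp
          finally show "star (e k) * x * e n = (M $$ (k, n)) *\<^sub>C p" .
        qed
        then have "F x = M" using M by (intro eq_matI) (auto simp: F_def)
        then show "M \<in> range F" by blast
      qed
    qed (use FC in auto)
  qed
  moreover have "F (x + y) = F x + F y" for x y
    by (rule eq_matI) (auto simp: F_def g_add)
  moreover have "F (c *\<^sub>C x) = c \<cdot>\<^sub>m F x" for c x
    by (rule eq_matI) (auto simp: F_def g_scale)
  moreover have "F (x * y) = F x * F y" for x y
  proof (rule eq_matI)
    fix i j assume "i < dim_row (F x * F y)" "j < dim_col (F x * F y)"
    then have ij: "i < m" "j < m" by (simp_all add: F_def)
    then show "F (x * y) $$ (i, j) = (F x * F y) $$ (i, j)"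
      by (simp add: F_def g_mult scalar_prod_def lessThan_atLeast0)
  qed (simp_all add: F_def)
  moreover have "F (star x) = mat_adjoint (F x)" for x
    by (rule eq_matI) (auto simp: F_def g_star mat_adjoint_def mat_of_rows_def)
  ultimately show ?thesis unfolding matrix_algebra_def by blast
qed

text \<open>Take an orthonormal family of maximal length in \<open>A p\<close>. The defect \<open>q = 1 - \<Sum> e\<^sub>i e\<^sub>i\<^sup>*\<close> vanishes, as otherwise
primeness provides a nonzero element \<open>q y p\<close>, which is orthogonal to the family and extends it.\<close>

lemma prime_imp_matrix_algebra:
  assumes fd: "\<And>n f. lin_indep n (f :: nat \<Rightarrow> 'a::unital_cstar_algebra) \<Longrightarrow> n \<le> N"
    and prime: "\<And>a b :: 'a. (\<And>x. a * x * b = 0) \<Longrightarrow> b \<noteq> 0 \<Longrightarrow> a = 0"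
  shows "matrix_algebra TYPE('a)"
proof -
  obtain p :: 'a where "p \<noteq> 0 \<and> star p = p \<and> p * p = p \<and> (\<forall>x. \<exists>c. p * x * p = c *\<^sub>C p)"
    by (rule exE[OF minimal_projection_exists[OF fd]])
  then have p: "p \<noteq> 0" "star p = p" "p * p = p" "\<And>x. \<exists>c. p * x * p = c *\<^sub>C p" by simp_all
  define P where "P m e \<longleftrightarrow> (\<forall>i<m. e i * p = e i) \<and>
    (\<forall>i<m. \<forall>j<m. star (e i) * e j = (if i = j then p else 0))" for m and e :: "nat \<Rightarrow> 'a"
  have bd: "m \<le> N" if P: "P m e" for m e
  proof (rule fd, unfold lin_indep_def, intro allI impI)
    fix c i assume s: "(\<Sum>i<m. c i *\<^sub>C e i) = 0" and i: "i < m"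
    have "(\<Sum>j<m. c j *\<^sub>C (star (e i) * e j)) = star (e i) * (\<Sum>j<m. c j *\<^sub>C e j)"
      by (simp add: sum_distrib_left mult_scaleC_right)
    also have "\<dots> = 0" by (simp add: s)
    also have "(\<Sum>j<m. c j *\<^sub>C (star (e i) * e j)) = (\<Sum>j<m. if j = i then c j *\<^sub>C p else 0)"
      by (intro sum.cong HOL.refl) (use P i in \<open>auto simp: P_def\<close>)
    finally have "c i *\<^sub>C p = 0" using i by simp
    then show "c i = 0" using p(1) by simp
  qed
  define m where "m = (GREATEST m. \<exists>e. P m e)"
  have "\<exists>e. P 0 e" by (simp add: P_def)
  then have "\<exists>e. P m e"
    unfolding m_def by (rule GreatestI_nat[of "\<lambda>m. \<exists>e. P m e" 0 N]) (use bd in blast)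
  then obtain e where e: "P m e" by blast
  have max: "n \<le> m" if "P n e" for n e
    unfolding m_def by (rule Greatest_le_nat[of "\<lambda>m. \<exists>e. P m e" n N]) (use that bd in blast)+
  define q where "q = 1 - (\<Sum>k<m. e k * star (e k))"
  have eq: "star (e i) * q = 0" if i: "i < m" for i
  proof -
    have "e i * p = e i" using e i by (simp add: P_def)
    then have "star (e i * p) = star (e i)" by simp
    then have pe: "p * star (e i) = star (e i)" by (simp add: star_mult p(2))
    have "star (e i) * (\<Sum>k<m. e k * star (e k)) = (\<Sum>k<m. if k = i then p * star (e k) else 0)"
      unfolding sum_distrib_left mult.assoc[symmetric]
      by (intro sum.cong HOL.refl) (use e i in \<open>auto simp: P_def\<close>)
    then show ?thesis using i by (simp add: q_def right_diff_distrib pe)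
  qed
  have "q = 0"
  proof (rule ccontr)
    assume "q \<noteq> 0"
    then obtain y where y: "q * y * p \<noteq> 0" using prime[of q p] p(1) by blast
    define x where "x = q * y * p"
    have xp: "x * p = x" by (simp add: x_def mult.assoc p)
    have ex: "star (e i) * x = 0" if "i < m" for i
      using eq[OF that] by (simp add: x_def flip: mult.assoc)
    have xe: "star x * e i = 0" if "i < m" for i
      using arg_cong[OF ex[OF that], of star] by (simp add: star_mult star_star)
    have x0: "x \<noteq> 0" using y by (simp add: x_def)
    obtain c where c: "c > 0" "star x * x = complex_of_real c *\<^sub>C p"
      using minimal_projection_positive[OF p xp x0] by blast
    define e' where "e' = e (m := (1 / sqrt c) *\<^sub>R x)"
    have "P (Suc m) e'"
      unfolding P_def
    proof (intro conjI allI impI)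
      show "e' i * p = e' i" if "i < Suc m" for i
        using that e xp by (cases "i = m") (auto simp: e'_def P_def)
      have "star (e' m) * e' m = (1 / sqrt c * (1 / sqrt c)) *\<^sub>R (star x * x)"
        by (simp add: e'_def star_scaleR)
      also have "\<dots> = (1 / c) *\<^sub>R (complex_of_real c *\<^sub>C p)" using c(1) by (simp add: c(2))
      also have "\<dots> = p" using c(1) by (simp add: scaleR_scaleC scaleC_scaleC scaleC_one)
      finally have xx: "star (e' m) * e' m = p" .
      show "star (e' i) * e' j = (if i = j then p else 0)" if "i < Suc m" "j < Suc m" for i j
      proof (cases "i = m \<or> j = m")
        case True
        then show ?thesis using that xx ex xe by (auto simp: e'_def star_scaleR less_Suc_eq)
      next
        case False
        then show ?thesis using that e by (auto simp: e'_def P_def less_Suc_eq)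
      qed
    qed
    from max[OF this] show False by simp
  qed
  then have "(\<Sum>k<m. e k * star (e k)) = 1" by (simp add: q_def)
  then show ?thesis
    using e by (intro matrix_units_imp_matrix_algebra[OF p(1,3,2,4), of m e]) (auto simp: P_def)
qed

lemma matrix_algebra_transfer:
  fixes \<rho> :: "'a::unital_cstar_algebra \<Rightarrow> 'b::unital_cstar_algebra"
  assumes \<rho>: "star_isomorphism \<rho>" and A: "matrix_algebra TYPE('a)"
  shows "matrix_algebra TYPE('b)"
proof -
  obtain n f where f: "n > 0" "bij_betw f UNIV (carrier_mat n n)" "\<And>x y::'a. f (x + y) = f x + f y"
    "\<And>c x. f (c *\<^sub>C x) = c \<cdot>\<^sub>m f x" "\<And>x y. f (x * y) = f x * f y" "\<And>x. f (star x) = mat_adjoint (f x)"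
    using A unfolding matrix_algebra_def by blast
  define s where "s = inv_into UNIV \<rho>"
  have s: "star_isomorphism s" unfolding s_def by (rule star_isomorphism_inv[OF \<rho>])
  have "bij_betw (f \<circ> s) UNIV (carrier_mat n n)"
    by (rule bij_betw_trans[OF star_isomorphism_bij[OF s] f(2)])
  then show ?thesis
    unfolding matrix_algebra_def using f(1)
    by (intro exI[of _ n] exI[of _ "f \<circ> s"] conjI allI)
      (simp_all add: f(3-) clinear_add[OF star_isomorphism_clinear[OF s]] star_isomorphism_mult[OF s]
        clinear_scaleC[OF star_isomorphism_clinear[OF s]] star_isomorphism_star[OF s])
qed

section \<open>Innerness of the flip\<close>

lemma ptens_eq_0_imp:
  fixes x :: "'a::{complex_normed_vector, banach}" and y :: "'b::{complex_normed_vector, banach}"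
  assumes "x \<otimes>\<^sub>\<gamma> y = 0"
  shows "x = 0 \<or> y = 0"
proof (rule ccontr)
  assume "\<not> ?thesis"
  then obtain F :: "'b \<Rightarrow> complex" where F: "clinear F" "\<And>v. cmod (F v) \<le> norm v" "F y = norm y" and x: "x \<noteq> 0" "y \<noteq> 0"
    using norming_functional[of y] by auto
  have Fb: "bounded_clinear F" using F by (intro bounded_clinearI[of F 1]) simp_all
  have "norm y *\<^sub>R x = slice_right F (x \<otimes>\<^sub>\<gamma> y)" by (simp add: slice_right_pure[OF Fb] F scaleR_scaleC)
  also have "\<dots> = 0" by (simp add: assms bounded_clinear_zero[OF bounded_clinear_slice_right[OF Fb]])
  finally show False using x by simp
qed

lemma tensor_incl_finite_sum:
  "\<exists>n x y. tensor_incl t = (\<Sum>i<n. x i \<otimes>\<^sub>\<gamma> y (i::nat))"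
proof (induction t rule: tensor_induct)
  case zero
  then show ?case by (intro exI[of _ 0]) (simp add: tensor_incl_def zero_ptensor.abs_eq)
next
  case (add a b t)
  then obtain n x y where "tensor_incl t = (\<Sum>i<n. x i \<otimes>\<^sub>\<gamma> y (i::nat))" by blast
  then have "tensor_incl (pure_tensor a b + t) = (\<Sum>i<Suc n. (x(n := a)) i \<otimes>\<^sub>\<gamma> (y(n := b)) i)"
    by (simp add: tensor_incl_add add.commute flip: ptens_def)
  then show ?case by blast
qed

lemma star_sum: "star (sum f I) = (\<Sum>i\<in>I. star (f i :: 'a::unital_star_algebra))"
  by (induction I rule: infinite_finite_induct) (simp_all add: star_add)

text \<open>Slicing \<open>u\<^sup>* (1 \<otimes> \<rho> a) u = a \<otimes> 1\<close> by a state returns \<open>a\<close>. Replacing \<open>u\<close> by a nearby finite sum of elementary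
tensors turns this into a finite rank map \<open>T\<close> with \<open>\<parallel>T a - a\<parallel> < \<parallel>a\<parallel>\<close> for \<open>a \<noteq> 0\<close>, which is injective. For
primeness, \<open>a A b = 0\<close> implies \<open>(a \<otimes> 1) u\<^sup>* (b \<otimes> 1) = 0\<close>; moving \<open>u\<^sup>*\<close> to the left gives \<open>b \<otimes> \<rho> a = 0\<close>.\<close>

lemma flip_intertwiner_imp_matrix_algebra:
  fixes u :: "('a::unital_cstar_algebra, 'b::unital_cstar_algebra) ptensor"
  assumes \<rho>: "star_isomorphism \<rho>" and u: "unitary u"
    and u\<rho>: "\<And>a. u * (a \<otimes>\<^sub>\<gamma> 1) = (1 \<otimes>\<^sub>\<gamma> \<rho> a) * u"
  shows "matrix_algebra TYPE('a)"
proof -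
  have uu: "star u * u = 1" "u * star u = 1" using u by (simp_all add: unitary_def)
  have conj: "star u * (1 \<otimes>\<^sub>\<gamma> \<rho> a) * u = a \<otimes>\<^sub>\<gamma> 1" for a
    using u\<rho>[of a] by (metis mult.assoc mult_1_left uu(1))
  have su: "(a \<otimes>\<^sub>\<gamma> 1) * star u = star u * (1 \<otimes>\<^sub>\<gamma> \<rho> a)" for a
    unfolding conj[symmetric] by (simp add: mult.assoc uu(2))
  obtain f :: "'b \<Rightarrow> complex" where f: "state f" using central_state_exists by blast
  note fb = state_bounded_clinear[OF f]
  have fn: "norm (slice_right f z :: 'a) \<le> norm z" for z
    using norm_slice_right[OF state_clinear[OF f], of 1 z] state_bound[OF f] by simp
  \<comment> \<open>With \<open>\<parallel>u - v\<parallel> < d\<close>, the difference of the two conjugations is at most \<open>d (2 \<parallel>u\<parallel> + 1) \<parallel>a\<parallel>\<close>.\<close>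
  define d where "d = min 1 (1 / (2 * (2 * norm u + 1)))"
  have q: "2 * norm u + 1 > 0" using norm_ge_zero[of u] by linarith
  have d: "d > 0" "d \<le> 1" using q by (simp_all add: d_def)
  have "d * (2 * norm u + 1) \<le> (1 / (2 * (2 * norm u + 1))) * (2 * norm u + 1)"
    using q by (intro mult_right_mono) (auto simp: d_def)
  also have "\<dots> < 1" using q by simp
  finally have d3: "d * (2 * norm u + 1) < 1" .
  obtain t where t: "norm (u - tensor_incl t) < d" using tensor_incl_dense[OF d(1)] by blast
  obtain n x y where w: "tensor_incl t = (\<Sum>i<n. x i \<otimes>\<^sub>\<gamma> y (i::nat))" using tensor_incl_finite_sum by blast
  define v where "v = tensor_incl t"
  define T where "T a = slice_right f (star v * (1 \<otimes>\<^sub>\<gamma> \<rho> a) * v)" for a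
  have Tlin: "clinear T"
    by (simp add: clinear_def T_def clinear_add[OF star_isomorphism_clinear[OF \<rho>]]
        clinear_scaleC[OF star_isomorphism_clinear[OF \<rho>]] ptens_add_right ptens_scaleC_right distrib_left distrib_right
        mult_scaleC_left mult_scaleC_right bounded_clinear_add[OF bounded_clinear_slice_right[OF fb]]
        bounded_clinear_scaleC[OF bounded_clinear_slice_right[OF fb]])
  have Tinj: "a = 0" if "T a = 0" for a
  proof (rule ccontr)
    assume a: "a \<noteq> 0"
    have "a = slice_right f (a \<otimes>\<^sub>\<gamma> 1)" by (simp add: slice_right_pure[OF fb] state_one[OF f] scaleC_one)
    also have "\<dots> = slice_right f (star u * (1 \<otimes>\<^sub>\<gamma> \<rho> a) * u) - T a" using that by (simp add: conj)
    also have "\<dots> = slice_right f (star u * (1 \<otimes>\<^sub>\<gamma> \<rho> a) * u - star v * (1 \<otimes>\<^sub>\<gamma> \<rho> a) * v)"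
      by (simp add: T_def bounded_clinear_diff[OF bounded_clinear_slice_right[OF fb]])
    finally have "norm a \<le> norm (star u * (1 \<otimes>\<^sub>\<gamma> \<rho> a) * u - star v * (1 \<otimes>\<^sub>\<gamma> \<rho> a) * v)" using fn by metis
    also have "star u * (1 \<otimes>\<^sub>\<gamma> \<rho> a) * u - star v * (1 \<otimes>\<^sub>\<gamma> \<rho> a) * v
        = star u * (1 \<otimes>\<^sub>\<gamma> \<rho> a) * (u - v) + star (u - v) * (1 \<otimes>\<^sub>\<gamma> \<rho> a) * v"
      by (simp add: star_diff algebra_simps)
    also have "norm \<dots> \<le> norm u * norm a * d + d * norm a * (norm u + 1)"
    proof (rule norm_triangle_mono)
      have r: "norm ((1::'a) \<otimes>\<^sub>\<gamma> \<rho> a) \<le> norm a"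
        using norm_ptens_le[of "1::'a" "\<rho> a"] by (simp add: star_isomorphism_isometric[OF \<rho>])
      have uv: "norm (u - v) \<le> d" using t by (simp add: v_def)
      have v: "norm v \<le> norm u + 1" using norm_triangle_ineq2[of v u] uv d(2) by (simp add: norm_minus_commute)
      show "norm (star u * (1 \<otimes>\<^sub>\<gamma> \<rho> a) * (u - v)) \<le> norm u * norm a * d"
        by (intro order.trans[OF norm_mult_ineq] mult_mono uv order.trans[OF norm_mult_ineq] r)
          (simp_all add: norm_star)
      show "norm (star (u - v) * (1 \<otimes>\<^sub>\<gamma> \<rho> a) * v) \<le> d * norm a * (norm u + 1)"
        by (intro order.trans[OF norm_mult_ineq] mult_mono v order.trans[OF norm_mult_ineq] r)
          (use uv d in \<open>simp_all add: norm_star\<close>)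
    qed
    also have "\<dots> = (d * (2 * norm u + 1)) * norm a" by (simp add: algebra_simps)
    also have "\<dots> < 1 * norm a" using a d3 by (intro mult_strict_right_mono) auto
    finally show False by simp
  qed
  define X where "X = (\<lambda>(i, j). star (x i) * x j) ` ({..<n} \<times> {..<n})"
  have Tspan: "T a \<in> complex_vector.span X" for a
  proof -
    have "star v * (1 \<otimes>\<^sub>\<gamma> \<rho> a) * v
        = (\<Sum>j<n. \<Sum>i<n. (star (x i) * x j) \<otimes>\<^sub>\<gamma> (star (y i) * \<rho> a * y j))"
      by (simp add: v_def w star_sum sum_distrib_left sum_distrib_right star_ptens ptens_mult)
    then have "T a = (\<Sum>j<n. \<Sum>i<n. f (star (y i) * \<rho> a * y j) *\<^sub>C (star (x i) * x j))"
      by (simp add: T_def clinear_sum[OF bounded_clinear_clinear[OF bounded_clinear_slice_right[OF fb]]] slice_right_pure[OF fb])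
    also have "\<dots> \<in> complex_vector.span X"
      by (intro complex_vector.span_sum complex_vector.span_scale complex_vector.span_base) (auto simp: X_def)
    finally show ?thesis .
  qed
  have fd: "k \<le> card X" if h: "lin_indep k h" for k and h :: "nat \<Rightarrow> 'a"
  proof (rule lin_indep_le_card)
    show "lin_indep k (\<lambda>i. T (h i))"
      unfolding lin_indep_def
    proof (intro allI impI)
      fix c i assume "(\<Sum>i<k. c i *\<^sub>C T (h i)) = 0" and i: "i < k"
      then have "T (\<Sum>i<k. c i *\<^sub>C h i) = 0" by (simp add: clinear_sum[OF Tlin] clinear_scaleC[OF Tlin])
      then have "(\<Sum>i<k. c i *\<^sub>C h i) = 0" by (rule Tinj)
      then show "c i = 0" using h i unfolding lin_indep_def by blast
    qed
    show "finite X" by (simp add: X_def)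
    show "T (h i) \<in> complex_vector.span X" for i by (rule Tspan)
  qed
  show ?thesis
  proof (rule prime_imp_matrix_algebra[where N = "card X"])
    show "k \<le> card X" if "lin_indep k h" for k and h :: "nat \<Rightarrow> 'a" by (rule fd[OF that])
    fix a b :: 'a assume ab: "\<And>x. a * x * b = 0" and b: "b \<noteq> 0"
    have z0: "(0::'a) \<otimes>\<^sub>\<gamma> y = 0" for y :: 'b
      using ptens_scaleC_left[of 0 "0::'a" y] by simp
    have "(a \<otimes>\<^sub>\<gamma> 1) * z * (b \<otimes>\<^sub>\<gamma> 1) = 0" for z :: "('a, 'b) ptensor"
      by (rule ptensor_eqI[of "\<lambda>z. (a \<otimes>\<^sub>\<gamma> 1) * z * (b \<otimes>\<^sub>\<gamma> 1)" "\<lambda>_. 0", OF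
            bounded_clinear_compose[OF bounded_clinear_mult_right bounded_clinear_mult_left]])
        (simp_all add: ptens_mult ab z0 bounded_clinearI[of _ 0] clinear_def)
    from this[of "star u"] have "star u * ((1 \<otimes>\<^sub>\<gamma> \<rho> a) * (b \<otimes>\<^sub>\<gamma> 1)) = 0"
      by (simp only: su mult.assoc)
    then have "u * (star u * (b \<otimes>\<^sub>\<gamma> \<rho> a)) = 0" by (simp add: ptens_mult)
    then have "b \<otimes>\<^sub>\<gamma> \<rho> a = 0" by (simp add: uu flip: mult.assoc)
    then have "\<rho> a = 0" using ptens_eq_0_imp b by blast
    then show "a = 0" using star_isomorphism_isometric[OF \<rho>, of a] by simp
  qed
qed

section \<open>Hermitian elements of the tensor product\<close>

text \<open>A condition on the norm alone, hence invariant under isometries. It is the form in which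
\<open>\<parallel>exp (i t k)\<parallel> = 1\<close> is used, and it makes all states real on \<open>k\<close>.\<close>

definition hermitian :: "'a::{unital_banach_star_algebra, real_normed_algebra_1} \<Rightarrow> bool" where
  "hermitian k \<longleftrightarrow> (\<exists>C. \<forall>t. norm (1 + t *\<^sub>R (\<i> *\<^sub>C k)) \<le> 1 + C * t\<^sup>2)"

lemma hermitian_state_real:
  fixes k :: "'a::{unital_banach_star_algebra, real_normed_algebra_1}"
  assumes k: "hermitian k" and \<Phi>: "state \<Phi>"
  shows "Im (\<Phi> k) = 0"
proof (rule ccontr)
  assume "Im (\<Phi> k) \<noteq> 0"
  define y where "y = Im (\<Phi> k)"
  have y: "y \<noteq> 0" using \<open>Im (\<Phi> k) \<noteq> 0\<close> by (simp add: y_def)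
  obtain C where C: "\<And>t. norm (1 + t *\<^sub>R (\<i> *\<^sub>C k)) \<le> 1 + C * t\<^sup>2" using k by (auto simp: hermitian_def)
  have le: "- t * y \<le> C * t\<^sup>2" for t
  proof -
    have "\<Phi> (1 + t *\<^sub>R (\<i> *\<^sub>C k)) = 1 + t *\<^sub>R (\<i> * \<Phi> k)"
      by (simp add: clinear_add[OF state_clinear[OF \<Phi>]] clinear_scaleR[OF state_clinear[OF \<Phi>]]
          clinear_scaleC[OF state_clinear[OF \<Phi>]] state_one[OF \<Phi>])
    then have "1 - t * y = Re (\<Phi> (1 + t *\<^sub>R (\<i> *\<^sub>C k)))" by (simp add: y_def)
    also have "\<dots> \<le> 1 + C * t\<^sup>2"
      using complex_Re_le_cmod state_bound[OF \<Phi>] C order_trans by meson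
    finally show ?thesis by simp
  qed
  define s where "s = 1 / (\<bar>C\<bar> + 1)"
  have s: "s > 0" "C * s < 1" by (simp_all add: s_def)
  have "s * y\<^sup>2 \<le> (C * s) * (s * y\<^sup>2)" using le[of "- s * y"] by (simp add: power2_eq_square algebra_simps)
  moreover have "(C * s) * (s * y\<^sup>2) < 1 * (s * y\<^sup>2)" using s y by (intro mult_strict_right_mono) auto
  ultimately show False by simp
qed

lemma state_ptensorI:
  fixes V :: "('a::unital_cstar_algebra, 'b::unital_cstar_algebra) ptensor \<Rightarrow> complex"
  assumes V: "bounded_clinear V" and "V (1 \<otimes>\<^sub>\<gamma> 1) = 1" "\<And>x y. cmod (V (x \<otimes>\<^sub>\<gamma> y)) \<le> norm x * norm y"
  shows "state V"
  using ptensor_norm_bound[OF bounded_clinear_clinear[OF V] bounded_clinear_continuous[OF V], of 1] assms(2,3)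
  by (simp add: state_def bounded_clinear_clinear[OF V] ptens_one)

lemma state_ptens_left:
  fixes \<Phi> :: "('a::unital_cstar_algebra, 'b::unital_cstar_algebra) ptensor \<Rightarrow> complex"
  assumes "state \<Phi>"
  shows "state (\<lambda>x. \<Phi> (x \<otimes>\<^sub>\<gamma> 1))" "state (\<lambda>y. \<Phi> (1 \<otimes>\<^sub>\<gamma> y))"
proof -
  have "cmod (\<Phi> (x \<otimes>\<^sub>\<gamma> 1)) \<le> norm x" "cmod (\<Phi> (1 \<otimes>\<^sub>\<gamma> y)) \<le> norm y" for x y
    using state_bound[OF assms, of "x \<otimes>\<^sub>\<gamma> 1"] norm_ptens_le[of x "1::'b"]
      state_bound[OF assms, of "1 \<otimes>\<^sub>\<gamma> y"] norm_ptens_le[of "1::'a" y] by simp_all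
  then show "state (\<lambda>x. \<Phi> (x \<otimes>\<^sub>\<gamma> 1))" "state (\<lambda>y. \<Phi> (1 \<otimes>\<^sub>\<gamma> y))"
    using bounded_clinear_clinear[OF bounded_clinear_compose[OF state_bounded_clinear[OF assms] bounded_clinear_ptens_left]]
      bounded_clinear_clinear[OF bounded_clinear_compose[OF state_bounded_clinear[OF assms] bounded_clinear_ptens_right]]
      state_one[OF assms]
    by (simp_all add: state_def ptens_one)
qed

definition product_functional :: "('a \<Rightarrow> complex) \<Rightarrow> ('b \<Rightarrow> complex) \<Rightarrow>
    ('a::unital_cstar_algebra, 'b::unital_cstar_algebra) ptensor \<Rightarrow> complex" where
  "product_functional f g z = f (slice_right g z)"

lemma bounded_clinear_product_functional:
  assumes "bounded_clinear f" "bounded_clinear g"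
  shows "bounded_clinear (product_functional f g)"
  unfolding product_functional_def
  by (rule bounded_clinear_compose[OF assms(1) bounded_clinear_slice_right[OF assms(2)]])

lemma product_functional_pure:
  assumes "bounded_clinear f" "bounded_clinear g"
  shows "product_functional f g (x \<otimes>\<^sub>\<gamma> y) = f x * g y"
  by (simp add: product_functional_def slice_right_pure[OF assms(2)] bounded_clinear_scaleC[OF assms(1)])

lemma bounded_clinear_combine:
  fixes f g :: "'a::complex_normed_vector \<Rightarrow> 'b::complex_normed_vector"
  assumes f: "bounded_clinear f" and g: "bounded_clinear g"
  shows "bounded_clinear (\<lambda>x. c *\<^sub>C f x + d *\<^sub>C g x)"
proof -
  obtain K where K: "\<And>x. norm (f x) \<le> K * norm x" using bounded_clinearD[OF f] by metis
  obtain L where L: "\<And>x. norm (g x) \<le> L * norm x" using bounded_clinearD[OF g] by metis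
  show ?thesis
  proof (rule bounded_clinearI)
    show "clinear (\<lambda>x. c *\<^sub>C f x + d *\<^sub>C g x)"
      by (simp add: clinear_def bounded_clinear_add[OF f] bounded_clinear_add[OF g] bounded_clinear_scaleC[OF f]
          bounded_clinear_scaleC[OF g] scaleC_add_right scaleC_scaleC mult.commute)
    show "norm (c *\<^sub>C f x + d *\<^sub>C g x) \<le> (cmod c * K + cmod d * L) * norm x" for x
      using mult_left_mono[OF K, of "cmod c" x] mult_left_mono[OF L, of "cmod d" x]
        norm_triangle_ineq[of "c *\<^sub>C f x" "d *\<^sub>C g x"]
      by (simp add: norm_scaleC algebra_simps)
  qed
qed

lemma real_cauchy_schwarz_2:
  fixes a b c d :: real
  assumes "a\<^sup>2 + c\<^sup>2 \<le> X\<^sup>2" "b\<^sup>2 + d\<^sup>2 \<le> Y\<^sup>2" "X \<ge> 0" "Y \<ge> 0"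
  shows "a * b + c * d \<le> X * Y"
proof -
  have "(a * b + c * d)\<^sup>2 + (a * d - c * b)\<^sup>2 = (a\<^sup>2 + c\<^sup>2) * (b\<^sup>2 + d\<^sup>2)"
    by (simp add: power2_eq_square algebra_simps)
  also have "\<dots> \<le> X\<^sup>2 * Y\<^sup>2" using assms by (intro mult_mono) auto
  finally have "(a * b + c * d)\<^sup>2 \<le> (X * Y)\<^sup>2" by (simp add: power_mult_distrib add_increasing2) (smt (verit) zero_le_power2)
  then show ?thesis using assms by (meson abs_le_square_iff abs_ge_self mult_nonneg_nonneg abs_of_nonneg order_trans power2_le_imp_le)
qed

lemma scaleC_scaleR: "c *\<^sub>C r *\<^sub>R x = r *\<^sub>R c *\<^sub>C (x::'a::complex_normed_vector)"
  by (simp add: scaleR_scaleC scaleC_scaleC mult.commute)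

text \<open>The second-order Taylor polynomial of \<open>exp (i t h)\<close> is unitary up to fourth order.\<close>

lemma norm_second_order_unitary:
  fixes h :: "'a::unital_cstar_algebra"
  assumes h: "star h = h" and t: "0 \<le> t"
  shows "norm (1 + t *\<^sub>R (\<i> *\<^sub>C h) - (t\<^sup>2 / 2) *\<^sub>R (h * h)) \<le> 1 + t ^ 4 * norm h ^ 4"
proof -
  define a where "a = 1 + t *\<^sub>R (\<i> *\<^sub>C h) - (t\<^sup>2 / 2) *\<^sub>R (h * h)"
  have sa: "star a = 1 - t *\<^sub>R (\<i> *\<^sub>C h) - (t\<^sup>2 / 2) *\<^sub>R (h * h)"
    by (simp add: a_def star_add star_diff star_scaleR star_scaleC star_mult h scaleC_minus_left)
  define c where "c = 1 - (t\<^sup>2 / 2) *\<^sub>R (h * h)"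
  define s where "s = t *\<^sub>R (\<i> *\<^sub>C h)"
  have cs: "c * s = s * c" by (simp add: c_def s_def algebra_simps mult_scaleC_left mult_scaleC_right scaleC_scaleR mult.commute)
  have ss: "s * s = - (t\<^sup>2 *\<^sub>R (h * h))"
    by (simp add: s_def mult_scaleC_left mult_scaleC_right scaleC_scaleC scaleC_scaleR scaleC_minus_left scaleC_one power2_eq_square)
  have cc: "c * c = 1 - t\<^sup>2 *\<^sub>R (h * h) + (t ^ 4 / 4) *\<^sub>R (h * h * (h * h))"
  proof -
    define q where "q = (t\<^sup>2 / 2) *\<^sub>R (h * h)"
    have "c * c = 1 - (q + q) + q * q" by (simp add: c_def q_def[symmetric] algebra_simps)
    also have "q + q = t\<^sup>2 *\<^sub>R (h * h)" by (simp add: q_def flip: scaleR_left_distrib)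
    also have "q * q = (t ^ 4 / 4) *\<^sub>R (h * h * (h * h))" by (simp add: q_def power2_eq_square power4_eq_xxxx)
    finally show ?thesis .
  qed
  have e1: "star a = c - s" unfolding sa by (simp add: c_def s_def)
  have e2: "a = c + s" by (simp add: a_def c_def s_def)
  have "star a * a = (c - s) * (c + s)" unfolding e1 unfolding e2 ..
  also have "\<dots> = c * c - s * s" using cs by (simp add: algebra_simps)
  also have "\<dots> = 1 + (t ^ 4 / 4) *\<^sub>R (h * h * (h * h))" by (simp add: ss cc)
  finally have "(norm a)\<^sup>2 \<le> 1 + (t ^ 4 / 4) * norm (h * h * (h * h))"
    unfolding norm_star_mult_self[symmetric] using norm_triangle_ineq[of 1 "(t ^ 4 / 4) *\<^sub>R (h * h * (h * h))"] t by simp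
  also have "norm (h * h * (h * h)) = norm h ^ 4"
    using norm_selfadjoint_square[of "h * h"] h by (simp add: norm_selfadjoint_square star_mult flip: power_mult)
  finally have "(norm a)\<^sup>2 \<le> 1 + (t ^ 4 / 4) * norm h ^ 4" .
  also have "\<dots> \<le> (1 + t ^ 4 * norm h ^ 4)\<^sup>2"
  proof -
    have "0 \<le> t ^ 4 * norm h ^ 4" using t by simp
    then show ?thesis by (simp add: power2_eq_square algebra_simps)
  qed
  finally show ?thesis
    unfolding a_def by (rule power2_le_imp_le) (use t in simp)
qed

context
  fixes \<Phi> :: "('a::unital_cstar_algebra, 'b::unital_cstar_algebra) ptensor \<Rightarrow> complex"
  assumes \<Phi>: "state \<Phi>"
begin

text \<open>Evaluate \<open>\<Phi>\<close> at the tensor product of the approximate unitaries \<open>exp (i t h)\<close> and \<open>exp (i t k)\<close>. The real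
part of the result is at most \<open>1 + O(t\<^sup>4)\<close>, and its second-order term is minus half the right-hand side.\<close>

lemma second_order_inequality:
  assumes h: "star h = h" "\<Phi> (h \<otimes>\<^sub>\<gamma> 1) = 0" and k: "star k = k" "\<Phi> (1 \<otimes>\<^sub>\<gamma> k) = 0"
  shows "0 \<le> Re (\<Phi> ((h * h) \<otimes>\<^sub>\<gamma> 1)) + Re (\<Phi> (1 \<otimes>\<^sub>\<gamma> (k * k))) + 2 * Re (\<Phi> (h \<otimes>\<^sub>\<gamma> k))"
proof -
  note l = clinear_add[OF state_clinear[OF \<Phi>]] clinear_diff[OF state_clinear[OF \<Phi>]]
    clinear_scaleC[OF state_clinear[OF \<Phi>]] clinear_scaleR[OF state_clinear[OF \<Phi>]]
  define Q where "Q = Re (\<Phi> ((h * h) \<otimes>\<^sub>\<gamma> 1)) + Re (\<Phi> (1 \<otimes>\<^sub>\<gamma> (k * k))) + 2 * Re (\<Phi> (h \<otimes>\<^sub>\<gamma> k))"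
  define R3 where "R3 = Im (\<Phi> (h \<otimes>\<^sub>\<gamma> (k * k))) / 2 + Im (\<Phi> ((h * h) \<otimes>\<^sub>\<gamma> k)) / 2"
  define R4 where "R4 = Re (\<Phi> ((h * h) \<otimes>\<^sub>\<gamma> (k * k))) / 4"
  define H where "H = norm h ^ 4"
  define K where "K = norm k ^ 4"
  define M where "M = H + K + H * K"
  have HK: "H \<ge> 0" "K \<ge> 0" by (simp_all add: H_def K_def)
  have ineq: "- Q / 2 \<le> t * (\<bar>R3\<bar> + \<bar>R4\<bar> + M)" if t: "0 < t" "t \<le> 1" for t
  proof -
    define a where "a = 1 + t *\<^sub>R (\<i> *\<^sub>C h) - (t\<^sup>2 / 2) *\<^sub>R (h * h)"
    define b where "b = 1 + t *\<^sub>R (\<i> *\<^sub>C k) - (t\<^sup>2 / 2) *\<^sub>R (k * k)"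
    have "Re (\<Phi> (a \<otimes>\<^sub>\<gamma> b)) \<le> norm a * norm b"
      using complex_Re_le_cmod[of "\<Phi> (a \<otimes>\<^sub>\<gamma> b)"] state_bound[OF \<Phi>, of "a \<otimes>\<^sub>\<gamma> b"] norm_ptens_le[of a b] by linarith
    also have "\<dots> \<le> (1 + t ^ 4 * H) * (1 + t ^ 4 * K)"
      unfolding a_def b_def H_def K_def
      by (intro mult_mono norm_second_order_unitary h k) (use t in auto)
    also have "\<dots> = 1 + t ^ 4 * (H + K) + t ^ 8 * (H * K)" by (simp add: algebra_simps flip: power_add)
    also have "\<dots> \<le> 1 + t ^ 4 * M"
      using mult_right_mono[OF power_decreasing[of 4 8 t], of "H * K"] t HK by (simp add: M_def algebra_simps)
    finally have up: "Re (\<Phi> (a \<otimes>\<^sub>\<gamma> b)) \<le> 1 + t ^ 4 * M" .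
    have "Re (\<Phi> (a \<otimes>\<^sub>\<gamma> b)) = 1 - t\<^sup>2 * (Q / 2) + t ^ 3 * R3 + t ^ 4 * R4"
      unfolding a_def b_def
      by (simp add: ptens_diff ptens_scaleR ptens_add_left ptens_add_right ptens_scaleC_left ptens_scaleC_right l h k
          ptens_one state_one[OF \<Phi>])
        (simp add: Q_def R3_def R4_def power2_eq_square power3_eq_cube power4_eq_xxxx field_simps)
    with up have "t\<^sup>2 * (- Q / 2) \<le> t ^ 4 * M - t ^ 3 * R3 - t ^ 4 * R4" by (simp add: algebra_simps)
    also have "\<dots> = t\<^sup>2 * (t\<^sup>2 * M - t * R3 - t\<^sup>2 * R4)"
      by (simp add: power2_eq_square power3_eq_cube power4_eq_xxxx algebra_simps)
    finally have 1: "- Q / 2 \<le> t\<^sup>2 * M - t * R3 - t\<^sup>2 * R4" using t mult_le_cancel_left_pos[of "t\<^sup>2" "- Q / 2"] by auto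
    have t2: "t\<^sup>2 \<le> t" using t by (simp add: power2_eq_square mult_left_le)
    have M0: "M \<ge> 0" using HK by (simp add: M_def)
    have "t\<^sup>2 * M \<le> t * M" using t2 M0 by (rule mult_right_mono)
    moreover have "- (t * R3) \<le> t * \<bar>R3\<bar>"
      using mult_left_mono[of "- R3" "\<bar>R3\<bar>" t] t by simp
    moreover have "- (t\<^sup>2 * R4) \<le> t * \<bar>R4\<bar>"
    proof -
      have "- (t\<^sup>2 * R4) \<le> t\<^sup>2 * \<bar>R4\<bar>" using mult_left_mono[of "- R4" "\<bar>R4\<bar>" "t\<^sup>2"] by simp
      also have "\<dots> \<le> t * \<bar>R4\<bar>" using t2 by (rule mult_right_mono) simp
      finally show ?thesis .
    qed
    ultimately show ?thesis using 1 by (simp add: algebra_simps)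
  qed
  have "- Q / 2 \<le> 0"
  proof (rule field_le_epsilon)
    fix e :: real assume e: "e > 0"
    define L where "L = \<bar>R3\<bar> + \<bar>R4\<bar> + M"
    have L: "L \<ge> 0" using HK by (simp add: L_def M_def)
    define t where "t = min 1 (e / (L + 1))"
    have t: "0 < t" "t \<le> 1" using e L by (auto simp: t_def)
    have "t * L \<le> e / (L + 1) * L" using L by (intro mult_right_mono) (auto simp: t_def)
    also have "\<dots> \<le> e" using e L by (simp add: field_simps)
    finally show "- Q / 2 \<le> 0 + e" using ineq[OF t] by (simp add: L_def)
  qed
  then show ?thesis by (simp add: Q_def)
qed

end

lemma quadratic_form_bound:
  fixes A B R :: real
  assumes q: "\<And>s t. 0 \<le> t\<^sup>2 * A + s\<^sup>2 * B + 2 * t * s * R"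
  shows "R\<^sup>2 \<le> A * B"
proof -
  have A: "A \<ge> 0" and B: "B \<ge> 0" using q[of 1 0] q[of 0 1] by simp_all
  show ?thesis
  proof (cases "B = 0")
    case True
    have "R = 0"
    proof (rule ccontr)
      assume R: "R \<noteq> 0"
      have "0 \<le> A + 2 * (- (A + 1) / R) * R" using q[of 1 "- (A + 1) / R"] by (simp add: True)
      also have "\<dots> = - A - 2" using R by simp
      finally show False using A by simp
    qed
    then show ?thesis by (simp add: True)
  next
    case False
    have "0 \<le> B\<^sup>2 * A + R\<^sup>2 * B + 2 * B * - R * R" using q[of B "- R"] by simp
    also have "\<dots> = B * (A * B - R\<^sup>2)" by (simp add: power2_eq_square algebra_simps)
    finally show ?thesis using False B by (simp add: zero_le_mult_iff)
  qed
qed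

definition state_variance :: "('a::unital_cstar_algebra \<Rightarrow> complex) \<Rightarrow> 'a \<Rightarrow> real" where
  "state_variance f h = Re (f (h * h)) - (Re (f h))\<^sup>2"

lemma state_variance_centred:
  fixes h :: "'a::unital_cstar_algebra"
  assumes f: "state f" and h: "star h = h"
  shows "state_variance f h = Re (f ((h - Re (f h) *\<^sub>R 1) * (h - Re (f h) *\<^sub>R 1)))"
proof -
  note l = clinear_diff[OF state_clinear[OF f]] clinear_scaleR[OF state_clinear[OF f]] state_one[OF f]
    clinear_add[OF state_clinear[OF f]]
  show ?thesis by (simp add: state_variance_def algebra_simps l power2_eq_square)
qed

lemma state_variance_nonneg:
  fixes h :: "'a::unital_cstar_algebra"
  assumes "state f" "star h = h"
  shows "state_variance f h \<ge> 0"
  unfolding state_variance_centred[OF assms]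
  by (rule state_square_nonneg[OF assms(1)]) (simp add: star_diff star_scaleR assms(2))

text \<open>The squares of the real and imaginary parts add up to \<open>(x\<^sup>* x + x x\<^sup>*) / 2\<close>, of norm at most \<open>\<parallel>x\<parallel>\<^sup>2\<close>.\<close>

lemma state_variance_parts:
  fixes x :: "'a::unital_cstar_algebra"
  assumes f: "state f"
  shows "(cmod (f x))\<^sup>2 + (state_variance f (real_part x) + state_variance f (imag_part x)) \<le> (norm x)\<^sup>2"
proof -
  define a b where "a = real_part x" and "b = imag_part x"
  have x: "x = a + \<i> *\<^sub>C b" and sx: "star x = a - \<i> *\<^sub>C b"
    by (simp_all add: a_def b_def real_imag_part star_real_imag)
  note l = clinear_add[OF state_clinear[OF f]] clinear_scaleC[OF state_clinear[OF f]] clinear_scaleR[OF state_clinear[OF f]]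
  have r: "Im (f a) = 0" "Im (f b) = 0" by (simp_all add: a_def b_def state_selfadjoint_real[OF f])
  have 1: "star x * x + x * star x = 2 *\<^sub>R (a * a + b * b)"
    unfolding sx unfolding x
    by (simp add: algebra_simps mult_scaleC_left mult_scaleC_right scaleC_scaleC scaleC_diff_right scaleC_add_right
        scaleC_minus_one scaleR_2)
  have "norm (x * star x) = (norm x)\<^sup>2" using norm_star_mult_self[of "star x"] by (simp add: star_star norm_star)
  then have "norm (2 *\<^sub>R (a * a + b * b)) \<le> 2 * (norm x)\<^sup>2"
    unfolding 1[symmetric] by (intro order.trans[OF norm_triangle_ineq]) (simp add: norm_star_mult_self)
  then have n: "norm (a * a + b * b) \<le> (norm x)\<^sup>2" by simp
  have "Re (f (a * a)) + Re (f (b * b)) = Re (f (a * a + b * b))" by (simp add: l)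
  also have "\<dots> \<le> (norm x)\<^sup>2" using complex_Re_le_cmod state_bound[OF f] n order_trans by meson
  finally have "Re (f (a * a)) + Re (f (b * b)) \<le> (norm x)\<^sup>2" .
  moreover have "(cmod (f x))\<^sup>2 = (Re (f a))\<^sup>2 + (Re (f b))\<^sup>2"
    by (simp add: x l cmod_power2 r)
  ultimately show ?thesis by (simp add: state_variance_def flip: a_def b_def)
qed

context
  fixes \<Phi> :: "('a::unital_cstar_algebra, 'b::unital_cstar_algebra) ptensor \<Rightarrow> complex"
  assumes \<Phi>: "state \<Phi>"
begin

abbreviation (input) left_state where "left_state \<equiv> \<lambda>x. \<Phi> (x \<otimes>\<^sub>\<gamma> 1)"
abbreviation (input) right_state where "right_state \<equiv> \<lambda>y. \<Phi> (1 \<otimes>\<^sub>\<gamma> y)"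

text \<open>After centring \<open>h\<close> and \<open>k\<close>, the second-order inequality for \<open>t h\<close> and \<open>s k\<close> says that a real quadratic form in
\<open>(t, s)\<close> is nonnegative; this is its discriminant.\<close>

lemma covariance_bound:
  assumes h: "star h = h" and k: "star k = k"
  shows "(Re (\<Phi> (h \<otimes>\<^sub>\<gamma> k)) - Re (left_state h) * Re (right_state k))\<^sup>2
    \<le> state_variance left_state h * state_variance right_state k"
proof -
  note f = state_ptens_left(1)[OF \<Phi>] and g = state_ptens_left(2)[OF \<Phi>]
  note l = clinear_add[OF state_clinear[OF \<Phi>]] clinear_diff[OF state_clinear[OF \<Phi>]]
    clinear_scaleC[OF state_clinear[OF \<Phi>]] clinear_scaleR[OF state_clinear[OF \<Phi>]]
  have real: "\<Phi> (h \<otimes>\<^sub>\<gamma> 1) = complex_of_real (Re (left_state h))" "\<Phi> (1 \<otimes>\<^sub>\<gamma> k) = complex_of_real (Re (right_state k))"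
    using state_selfadjoint_real[OF f h] state_selfadjoint_real[OF g k] by (simp_all add: complex_eq_iff)
  define h' where "h' = h - Re (left_state h) *\<^sub>R 1"
  define k' where "k' = k - Re (right_state k) *\<^sub>R 1"
  have sh: "star h' = h'" "\<Phi> (h' \<otimes>\<^sub>\<gamma> 1) = 0" and sk: "star k' = k'" "\<Phi> (1 \<otimes>\<^sub>\<gamma> k') = 0"
    using real by (simp_all add: h'_def k'_def star_diff star_scaleR h k ptens_diff ptens_scaleR l ptens_one state_one[OF \<Phi>] scaleR_conv_of_real[where 'a = complex])
  have R: "Re (\<Phi> (h' \<otimes>\<^sub>\<gamma> k')) = Re (\<Phi> (h \<otimes>\<^sub>\<gamma> k)) - Re (left_state h) * Re (right_state k)"
    by (simp add: h'_def k'_def ptens_diff ptens_scaleR l ptens_one state_one[OF \<Phi>])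
  have "(Re (\<Phi> (h' \<otimes>\<^sub>\<gamma> k')))\<^sup>2 \<le> Re (\<Phi> ((h' * h') \<otimes>\<^sub>\<gamma> 1)) * Re (\<Phi> (1 \<otimes>\<^sub>\<gamma> (k' * k')))"
  proof (rule quadratic_form_bound)
    fix s t :: real
    show "0 \<le> t\<^sup>2 * Re (\<Phi> ((h' * h') \<otimes>\<^sub>\<gamma> 1)) + s\<^sup>2 * Re (\<Phi> (1 \<otimes>\<^sub>\<gamma> (k' * k'))) + 2 * t * s * Re (\<Phi> (h' \<otimes>\<^sub>\<gamma> k'))"
      using second_order_inequality[OF \<Phi>, of "t *\<^sub>R h'" "s *\<^sub>R k'"] sh sk
      by (simp add: star_scaleR ptens_scaleR l power2_eq_square algebra_simps)
  qed
  then show ?thesis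
    unfolding R state_variance_centred[OF f h] state_variance_centred[OF g k] by (simp add: h'_def k'_def)
qed

text \<open>\<open>S\<close> is the part of \<open>\<Phi>\<close> that is real on self-adjoint elements, and \<open>S - P\<close> is its covariance. By the covariance
bound, for arbitrary \<open>x, y\<close> the value \<open>(S - P) (x \<otimes> y)\<close> is at most twice the product of the standard deviations,
which leaves room for a factor \<open>\<zeta>\<close> of modulus \<open>1/2\<close> in
\<open>|f x|\<^sup>2 + var\<^sub>f x \<le> \<parallel>x\<parallel>\<^sup>2\<close> and \<open>|g y|\<^sup>2 + var\<^sub>g y \<le> \<parallel>y\<parallel>\<^sup>2\<close>.\<close>

lemma covariance_perturbation_state:
  assumes \<zeta>: "cmod \<zeta> \<le> 1/2"
  defines "P \<equiv> product_functional left_state right_state"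
  defines "S \<equiv> \<lambda>z. (1/2) *\<^sub>C \<Phi> z + (1/2) *\<^sub>C cnj (\<Phi> (star z))"
  shows "state (\<lambda>z. (1 - \<zeta>) *\<^sub>C P z + \<zeta> *\<^sub>C S z)"
proof (rule state_ptensorI)
  note f = state_ptens_left(1)[OF \<Phi>] and g = state_ptens_left(2)[OF \<Phi>]
  note fb = state_bounded_clinear[OF f] and gb = state_bounded_clinear[OF g]
  note l = bounded_clinear_add[OF state_bounded_clinear[OF \<Phi>]] bounded_clinear_scaleC[OF state_bounded_clinear[OF \<Phi>]]
  have Pb: "bounded_clinear P" unfolding P_def by (rule bounded_clinear_product_functional[OF fb gb])
  have Sb: "bounded_clinear S"
    unfolding S_def
    using bounded_clinear_combine[OF state_bounded_clinear[OF \<Phi>], of "\<lambda>z. cnj (\<Phi> (star z))" "1/2" "1/2"]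
      bounded_clinear_star_conj[OF state_bounded_clinear[OF \<Phi>]] by simp
  show "bounded_clinear (\<lambda>z. (1 - \<zeta>) *\<^sub>C P z + \<zeta> *\<^sub>C S z)" by (rule bounded_clinear_combine[OF Pb Sb])
  have Pp: "P (x \<otimes>\<^sub>\<gamma> y) = left_state x * right_state y" for x y
    unfolding P_def by (rule product_functional_pure[OF fb gb])
  show "(1 - \<zeta>) *\<^sub>C P (1 \<otimes>\<^sub>\<gamma> 1) + \<zeta> *\<^sub>C S (1 \<otimes>\<^sub>\<gamma> 1) = 1"
    using Pp[of 1 1] by (simp add: S_def ptens_one state_one[OF \<Phi>])
  define W where "W h k = Re (\<Phi> (h \<otimes>\<^sub>\<gamma> k)) - Re (left_state h) * Re (right_state k)" for h k
  fix x :: 'a and y :: 'b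
  define h1 h2 k1 k2 where "h1 = real_part x" and "h2 = imag_part x" and "k1 = real_part y" and "k2 = imag_part y"
  have sa: "star h1 = h1" "star h2 = h2" "star k1 = k1" "star k2 = k2"
    by (simp_all add: h1_def h2_def k1_def k2_def)
  have x: "x = h1 + \<i> *\<^sub>C h2" and y: "y = k1 + \<i> *\<^sub>C k2" by (simp_all add: h1_def h2_def k1_def k2_def real_imag_part)
  have D: "S (h \<otimes>\<^sub>\<gamma> k) - P (h \<otimes>\<^sub>\<gamma> k) = complex_of_real (W h k)" if "star h = h" "star k = k" for h k
    using state_selfadjoint_real[OF f that(1)] state_selfadjoint_real[OF g that(2)] that
    by (simp add: S_def Pp W_def star_ptens complex_eq_iff)
  have xy: "x \<otimes>\<^sub>\<gamma> y = h1 \<otimes>\<^sub>\<gamma> k1 - h2 \<otimes>\<^sub>\<gamma> k2 + \<i> *\<^sub>C (h1 \<otimes>\<^sub>\<gamma> k2 + h2 \<otimes>\<^sub>\<gamma> k1)"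
    by (simp add: x y ptens_add_left ptens_add_right ptens_scaleC_left ptens_scaleC_right scaleC_add_right scaleC_scaleC scaleC_minus_one)
  have SP: "S (x \<otimes>\<^sub>\<gamma> y) - P (x \<otimes>\<^sub>\<gamma> y)
      = W h1 k1 - W h2 k2 + \<i> * (W h1 k2 + W h2 k1)"
    unfolding xy bounded_clinear_add[OF Sb] bounded_clinear_add[OF Pb] bounded_clinear_diff[OF Sb] bounded_clinear_diff[OF Pb]
      bounded_clinear_scaleC[OF Sb] bounded_clinear_scaleC[OF Pb]
    using D[OF sa(1,3)] D[OF sa(2,4)] D[OF sa(1,4)] D[OF sa(2,3)] by (simp add: algebra_simps)
  define \<sigma> where "\<sigma> h = sqrt (state_variance left_state h)" for h
  define \<tau> where "\<tau> k = sqrt (state_variance right_state k)" for k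
  have Wb: "\<bar>W h k\<bar> \<le> \<sigma> h * \<tau> k" if "star h = h" "star k = k" for h k
    using covariance_bound[OF that] real_sqrt_le_mono[of "(W h k)\<^sup>2"]
    by (simp add: W_def \<sigma>_def \<tau>_def flip: real_sqrt_mult)
  have "cmod (S (x \<otimes>\<^sub>\<gamma> y) - P (x \<otimes>\<^sub>\<gamma> y)) \<le> \<bar>W h1 k1\<bar> + \<bar>W h2 k2\<bar> + (\<bar>W h1 k2\<bar> + \<bar>W h2 k1\<bar>)"
    unfolding SP
    by (rule order.trans[OF norm_triangle_ineq])
      (use abs_triangle_ineq4[of "W h1 k1" "W h2 k2"] abs_triangle_ineq[of "W h1 k2" "W h2 k1"] in
        \<open>simp add: norm_mult del: of_real_add of_real_diff\<close>)
  also have "\<dots> \<le> \<sigma> h1 * \<tau> k1 + \<sigma> h2 * \<tau> k2 + (\<sigma> h1 * \<tau> k2 + \<sigma> h2 * \<tau> k1)"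
    by (intro add_mono Wb sa)
  finally have dev: "cmod (S (x \<otimes>\<^sub>\<gamma> y) - P (x \<otimes>\<^sub>\<gamma> y)) \<le> (\<sigma> h1 + \<sigma> h2) * (\<tau> k1 + \<tau> k2)"
    by (simp add: algebra_simps)
  define s where "s = sqrt ((\<sigma> h1)\<^sup>2 + (\<sigma> h2)\<^sup>2)"
  define t where "t = sqrt ((\<tau> k1)\<^sup>2 + (\<tau> k2)\<^sup>2)"
  have two: "a + b \<le> sqrt 2 * sqrt (a\<^sup>2 + b\<^sup>2)" for a b :: real
  proof -
    have "(a + b)\<^sup>2 \<le> 2 * (a\<^sup>2 + b\<^sup>2)" using zero_le_power2[of "a - b"] by (simp add: power2_eq_square algebra_simps)
    from real_le_rsqrt[OF this] show ?thesis by (simp only: real_sqrt_mult)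
  qed
  have nonneg: "\<sigma> h1 \<ge> 0" "\<sigma> h2 \<ge> 0" "\<tau> k1 \<ge> 0" "\<tau> k2 \<ge> 0"
    using state_variance_nonneg[OF f] state_variance_nonneg[OF g] sa by (simp_all add: \<sigma>_def \<tau>_def)
  have "(\<sigma> h1 + \<sigma> h2) * (\<tau> k1 + \<tau> k2) \<le> (sqrt 2 * s) * (sqrt 2 * t)"
    unfolding s_def t_def by (intro mult_mono two) (use nonneg in auto)
  also have "\<dots> = 2 * (s * t)" by simp
  finally have dev2: "cmod (S (x \<otimes>\<^sub>\<gamma> y) - P (x \<otimes>\<^sub>\<gamma> y)) \<le> 2 * (s * t)" using dev by simp
  have ss: "(cmod (left_state x))\<^sup>2 + s\<^sup>2 \<le> (norm x)\<^sup>2"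
    using state_variance_parts[OF f, of x] state_variance_nonneg[OF f sa(1)] state_variance_nonneg[OF f sa(2)]
    by (simp add: s_def \<sigma>_def h1_def h2_def)
  have tt: "(cmod (right_state y))\<^sup>2 + t\<^sup>2 \<le> (norm y)\<^sup>2"
    using state_variance_parts[OF g, of y] state_variance_nonneg[OF g sa(3)] state_variance_nonneg[OF g sa(4)]
    by (simp add: t_def \<tau>_def k1_def k2_def)
  have "(1 - \<zeta>) *\<^sub>C P (x \<otimes>\<^sub>\<gamma> y) + \<zeta> *\<^sub>C S (x \<otimes>\<^sub>\<gamma> y)
      = left_state x * right_state y + \<zeta> * (S (x \<otimes>\<^sub>\<gamma> y) - P (x \<otimes>\<^sub>\<gamma> y))"
    by (simp add: Pp algebra_simps)
  also have "cmod \<dots> \<le> cmod (left_state x) * cmod (right_state y) + cmod \<zeta> * cmod (S (x \<otimes>\<^sub>\<gamma> y) - P (x \<otimes>\<^sub>\<gamma> y))"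
    by (rule order.trans[OF norm_triangle_ineq]) (simp add: norm_mult)
  also have "\<dots> \<le> cmod (left_state x) * cmod (right_state y) + (1/2) * (2 * (s * t))"
    by (intro add_left_mono mult_mono \<zeta> dev2) auto
  also have "\<dots> \<le> norm x * norm y"
    using real_cauchy_schwarz_2[OF ss tt] by simp
  finally show "cmod ((1 - \<zeta>) *\<^sub>C P (x \<otimes>\<^sub>\<gamma> y) + \<zeta> *\<^sub>C S (x \<otimes>\<^sub>\<gamma> y)) \<le> norm x * norm y" .
qed

text \<open>The state of the preceding lemma with \<open>\<zeta> = i / 2\<close> must be real at \<open>k\<close>, as must \<open>\<Phi>\<close> and the product state.\<close>

lemma hermitian_state_is_product:
  assumes k: "hermitian k" "star k = k"
  shows "\<Phi> k = product_functional left_state right_state k"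
proof -
  let ?P = "product_functional left_state right_state k"
  have 0: "Im ?P = 0"
    using hermitian_state_real[OF k(1) covariance_perturbation_state[of 0]] by (simp add: scaleC_one)
  have r: "Im (\<Phi> k) = 0" by (rule hermitian_state_real[OF k(1) \<Phi>])
  have "Im ((1 - \<i> / 2) * ?P + (\<i> / 2) * ((1/2) * \<Phi> k + (1/2) * cnj (\<Phi> k))) = 0"
    using hermitian_state_real[OF k(1) covariance_perturbation_state[of "\<i> / 2"]] k(2) by (simp add: norm_divide)
  then show ?thesis using 0 r by (simp add: complex_eq_iff)
qed

end

text \<open>With \<open>s, s'\<close> the means and \<open>d, d'\<close> half the differences of the given states, \<open>s \<otimes> s' + \<zeta> d \<otimes> d'\<close> is a state for
\<open>|\<zeta>| \<le> 1\<close>, by the parallelogram law. Its reality at \<open>k\<close> for \<open>\<zeta> = 1\<close> and \<open>\<zeta> = i\<close> forces \<open>(d \<otimes> d') k = 0\<close>.\<close>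

lemma hermitian_product_difference:
  fixes k :: "('a::unital_cstar_algebra, 'b::unital_cstar_algebra) ptensor"
  assumes k: "hermitian k" and p: "state p" "state p'" and q: "state q" "state q'"
  shows "product_functional (\<lambda>x. p x - p' x) (\<lambda>y. q y - q' y) k = 0"
proof -
  define s d where "s x = (1/2) *\<^sub>C p x + (1/2) *\<^sub>C p' x" and "d x = (1/2) *\<^sub>C p x + (- 1/2) *\<^sub>C p' x" for x
  define s' d' where "s' y = (1/2) *\<^sub>C q y + (1/2) *\<^sub>C q' y" and "d' y = (1/2) *\<^sub>C q y + (- 1/2) *\<^sub>C q' y" for y
  note pb = state_bounded_clinear[OF p(1)] state_bounded_clinear[OF p(2)]
  note qb = state_bounded_clinear[OF q(1)] state_bounded_clinear[OF q(2)]
  have b: "bounded_clinear s" "bounded_clinear d" "bounded_clinear s'" "bounded_clinear d'"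
    unfolding s_def d_def s'_def d'_def by (intro bounded_clinear_combine pb qb)+
  have parallelogram: "(cmod ((1/2) * a + (1/2) * c))\<^sup>2 + (cmod ((1/2) * a + (- 1/2) * c))\<^sup>2 \<le> n\<^sup>2"
    if "cmod a \<le> n" "cmod c \<le> n" for a c n
  proof -
    have "(cmod ((1/2) * a + (1/2) * c))\<^sup>2 + (cmod ((1/2) * a + (- 1/2) * c))\<^sup>2 = ((cmod a)\<^sup>2 + (cmod c)\<^sup>2) / 2"
      unfolding cmod_power2 by (simp add: power2_eq_square) (simp add: field_simps)
    also have "\<dots> \<le> n\<^sup>2" using power_mono[OF that(1), of 2] power_mono[OF that(2), of 2] by simp
    finally show ?thesis .
  qed
  have sd: "(cmod (s x))\<^sup>2 + (cmod (d x))\<^sup>2 \<le> (norm x)\<^sup>2" for x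
    using parallelogram[OF state_bound[OF p(1)] state_bound[OF p(2)]] by (simp add: s_def d_def)
  have sd': "(cmod (s' y))\<^sup>2 + (cmod (d' y))\<^sup>2 \<le> (norm y)\<^sup>2" for y
    using parallelogram[OF state_bound[OF q(1)] state_bound[OF q(2)]] by (simp add: s'_def d'_def)
  have st: "state (\<lambda>z. 1 *\<^sub>C product_functional s s' z + \<zeta> *\<^sub>C product_functional d d' z)" if z: "cmod \<zeta> \<le> 1" for \<zeta>
  proof (rule state_ptensorI)
    show "bounded_clinear (\<lambda>z. 1 *\<^sub>C product_functional s s' z + \<zeta> *\<^sub>C product_functional d d' z)"
      by (intro bounded_clinear_combine bounded_clinear_product_functional b)
    show "1 *\<^sub>C product_functional s s' (1 \<otimes>\<^sub>\<gamma> 1) + \<zeta> *\<^sub>C product_functional d d' (1 \<otimes>\<^sub>\<gamma> 1) = 1"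
      by (simp add: product_functional_pure b s_def d_def s'_def d'_def state_one p q)
    fix x y
    have "cmod (1 *\<^sub>C product_functional s s' (x \<otimes>\<^sub>\<gamma> y) + \<zeta> *\<^sub>C product_functional d d' (x \<otimes>\<^sub>\<gamma> y))
        \<le> cmod (s x) * cmod (s' y) + cmod \<zeta> * (cmod (d x) * cmod (d' y))"
      by (rule order.trans[OF norm_triangle_ineq]) (simp add: product_functional_pure b norm_mult)
    also have "\<dots> \<le> cmod (s x) * cmod (s' y) + 1 * (cmod (d x) * cmod (d' y))"
      using z by (intro add_left_mono mult_right_mono) auto
    also have "\<dots> \<le> norm x * norm y" using real_cauchy_schwarz_2[OF sd sd'] by simp
    finally show "cmod (1 *\<^sub>C product_functional s s' (x \<otimes>\<^sub>\<gamma> y) + \<zeta> *\<^sub>C product_functional d d' (x \<otimes>\<^sub>\<gamma> y)) \<le> norm x * norm y" .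
  qed
  have "Im (product_functional s s' k) = 0" using hermitian_state_real[OF k st[of 0]] by simp
  then have "product_functional d d' k = 0"
    using hermitian_state_real[OF k st[of 1]] hermitian_state_real[OF k st[of \<i>]] by (simp add: complex_eq_iff)
  moreover have "product_functional d d' z = (1/4) * product_functional (\<lambda>x. p x - p' x) (\<lambda>y. q y - q' y) z" for z
  proof -
    have db: "bounded_clinear (\<lambda>x. p x - p' x)" "bounded_clinear (\<lambda>y. q y - q' y)"
      using bounded_clinear_combine[OF pb, of 1 "- 1"] bounded_clinear_combine[OF qb, of 1 "- 1"] by simp_all
    have e: "bounded_clinear (\<lambda>z. (1/4) * product_functional (\<lambda>x. p x - p' x) (\<lambda>y. q y - q' y) z)"
      using bounded_clinear_combine[OF bounded_clinear_product_functional[OF db] bounded_clinear_product_functional[OF db], of "1/4" 0] by simp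
    show ?thesis
      by (rule ptensor_eqI[OF bounded_clinear_product_functional[OF b(2,4)] e])
        (simp add: product_functional_pure b db, simp add: d_def d'_def field_simps)
  qed
  ultimately show ?thesis by simp
qed

text \<open>The theorem of Kaijser and Sinclair. Fix states \<open>p, q\<close> and subtract from \<open>k\<close> its two slices. On the
difference every state \<open>\<Phi>\<close> of the tensor product with marginals \<open>f, g\<close> takes the value
\<open>((f - p) \<otimes> (g - q)) k\<close>, which is zero.\<close>

theorem hermitian_decomposition:
  fixes k :: "('a::unital_cstar_algebra, 'b::unital_cstar_algebra) ptensor"
  assumes k: "hermitian k" "star k = k"
  shows "\<exists>a b. k = a \<otimes>\<^sub>\<gamma> 1 + 1 \<otimes>\<^sub>\<gamma> b"
proof -
  obtain p :: "'a \<Rightarrow> complex" where p: "state p" using central_state_exists by blast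
  obtain q :: "'b \<Rightarrow> complex" where q: "state q" using central_state_exists by blast
  note pb = state_bounded_clinear[OF p] and qb = state_bounded_clinear[OF q]
  define r l c where "r = slice_right q k" and "l = slice_left p k" and "c = p r"
  define k' where "k' = k - (r \<otimes>\<^sub>\<gamma> 1 + 1 \<otimes>\<^sub>\<gamma> (l - c *\<^sub>C 1))"
  have "k' = 0"
  proof (rule numerical_range_zero_imp_zero)
    fix \<Phi> :: "('a, 'b) ptensor \<Rightarrow> complex" assume \<Phi>: "state \<Phi>"
    define f g where "f = (\<lambda>x. \<Phi> (x \<otimes>\<^sub>\<gamma> 1))" and "g = (\<lambda>y. \<Phi> (1 \<otimes>\<^sub>\<gamma> y))"
    have f: "state f" and g: "state g" unfolding f_def g_def by (rule state_ptens_left[OF \<Phi>])+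
    note fb = state_bounded_clinear[OF f] and gb = state_bounded_clinear[OF g]
    have "\<Phi> k' = \<Phi> k - f r - (g l - c)"
      using clinear_diff[OF state_clinear[OF g], of l "c *\<^sub>C 1"]
      by (simp add: k'_def f_def[symmetric] clinear_diff[OF state_clinear[OF \<Phi>]] clinear_add[OF state_clinear[OF \<Phi>]]
          clinear_scaleC[OF state_clinear[OF g]] state_one[OF g] flip: f_def g_def) (simp add: f_def g_def)
    also have "\<Phi> k = f (slice_right g k)"
      using hermitian_state_is_product[OF \<Phi> k] by (simp add: product_functional_def f_def g_def)
    also have "g l = p (slice_right g k)" unfolding l_def by (rule slice_swap[OF gb pb, symmetric])
    finally have 1: "\<Phi> k' = f (slice_right g k) - f r - p (slice_right g k) + p r" by (simp add: c_def)
    have "slice_right (\<lambda>y. g y - q y) k = slice_right g k - r"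
    proof -
      have b: "bounded_clinear (\<lambda>y. g y - q y)" using bounded_clinear_combine[OF gb qb, of 1 "- 1"] by simp
      have b2: "bounded_clinear (\<lambda>z. slice_right g z - slice_right q z :: 'a)"
        using bounded_clinear_combine[OF bounded_clinear_slice_right[OF gb] bounded_clinear_slice_right[OF qb], of 1 "- 1"]
        by (simp add: scaleC_one scaleC_minus_one)
      show ?thesis
        unfolding r_def
        by (rule ptensor_eqI[OF bounded_clinear_slice_right[OF b] b2])
          (simp add: slice_right_pure[OF b] slice_right_pure[OF gb] slice_right_pure[OF qb]
            complex_vector.scale_left_diff_distrib)
    qed
    then have "\<Phi> k' = product_functional (\<lambda>x. f x - p x) (\<lambda>y. g y - q y) k"
      by (simp add: 1 product_functional_def bounded_clinear_diff[OF fb] bounded_clinear_diff[OF pb])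
    also have "\<dots> = 0" by (rule hermitian_product_difference[OF k(1) f p g q])
    finally show "\<Phi> k' = 0" .
  qed
  then show ?thesis unfolding k'_def by (metis eq_iff_diff_eq_0)
qed

section \<open>Isometric automorphisms and the two tensor factors\<close>

lemma nonscalar_functional:
  fixes x :: "'a::unital_cstar_algebra"
  assumes "\<nexists>c. x = c *\<^sub>C 1"
  shows "\<exists>f :: 'a \<Rightarrow> complex. bounded_clinear f \<and> f 1 = 0 \<and> f x \<noteq> 0"
proof -
  obtain p :: "'a \<Rightarrow> complex" where p: "state p" using central_state_exists by blast
  have "x - p x *\<^sub>C 1 \<noteq> 0" using assms by (metis eq_iff_diff_eq_0)
  then obtain G :: "'a \<Rightarrow> complex" where G: "clinear G" "\<And>v. cmod (G v) \<le> norm v"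
    "G (x - p x *\<^sub>C 1) = norm (x - p x *\<^sub>C 1)"
    using norming_functional by blast
  have Gb: "bounded_clinear G" using G by (intro bounded_clinearI[of G 1]) simp_all
  have "bounded_clinear (\<lambda>v. 1 *\<^sub>C G v + (- G 1) *\<^sub>C p v)"
    by (rule bounded_clinear_combine[OF Gb state_bounded_clinear[OF p]])
  then have "bounded_clinear (\<lambda>v. G v - G 1 * p v)" by simp
  moreover have "G x - G 1 * p x \<noteq> 0"
    using G(3) \<open>x - p x *\<^sub>C 1 \<noteq> 0\<close> by (simp add: clinear_diff[OF G(1)] clinear_scaleC[OF G(1)] mult.commute)
  ultimately show ?thesis using state_one[OF p] by (intro exI[of _ "\<lambda>v. G v - G 1 * p v"]) simp
qed

text \<open>The two legs of the tensor product are the subalgebras \<open>A \<otimes> 1\<close> and \<open>1 \<otimes> B\<close>.\<close>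

definition leg_sums :: "('a::unital_cstar_algebra, 'b::unital_cstar_algebra) ptensor set" where
  "leg_sums = {z. \<exists>x y. z = x \<otimes>\<^sub>\<gamma> 1 + 1 \<otimes>\<^sub>\<gamma> y}"

lemma leg_sums_add: "z \<in> leg_sums \<Longrightarrow> w \<in> leg_sums \<Longrightarrow> z + w \<in> leg_sums"
proof -
  assume "z \<in> leg_sums" "w \<in> leg_sums"
  then obtain x y x' y' where "z = x \<otimes>\<^sub>\<gamma> 1 + 1 \<otimes>\<^sub>\<gamma> y" "w = x' \<otimes>\<^sub>\<gamma> 1 + 1 \<otimes>\<^sub>\<gamma> y'" by (auto simp: leg_sums_def)
  then have "z + w = (x + x') \<otimes>\<^sub>\<gamma> 1 + 1 \<otimes>\<^sub>\<gamma> (y + y')" by (simp add: ptens_add_left ptens_add_right algebra_simps)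
  then show ?thesis by (auto simp: leg_sums_def)
qed

lemma leg_sums_scaleC: "z \<in> leg_sums \<Longrightarrow> c *\<^sub>C z \<in> leg_sums"
proof -
  assume "z \<in> leg_sums"
  then obtain x y where "z = x \<otimes>\<^sub>\<gamma> 1 + 1 \<otimes>\<^sub>\<gamma> y" by (auto simp: leg_sums_def)
  then have "c *\<^sub>C z = (c *\<^sub>C x) \<otimes>\<^sub>\<gamma> 1 + 1 \<otimes>\<^sub>\<gamma> (c *\<^sub>C y)"
    by (simp only: scaleC_add_right ptens_scaleC_left ptens_scaleC_right)
  then show ?thesis by (auto simp: leg_sums_def)
qed

lemma pure_leg_sum_scalar:
  fixes x :: "'a::unital_cstar_algebra" and y :: "'b::unital_cstar_algebra"
  assumes "x \<otimes>\<^sub>\<gamma> y \<in> leg_sums"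
  shows "(\<exists>c. x = c *\<^sub>C 1) \<or> (\<exists>c. y = c *\<^sub>C 1)"
proof (rule ccontr)
  assume no: "\<not> ?thesis"
  obtain a b where ab: "x \<otimes>\<^sub>\<gamma> y = a \<otimes>\<^sub>\<gamma> 1 + 1 \<otimes>\<^sub>\<gamma> b" using assms by (auto simp: leg_sums_def)
  obtain f :: "'a \<Rightarrow> complex" where f: "bounded_clinear f" "f 1 = 0" "f x \<noteq> 0" using nonscalar_functional[of x] no by blast
  obtain g :: "'b \<Rightarrow> complex" where g: "bounded_clinear g" "g 1 = 0" "g y \<noteq> 0" using nonscalar_functional[of y] no by blast
  have "f x * g y = product_functional f g (a \<otimes>\<^sub>\<gamma> 1 + 1 \<otimes>\<^sub>\<gamma> b)"
    by (simp add: product_functional_pure[OF f(1) g(1)] flip: ab)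
  also have "\<dots> = 0"
    by (simp add: bounded_clinear_add[OF bounded_clinear_product_functional[OF f(1) g(1)]]
        product_functional_pure[OF f(1) g(1)] f(2) g(2))
  finally show False using f g by simp
qed

lemma scalar_legs: "(c *\<^sub>C 1) \<otimes>\<^sub>\<gamma> 1 = 1 \<otimes>\<^sub>\<gamma> (c *\<^sub>C 1)"
  by (simp add: ptens_scaleC_left ptens_scaleC_right)

text \<open>The square of \<open>x \<otimes> 1 + 1 \<otimes> y\<close> contains the mixed term \<open>2 x \<otimes> y\<close>, so one of \<open>x, y\<close> is a scalar.\<close>

lemma leg_sum_square_in_leg:
  assumes z: "z \<in> leg_sums" "z * z \<in> leg_sums"
  shows "(\<exists>x. z = x \<otimes>\<^sub>\<gamma> 1) \<or> (\<exists>y. z = 1 \<otimes>\<^sub>\<gamma> y)"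
proof -
  obtain x y where xy: "z = x \<otimes>\<^sub>\<gamma> 1 + 1 \<otimes>\<^sub>\<gamma> y" using z(1) by (auto simp: leg_sums_def)
  have zz: "z * z = ((x * x) \<otimes>\<^sub>\<gamma> 1 + 1 \<otimes>\<^sub>\<gamma> (y * y)) + 2 *\<^sub>C (x \<otimes>\<^sub>\<gamma> y)"
    using scaleC_add_left[of 1 1 "x \<otimes>\<^sub>\<gamma> y"]
    by (simp add: xy distrib_left distrib_right ptens_mult scaleC_one algebra_simps)
  have "x \<otimes>\<^sub>\<gamma> y = (1/2) *\<^sub>C (z * z + (- 1) *\<^sub>C ((x * x) \<otimes>\<^sub>\<gamma> 1 + 1 \<otimes>\<^sub>\<gamma> (y * y)))"
    unfolding zz by (simp add: scaleC_minus_left scaleC_one scaleC_scaleC)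
  also have "\<dots> \<in> leg_sums"
  proof (intro leg_sums_scaleC leg_sums_add[OF z(2)])
    show "(x * x) \<otimes>\<^sub>\<gamma> 1 + 1 \<otimes>\<^sub>\<gamma> (y * y) \<in> leg_sums" by (auto simp: leg_sums_def)
  qed
  finally have "(\<exists>c. x = c *\<^sub>C 1) \<or> (\<exists>c. y = c *\<^sub>C 1)" by (rule pure_leg_sum_scalar)
  then show ?thesis
  proof
    assume "\<exists>c. x = c *\<^sub>C 1"
    then obtain c where "x = c *\<^sub>C 1" by blast
    then have "z = 1 \<otimes>\<^sub>\<gamma> (c *\<^sub>C 1 + y)" by (simp add: xy scalar_legs ptens_add_right)
    then show ?thesis by blast
  next
    assume "\<exists>c. y = c *\<^sub>C 1"
    then obtain c where "y = c *\<^sub>C 1" by blast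
    then have "z = (x + c *\<^sub>C 1) \<otimes>\<^sub>\<gamma> 1" by (simp add: xy ptens_add_left flip: scalar_legs)
    then show ?thesis by blast
  qed
qed

lemma ptens_left_inj: "x \<otimes>\<^sub>\<gamma> (1::'b::unital_cstar_algebra) = x' \<otimes>\<^sub>\<gamma> 1 \<Longrightarrow> x = (x'::'a::unital_cstar_algebra)"
  using ptens_eq_0_imp[of "x - x'" "1::'b"] by (simp add: ptens_diff)

lemma ptens_right_inj: "(1::'a::unital_cstar_algebra) \<otimes>\<^sub>\<gamma> y = 1 \<otimes>\<^sub>\<gamma> y' \<Longrightarrow> y = (y'::'b::unital_cstar_algebra)"
  using ptens_eq_0_imp[of "1::'a" "y - y'"] by (simp add: ptens_diff)

lemma legs_meet_in_scalars:
  fixes x :: "'a::unital_cstar_algebra" and y :: "'b::unital_cstar_algebra"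
  assumes "x \<otimes>\<^sub>\<gamma> 1 = 1 \<otimes>\<^sub>\<gamma> y"
  shows "\<exists>c. x = c *\<^sub>C 1 \<and> y = c *\<^sub>C 1"
proof -
  obtain q :: "'b \<Rightarrow> complex" where q: "state q" using central_state_exists by blast
  note qb = state_bounded_clinear[OF q]
  have x: "x = q y *\<^sub>C 1"
    using arg_cong[OF assms, of "slice_right q"] by (simp add: slice_right_pure[OF qb] state_one[OF q] scaleC_one)
  have "1 \<otimes>\<^sub>\<gamma> y = (1::'a) \<otimes>\<^sub>\<gamma> (q y *\<^sub>C 1)" using assms by (simp add: x scalar_legs)
  then show ?thesis using x ptens_right_inj by blast
qed

lemma hermitian_bound:
  fixes h :: "'a::unital_cstar_algebra"
  assumes "star h = h"
  shows "norm (1 + t *\<^sub>R (\<i> *\<^sub>C h)) \<le> 1 + (norm h)\<^sup>2 * t\<^sup>2"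
proof (rule power2_le_imp_le)
  have "star (1 + t *\<^sub>R (\<i> *\<^sub>C h)) * (1 + t *\<^sub>R (\<i> *\<^sub>C h)) = 1 + t\<^sup>2 *\<^sub>R (h * h)"
    by (simp add: star_add star_scaleR star_scaleC assms scaleC_minus_left algebra_simps mult_scaleC_left mult_scaleC_right
        scaleC_scaleR scaleC_scaleC scaleC_one power2_eq_square)
  then have "(norm (1 + t *\<^sub>R (\<i> *\<^sub>C h)))\<^sup>2 \<le> 1 + t\<^sup>2 * norm (h * h)"
    unfolding norm_star_mult_self[symmetric] using norm_triangle_ineq[of 1 "t\<^sup>2 *\<^sub>R (h * h)"] by simp
  also have "\<dots> \<le> (1 + (norm h)\<^sup>2 * t\<^sup>2)\<^sup>2"
    using zero_le_power2[of "(norm h)\<^sup>2 * t\<^sup>2"]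
    by (simp add: norm_selfadjoint_square[OF assms] power2_sum mult.commute)
  finally show "(norm (1 + t *\<^sub>R (\<i> *\<^sub>C h)))\<^sup>2 \<le> (1 + (norm h)\<^sup>2 * t\<^sup>2)\<^sup>2" .
qed simp

text \<open>Self-adjoint elements are Hermitian in the C*-algebra, and a contraction preserves this.\<close>

lemma isometric_embedding_in_leg_sums:
  fixes j :: "'c::unital_cstar_algebra \<Rightarrow> ('a::unital_cstar_algebra, 'b::unital_cstar_algebra) ptensor"
  assumes j: "clinear j" "j 1 = 1" "\<And>x. j (star x) = star (j x)" "\<And>x. norm (j x) \<le> norm x"
  shows "j x \<in> leg_sums"
proof -
  have sa: "j h \<in> leg_sums" if h: "star h = h" for h
  proof -
    have "norm (1 + t *\<^sub>R (\<i> *\<^sub>C j h)) \<le> 1 + (norm h)\<^sup>2 * t\<^sup>2" for t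
    proof -
      have "1 + t *\<^sub>R (\<i> *\<^sub>C j h) = j (1 + t *\<^sub>R (\<i> *\<^sub>C h))"
        by (simp add: clinear_add[OF j(1)] clinear_scaleR[OF j(1)] clinear_scaleC[OF j(1)] j(2))
      then show ?thesis using j(4) hermitian_bound[OF h] order_trans by metis
    qed
    then have "hermitian (j h)" unfolding hermitian_def by blast
    then show ?thesis unfolding leg_sums_def using hermitian_decomposition[of "j h"] j(3)[of h] h by simp
  qed
  have "j x = j (real_part x) + \<i> *\<^sub>C j (imag_part x)"
    by (subst real_imag_part[of x, symmetric]) (simp only: clinear_add[OF j(1)] clinear_scaleC[OF j(1)])
  then show ?thesis using leg_sums_add[OF sa leg_sums_scaleC[OF sa]] by simp
qed

text \<open>The second statement follows from the first because a group is not the union of two proper subgroups.\<close>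

lemma embedding_in_leg:
  fixes j :: "'c::unital_cstar_algebra \<Rightarrow> ('a::unital_cstar_algebra, 'b::unital_cstar_algebra) ptensor"
  assumes j: "clinear j" "j 1 = 1" "\<And>x. j (star x) = star (j x)" "\<And>x. norm (j x) \<le> norm x"
    and mult: "\<And>x y. j (x * y) = j x * j y"
  shows embedding_in_leg_pointwise: "(\<exists>x. j c = x \<otimes>\<^sub>\<gamma> 1) \<or> (\<exists>y. j c = 1 \<otimes>\<^sub>\<gamma> y)"
    and embedding_in_leg_uniform: "(\<forall>c. \<exists>x. j c = x \<otimes>\<^sub>\<gamma> 1) \<or> (\<forall>c. \<exists>y. j c = 1 \<otimes>\<^sub>\<gamma> y)"
proof -
  have pt: "(\<exists>x. j c = x \<otimes>\<^sub>\<gamma> 1) \<or> (\<exists>y. j c = 1 \<otimes>\<^sub>\<gamma> y)" for c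
    using leg_sum_square_in_leg[OF isometric_embedding_in_leg_sums[OF j, of c]]
      isometric_embedding_in_leg_sums[OF j, of "c * c"] by (simp only: mult)
  then show "(\<exists>x. j c = x \<otimes>\<^sub>\<gamma> 1) \<or> (\<exists>y. j c = 1 \<otimes>\<^sub>\<gamma> y)" .
  show "(\<forall>c. \<exists>x. j c = x \<otimes>\<^sub>\<gamma> 1) \<or> (\<forall>c. \<exists>y. j c = 1 \<otimes>\<^sub>\<gamma> y)"
  proof (rule ccontr)
    assume "\<not> ?thesis"
    then obtain a b where a: "\<nexists>x. j a = x \<otimes>\<^sub>\<gamma> 1" and b: "\<nexists>y. j b = 1 \<otimes>\<^sub>\<gamma> y" by blast
    obtain y where y: "j a = 1 \<otimes>\<^sub>\<gamma> y" using pt[of a] a by blast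
    obtain x where x: "j b = x \<otimes>\<^sub>\<gamma> 1" using pt[of b] b by blast
    from pt[of "a + b"] show False
    proof
      assume "\<exists>x. j (a + b) = x \<otimes>\<^sub>\<gamma> 1"
      then obtain z where "j (a + b) = z \<otimes>\<^sub>\<gamma> 1" by blast
      then have "j a = (z - x) \<otimes>\<^sub>\<gamma> 1"
        using clinear_add[OF j(1), of a b] x by (simp add: ptens_diff eq_diff_eq)
      then show False using a by blast
    next
      assume "\<exists>y. j (a + b) = 1 \<otimes>\<^sub>\<gamma> y"
      then obtain z where "j (a + b) = 1 \<otimes>\<^sub>\<gamma> z" by blast
      then have "j b = 1 \<otimes>\<^sub>\<gamma> (z - y)"
        using clinear_add[OF j(1), of a b] y by (simp add: ptens_diff eq_diff_eq add.commute)
      then show False using b by blast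
    qed
  qed
qed

lemma star_isomorphism_of_intertwining:
  fixes \<theta> :: "'e::unital_star_algebra \<Rightarrow> 'g::unital_star_algebra"
    and i :: "'d::unital_star_algebra \<Rightarrow> 'g" and j :: "'c::unital_star_algebra \<Rightarrow> 'e"
  assumes \<theta>: "star_isomorphism \<theta>"
    and i: "clinear i" "\<And>x y. i (x * y) = i x * i y" "\<And>x. i (star x) = star (i x)" "inj i"
    and j: "clinear j" "\<And>x y. j (x * y) = j x * j y" "\<And>x. j (star x) = star (j x)" "inj j"
    and \<phi>: "\<And>c. \<theta> (j c) = i (\<phi> c)" "surj \<phi>"
  shows "star_isomorphism \<phi>"
proof -
  note t = clinear_add[OF star_isomorphism_clinear[OF \<theta>]] clinear_scaleC[OF star_isomorphism_clinear[OF \<theta>]]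
    star_isomorphism_mult[OF \<theta>] star_isomorphism_star[OF \<theta>]
  have ci: "x = y" if "i x = i y" for x y using injD[OF i(4) that] .
  have "inj \<phi>"
  proof (rule injI)
    fix x y assume "\<phi> x = \<phi> y"
    then have "\<theta> (j x) = \<theta> (j y)" by (simp add: \<phi>(1))
    then have "j x = j y" using injD[OF bij_is_inj[OF star_isomorphism_bij[OF \<theta>]]] by blast
    then show "x = y" using injD[OF j(4)] by blast
  qed
  moreover have "\<phi> (x + y) = \<phi> x + \<phi> y" for x y
    by (rule ci) (simp add: \<phi>(1)[symmetric] clinear_add[OF i(1)] clinear_add[OF j(1)] t)
  moreover have "\<phi> (c *\<^sub>C x) = c *\<^sub>C \<phi> x" for c x
    by (rule ci) (simp add: \<phi>(1)[symmetric] clinear_scaleC[OF i(1)] clinear_scaleC[OF j(1)] t)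
  moreover have "\<phi> (x * y) = \<phi> x * \<phi> y" for x y
    by (rule ci) (simp add: \<phi>(1)[symmetric] i(2) j(2) t)
  moreover have "\<phi> (star x) = star (\<phi> x)" for x
    by (rule ci) (simp add: \<phi>(1)[symmetric] i(3) j(3) t)
  ultimately show ?thesis using \<phi>(2) by (simp add: star_isomorphism_def clinear_def bij_def)
qed

lemma ptens_left_hom:
  "clinear (\<lambda>x. x \<otimes>\<^sub>\<gamma> 1)" "(x * y) \<otimes>\<^sub>\<gamma> 1 = (x \<otimes>\<^sub>\<gamma> 1) * (y \<otimes>\<^sub>\<gamma> (1::'b::unital_cstar_algebra))"
  "star x \<otimes>\<^sub>\<gamma> 1 = star (x \<otimes>\<^sub>\<gamma> (1::'b))" "inj (\<lambda>x :: 'a::unital_cstar_algebra. x \<otimes>\<^sub>\<gamma> (1::'b))"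
  using bounded_clinear_clinear[OF bounded_clinear_ptens_left]
  by (auto simp: ptens_mult star_ptens intro: injI dest: ptens_left_inj)

lemma ptens_right_hom:
  "clinear (\<lambda>y. 1 \<otimes>\<^sub>\<gamma> y)" "1 \<otimes>\<^sub>\<gamma> (x * y) = (1 \<otimes>\<^sub>\<gamma> x) * ((1::'a::unital_cstar_algebra) \<otimes>\<^sub>\<gamma> y)"
  "1 \<otimes>\<^sub>\<gamma> star y = star ((1::'a) \<otimes>\<^sub>\<gamma> y)" "inj (\<lambda>y :: 'b::unital_cstar_algebra. (1::'a) \<otimes>\<^sub>\<gamma> y)"
  using bounded_clinear_clinear[OF bounded_clinear_ptens_right]
  by (auto simp: ptens_mult star_ptens intro: injI dest: ptens_right_inj)

lemma multiplicative_on_ptensor: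
  fixes h :: "('a::unital_cstar_algebra, 'b::unital_cstar_algebra) ptensor \<Rightarrow> 'e::unital_banach_star_algebra"
  assumes h: "bounded_clinear h"
    and mult: "\<And>x y x' y'. h ((x * x') \<otimes>\<^sub>\<gamma> (y * y')) = h (x \<otimes>\<^sub>\<gamma> y) * h (x' \<otimes>\<^sub>\<gamma> y')"
  shows "h (z * w) = h z * h w"
proof -
  have 1: "h ((x \<otimes>\<^sub>\<gamma> y) * w) = h (x \<otimes>\<^sub>\<gamma> y) * h w" for x y w
    by (rule ptensor_eqI[of "\<lambda>w. h ((x \<otimes>\<^sub>\<gamma> y) * w)" "\<lambda>w. h (x \<otimes>\<^sub>\<gamma> y) * h w"])
      (simp_all add: bounded_clinear_compose[OF h bounded_clinear_mult_left] bounded_clinear_compose[OF bounded_clinear_mult_left h] ptens_mult mult)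
  show ?thesis
    by (rule ptensor_eqI[of "\<lambda>z. h (z * w)" "\<lambda>z. h z * h w"])
      (simp_all add: bounded_clinear_compose[OF h bounded_clinear_mult_right] bounded_clinear_compose[OF bounded_clinear_mult_right h] 1)
qed

lemma star_preserving_on_ptensor:
  fixes h :: "('a::unital_cstar_algebra, 'b::unital_cstar_algebra) ptensor \<Rightarrow> 'e::unital_banach_star_algebra"
  assumes h: "bounded_clinear h" and st: "\<And>x y. h (star x \<otimes>\<^sub>\<gamma> star y) = star (h (x \<otimes>\<^sub>\<gamma> y))"
  shows "h (star z) = star (h z)"
proof -
  have "star (h (star z)) = h z"
    by (rule ptensor_eqI[OF bounded_clinear_star_conj[OF h] h]) (simp add: star_ptens st star_star)
  then show ?thesis by (metis star_star)
qed

lemma flip_star_isomorphism: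
  "star_isomorphism (flip :: ('a::unital_cstar_algebra, 'b::unital_cstar_algebra) ptensor \<Rightarrow> ('b, 'a) ptensor)"
  and norm_flip: "norm (flip z :: ('b, 'a) ptensor) = norm (z :: ('a, 'b) ptensor)"
proof -
  have "bij (flip :: ('a, 'b) ptensor \<Rightarrow> ('b, 'a) ptensor)"
    by (rule o_bij[of flip]) (auto simp: flip_flip)
  moreover have "flip (z * w) = flip z * (flip w :: ('b, 'a) ptensor)" for z w :: "('a, 'b) ptensor"
    by (rule multiplicative_on_ptensor[OF bounded_clinear_flip]) (simp add: flip(3) ptens_mult)
  moreover have "flip (star z) = star (flip z :: ('b, 'a) ptensor)" for z :: "('a, 'b) ptensor"
    by (rule star_preserving_on_ptensor[OF bounded_clinear_flip]) (simp add: flip(3) star_ptens)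
  ultimately show "star_isomorphism (flip :: ('a, 'b) ptensor \<Rightarrow> ('b, 'a) ptensor)"
    by (simp add: star_isomorphism_def flip(1))
  show "norm (flip z :: ('b, 'a) ptensor) = norm (z :: ('a, 'b) ptensor)"
    using norm_flip_le[of z] norm_flip_le[of "flip z :: ('b, 'a) ptensor"] by (simp add: flip_flip)
qed

lemma star_isomorphism_compose:
  "star_isomorphism f \<Longrightarrow> star_isomorphism g \<Longrightarrow> star_isomorphism (f \<circ> g)"
  by (auto simp: star_isomorphism_def clinear_def bij_comp)

context
  fixes \<theta> :: "('a::unital_cstar_algebra, 'b::unital_cstar_algebra) ptensor \<Rightarrow> ('c::unital_cstar_algebra, 'd::unital_cstar_algebra) ptensor"
  assumes \<theta>: "star_isomorphism \<theta>" and iso: "\<And>z. norm (\<theta> z) = norm z"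
begin

lemma isometric_isomorphism_bounded: "bounded_clinear \<theta>"
  by (rule bounded_clinearI[OF star_isomorphism_clinear[OF \<theta>], of 1]) (simp add: iso)

lemma isomorphism_leg_hom:
  "clinear (\<lambda>x. \<theta> (x \<otimes>\<^sub>\<gamma> 1))" "\<theta> (1 \<otimes>\<^sub>\<gamma> 1) = 1" "\<theta> (star x \<otimes>\<^sub>\<gamma> 1) = star (\<theta> (x \<otimes>\<^sub>\<gamma> 1))"
  "norm (\<theta> (x \<otimes>\<^sub>\<gamma> 1)) \<le> norm x" "\<theta> ((x * x') \<otimes>\<^sub>\<gamma> 1) = \<theta> (x \<otimes>\<^sub>\<gamma> 1) * \<theta> (x' \<otimes>\<^sub>\<gamma> 1)"
  "clinear (\<lambda>y. \<theta> (1 \<otimes>\<^sub>\<gamma> y))" "\<theta> (1 \<otimes>\<^sub>\<gamma> star y) = star (\<theta> (1 \<otimes>\<^sub>\<gamma> y))"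
  "norm (\<theta> (1 \<otimes>\<^sub>\<gamma> y)) \<le> norm y" "\<theta> (1 \<otimes>\<^sub>\<gamma> (y * y')) = \<theta> (1 \<otimes>\<^sub>\<gamma> y) * \<theta> (1 \<otimes>\<^sub>\<gamma> y')"
  using bounded_clinear_clinear[OF bounded_clinear_compose[OF isometric_isomorphism_bounded bounded_clinear_ptens_left]]
    bounded_clinear_clinear[OF bounded_clinear_compose[OF isometric_isomorphism_bounded bounded_clinear_ptens_right]]
    norm_ptens_le[of x "1::'b"] norm_ptens_le[of "1::'a" y]
  by (simp_all add: ptens_one star_isomorphism_one[OF \<theta>] iso ptens_left_hom(2,3) ptens_right_hom(2,3)
      star_isomorphism_star[OF \<theta>] star_isomorphism_mult[OF \<theta>])

lemmas left_leg_pointwise = embedding_in_leg_pointwise[of "\<lambda>x. \<theta> (x \<otimes>\<^sub>\<gamma> 1)", OF isomorphism_leg_hom(1-5)]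
lemmas left_leg_uniform = embedding_in_leg_uniform[of "\<lambda>x. \<theta> (x \<otimes>\<^sub>\<gamma> 1)", OF isomorphism_leg_hom(1-5)]
lemmas right_leg_pointwise = embedding_in_leg_pointwise[of "\<lambda>y. \<theta> (1 \<otimes>\<^sub>\<gamma> y)", OF isomorphism_leg_hom(6,2,7-9)]
lemmas right_leg_uniform = embedding_in_leg_uniform[of "\<lambda>y. \<theta> (1 \<otimes>\<^sub>\<gamma> y)", OF isomorphism_leg_hom(6,2,7-9)]

lemma isomorphism_pure: "\<theta> (x \<otimes>\<^sub>\<gamma> y) = \<theta> (x \<otimes>\<^sub>\<gamma> 1) * \<theta> (1 \<otimes>\<^sub>\<gamma> y)"
  by (simp add: ptens_mult flip: star_isomorphism_mult[OF \<theta>])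

lemma isomorphism_scalar: "\<theta> (c *\<^sub>C 1) = c *\<^sub>C 1"
  by (simp add: clinear_scaleC[OF star_isomorphism_clinear[OF \<theta>]] star_isomorphism_one[OF \<theta>])

end

lemma isometric_isomorphism_inv:
  fixes \<theta> :: "('a::unital_cstar_algebra, 'b::unital_cstar_algebra) ptensor \<Rightarrow> ('c::unital_cstar_algebra, 'd::unital_cstar_algebra) ptensor"
  assumes \<theta>: "star_isomorphism \<theta>" and iso: "\<And>z. norm (\<theta> z) = norm z"
  shows "star_isomorphism (inv_into UNIV \<theta>)" "norm (inv_into UNIV \<theta> z) = norm z" "\<theta> (inv_into UNIV \<theta> z) = z"
proof -
  show s: "\<theta> (inv_into UNIV \<theta> z) = z" for z
    using star_isomorphism_bij[OF \<theta>] by (simp add: bij_is_surj surj_f_inv_f)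
  show "norm (inv_into UNIV \<theta> z) = norm z" using iso[of "inv_into UNIV \<theta> z"] by (simp add: s)
qed (rule star_isomorphism_inv[OF \<theta>])

text \<open>What remains is surjectivity of \<open>\<phi>\<close> and \<open>\<psi>\<close>. The inverse of \<open>\<theta>\<close> maps \<open>x \<otimes> 1\<close> into one of the legs; if it is the
wrong one, then \<open>x\<close> is a scalar.\<close>

lemma leg_preserving_isomorphism:
  fixes \<theta> :: "('a::unital_cstar_algebra, 'b::unital_cstar_algebra) ptensor \<Rightarrow> ('c::unital_cstar_algebra, 'd::unital_cstar_algebra) ptensor"
  assumes \<theta>: "star_isomorphism \<theta>" and iso: "\<And>z. norm (\<theta> z) = norm z"
    and \<phi>: "\<And>x. \<theta> (x \<otimes>\<^sub>\<gamma> 1) = \<phi> x \<otimes>\<^sub>\<gamma> 1" and \<psi>: "\<And>y. \<theta> (1 \<otimes>\<^sub>\<gamma> y) = 1 \<otimes>\<^sub>\<gamma> \<psi> y"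
  shows "star_isomorphism \<phi>" "star_isomorphism \<psi>" "\<theta> (x \<otimes>\<^sub>\<gamma> y) = \<phi> x \<otimes>\<^sub>\<gamma> \<psi> y"
proof -
  note i = isometric_isomorphism_inv[OF \<theta> iso]
  have e: "(c *\<^sub>C 1) \<otimes>\<^sub>\<gamma> 1 = (c *\<^sub>C 1 :: ('e::unital_cstar_algebra, 'f::unital_cstar_algebra) ptensor)"
    "1 \<otimes>\<^sub>\<gamma> (c *\<^sub>C 1) = (c *\<^sub>C 1 :: ('e, 'f) ptensor)" for c
    by (simp_all add: ptens_scaleC_left ptens_scaleC_right ptens_one)
  have scalar: "\<phi> (c *\<^sub>C 1) = c *\<^sub>C 1" "\<psi> (c *\<^sub>C 1) = c *\<^sub>C 1" for c
  proof -
    have "\<phi> (c *\<^sub>C 1) \<otimes>\<^sub>\<gamma> 1 = ((c *\<^sub>C 1) \<otimes>\<^sub>\<gamma> 1 :: ('c, 'd) ptensor)"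
      by (simp only: \<phi>[symmetric] e isomorphism_scalar[OF \<theta> iso])
    then show "\<phi> (c *\<^sub>C 1) = c *\<^sub>C 1" by (rule ptens_left_inj)
    have "1 \<otimes>\<^sub>\<gamma> \<psi> (c *\<^sub>C 1) = (1 \<otimes>\<^sub>\<gamma> (c *\<^sub>C 1) :: ('c, 'd) ptensor)"
      by (simp only: \<psi>[symmetric] e isomorphism_scalar[OF \<theta> iso])
    then show "\<psi> (c *\<^sub>C 1) = c *\<^sub>C 1" by (rule ptens_right_inj)
  qed
  have "surj \<phi>"
  proof -
    have "\<exists>a. x = \<phi> a" for x
      using left_leg_pointwise[OF i(1,2), of x]
    proof
      assume "\<exists>a. inv_into UNIV \<theta> (x \<otimes>\<^sub>\<gamma> 1) = a \<otimes>\<^sub>\<gamma> 1"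
      then obtain a where "inv_into UNIV \<theta> (x \<otimes>\<^sub>\<gamma> 1) = a \<otimes>\<^sub>\<gamma> 1" by blast
      then have "\<phi> a \<otimes>\<^sub>\<gamma> 1 = (x \<otimes>\<^sub>\<gamma> 1 :: ('c, 'd) ptensor)" using i(3)[of "x \<otimes>\<^sub>\<gamma> 1"] \<phi>[of a] by simp
      then have "\<phi> a = x" by (rule ptens_left_inj)
      then show ?thesis by blast
    next
      assume "\<exists>b. inv_into UNIV \<theta> (x \<otimes>\<^sub>\<gamma> 1) = 1 \<otimes>\<^sub>\<gamma> b"
      then obtain b where "inv_into UNIV \<theta> (x \<otimes>\<^sub>\<gamma> 1) = 1 \<otimes>\<^sub>\<gamma> b" by blast
      then have "x \<otimes>\<^sub>\<gamma> 1 = 1 \<otimes>\<^sub>\<gamma> \<psi> b" using i(3)[of "x \<otimes>\<^sub>\<gamma> 1"] \<psi>[of b] by simp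
      then obtain c where "x = c *\<^sub>C 1" using legs_meet_in_scalars by blast
      then show ?thesis using scalar(1)[of c] by metis
    qed
    then show ?thesis by (auto simp: surj_def)
  qed
  then show "star_isomorphism \<phi>"
    by (rule star_isomorphism_of_intertwining[where \<phi> = \<phi>, OF \<theta> ptens_left_hom ptens_left_hom \<phi>])
  have "surj \<psi>"
  proof -
    have "\<exists>b. y = \<psi> b" for y
      using right_leg_pointwise[OF i(1,2), of y]
    proof
      assume "\<exists>a. inv_into UNIV \<theta> (1 \<otimes>\<^sub>\<gamma> y) = a \<otimes>\<^sub>\<gamma> 1"
      then obtain a where "inv_into UNIV \<theta> (1 \<otimes>\<^sub>\<gamma> y) = a \<otimes>\<^sub>\<gamma> 1" by blast
      then have "\<phi> a \<otimes>\<^sub>\<gamma> 1 = 1 \<otimes>\<^sub>\<gamma> y" using i(3)[of "1 \<otimes>\<^sub>\<gamma> y"] \<phi>[of a] by simp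
      then obtain c where "y = c *\<^sub>C 1" using legs_meet_in_scalars by blast
      then show ?thesis using scalar(2)[of c] by metis
    next
      assume "\<exists>b. inv_into UNIV \<theta> (1 \<otimes>\<^sub>\<gamma> y) = 1 \<otimes>\<^sub>\<gamma> b"
      then obtain b where "inv_into UNIV \<theta> (1 \<otimes>\<^sub>\<gamma> y) = 1 \<otimes>\<^sub>\<gamma> b" by blast
      then have "1 \<otimes>\<^sub>\<gamma> \<psi> b = (1 \<otimes>\<^sub>\<gamma> y :: ('c, 'd) ptensor)" using i(3)[of "1 \<otimes>\<^sub>\<gamma> y"] \<psi>[of b] by simp
      then have "\<psi> b = y" by (rule ptens_right_inj)
      then show ?thesis by blast
    qed
    then show ?thesis by (auto simp: surj_def)
  qed
  then show "star_isomorphism \<psi>"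
    by (rule star_isomorphism_of_intertwining[where \<phi> = \<psi>, OF \<theta> ptens_right_hom ptens_right_hom \<psi>])
  show "\<theta> (x \<otimes>\<^sub>\<gamma> y) = \<phi> x \<otimes>\<^sub>\<gamma> \<psi> y"
    by (simp add: isomorphism_pure[OF \<theta> iso, of x y] \<phi> \<psi> ptens_mult)
qed

lemma leg_exchanging_isomorphism:
  fixes \<theta> :: "('a::unital_cstar_algebra, 'b::unital_cstar_algebra) ptensor \<Rightarrow> ('c::unital_cstar_algebra, 'd::unital_cstar_algebra) ptensor"
  assumes \<theta>: "star_isomorphism \<theta>" and iso: "\<And>z. norm (\<theta> z) = norm z"
    and \<rho>: "\<And>x. \<theta> (x \<otimes>\<^sub>\<gamma> 1) = 1 \<otimes>\<^sub>\<gamma> \<rho> x" and \<mu>: "\<And>y. \<theta> (1 \<otimes>\<^sub>\<gamma> y) = \<mu> y \<otimes>\<^sub>\<gamma> 1"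
  shows "star_isomorphism \<rho>" "star_isomorphism \<mu>" "\<theta> (x \<otimes>\<^sub>\<gamma> y) = \<mu> y \<otimes>\<^sub>\<gamma> \<rho> x"
proof -
  have \<theta>': "star_isomorphism (\<lambda>z. flip (\<theta> z))"
    using star_isomorphism_compose[OF flip_star_isomorphism \<theta>] by (simp add: o_def)
  have iso': "norm (flip (\<theta> z)) = norm z" for z by (simp add: norm_flip iso)
  have legs: "flip (\<theta> (x \<otimes>\<^sub>\<gamma> 1)) = \<rho> x \<otimes>\<^sub>\<gamma> 1" "flip (\<theta> (1 \<otimes>\<^sub>\<gamma> y)) = 1 \<otimes>\<^sub>\<gamma> \<mu> y" for x y
    by (simp_all add: \<rho> \<mu> flip(3))
  note p = leg_preserving_isomorphism[OF \<theta>' iso' legs]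
  show "star_isomorphism \<rho>" "star_isomorphism \<mu>" by (rule p)+
  show "\<theta> (x \<otimes>\<^sub>\<gamma> y) = \<mu> y \<otimes>\<^sub>\<gamma> \<rho> x"
    using arg_cong[OF p(3)[of x y], of flip] by (simp add: flip(3))
qed

text \<open>If \<open>y\<close> is not a scalar, some functional \<open>p \<otimes> g\<close> with \<open>g 1 = 0\<close> and \<open>g y \<noteq> 0\<close> vanishes on the range of \<open>\<theta>\<close>, which is
everything. So \<open>B\<close> consists of scalars, on which \<open>\<theta>\<close> is the identity.\<close>

lemma not_both_legs_left:
  fixes \<theta> :: "('a::unital_cstar_algebra, 'b::unital_cstar_algebra) ptensor \<Rightarrow> ('a, 'b) ptensor"
  assumes \<theta>: "star_isomorphism \<theta>" and iso: "\<And>z. norm (\<theta> z) = norm z"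
    and L: "\<And>x. \<exists>a. \<theta> (x \<otimes>\<^sub>\<gamma> 1) = a \<otimes>\<^sub>\<gamma> 1" and R: "\<And>y. \<exists>a. \<theta> (1 \<otimes>\<^sub>\<gamma> y) = a \<otimes>\<^sub>\<gamma> 1"
  shows "\<exists>b. \<theta> (1 \<otimes>\<^sub>\<gamma> y) = 1 \<otimes>\<^sub>\<gamma> b"
proof -
  have "\<exists>c. y = c *\<^sub>C 1"
  proof (rule ccontr)
    assume "\<not> ?thesis"
    then obtain g :: "'b \<Rightarrow> complex" where g: "bounded_clinear g" "g 1 = 0" "g y \<noteq> 0"
      using nonscalar_functional[of y] by blast
    obtain p :: "'a \<Rightarrow> complex" where p: "state p" using central_state_exists by blast
    note pb = state_bounded_clinear[OF p]
    have "product_functional p g (\<theta> z) = 0" for z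
    proof (rule ptensor_eqI[of "\<lambda>z. product_functional p g (\<theta> z)" "\<lambda>_. 0"])
      show "bounded_clinear (\<lambda>z. product_functional p g (\<theta> z))"
        by (rule bounded_clinear_compose[OF bounded_clinear_product_functional[OF pb g(1)] isometric_isomorphism_bounded[OF \<theta> iso]])
      show "bounded_clinear (\<lambda>_ :: ('a, 'b) ptensor. 0 :: complex)" by (rule bounded_clinearI[of _ 0]) (simp_all add: clinear_def)
      fix x y
      obtain a b where "\<theta> (x \<otimes>\<^sub>\<gamma> 1) = a \<otimes>\<^sub>\<gamma> 1" "\<theta> (1 \<otimes>\<^sub>\<gamma> y) = b \<otimes>\<^sub>\<gamma> 1" using L R by meson
      then show "product_functional p g (\<theta> (x \<otimes>\<^sub>\<gamma> y)) = 0"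
        by (simp add: isomorphism_pure[OF \<theta> iso, of x y] ptens_mult product_functional_pure[OF pb g(1)] g(2))
    qed
    from this[of "inv_into UNIV \<theta> (1 \<otimes>\<^sub>\<gamma> y)"] show False
      by (simp add: isometric_isomorphism_inv(3)[OF \<theta> iso] product_functional_pure[OF pb g(1)] state_one[OF p] g(3))
  qed
  then obtain c where "y = c *\<^sub>C 1" by blast
  then have "\<theta> (1 \<otimes>\<^sub>\<gamma> y) = 1 \<otimes>\<^sub>\<gamma> (c *\<^sub>C 1)"
    using isomorphism_scalar[OF \<theta> iso, of c] by (simp add: ptens_scaleC_right ptens_one)
  then show ?thesis by blast
qed

lemma not_both_legs_right:
  fixes \<theta> :: "('a::unital_cstar_algebra, 'b::unital_cstar_algebra) ptensor \<Rightarrow> ('a, 'b) ptensor"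
  assumes \<theta>: "star_isomorphism \<theta>" and iso: "\<And>z. norm (\<theta> z) = norm z"
    and L: "\<And>x. \<exists>b. \<theta> (x \<otimes>\<^sub>\<gamma> 1) = 1 \<otimes>\<^sub>\<gamma> b" and R: "\<And>y. \<exists>b. \<theta> (1 \<otimes>\<^sub>\<gamma> y) = 1 \<otimes>\<^sub>\<gamma> b"
  shows "\<exists>a. \<theta> (x \<otimes>\<^sub>\<gamma> 1) = a \<otimes>\<^sub>\<gamma> 1"
proof -
  have "star_isomorphism (\<lambda>z. flip (\<theta> (flip z)))"
    using star_isomorphism_compose[OF flip_star_isomorphism star_isomorphism_compose[OF \<theta> flip_star_isomorphism]]
    by (simp add: o_def)
  moreover have "norm (flip (\<theta> (flip z))) = norm z" for z by (simp add: norm_flip iso)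
  moreover have "\<exists>a. flip (\<theta> (flip (y \<otimes>\<^sub>\<gamma> 1))) = a \<otimes>\<^sub>\<gamma> 1" for y using R[of y] by (auto simp: flip(3))
  moreover have "\<exists>a. flip (\<theta> (flip (1 \<otimes>\<^sub>\<gamma> x))) = a \<otimes>\<^sub>\<gamma> 1" for x using L[of x] by (auto simp: flip(3))
  ultimately obtain a where "flip (\<theta> (flip (1 \<otimes>\<^sub>\<gamma> x))) = 1 \<otimes>\<^sub>\<gamma> a"
    using not_both_legs_left[of "\<lambda>z. flip (\<theta> (flip z))" x] by blast
  from arg_cong[OF this, of flip] show ?thesis by (auto simp: flip(3))
qed

text \<open>Each leg is mapped into a leg. If both are mapped into the same one, then one factor is trivial and the
case of preserved legs applies as well.\<close>

theorem isometric_automorphism_cases: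
  fixes \<theta> :: "('a::unital_cstar_algebra, 'b::unital_cstar_algebra) ptensor \<Rightarrow> ('a, 'b) ptensor"
  assumes \<theta>: "star_isomorphism \<theta>" and iso: "\<And>z. norm (\<theta> z) = norm z"
  shows "(\<exists>(\<phi> :: 'a \<Rightarrow> 'a) (\<psi> :: 'b \<Rightarrow> 'b). star_isomorphism \<phi> \<and> star_isomorphism \<psi> \<and> (\<forall>x y. \<theta> (x \<otimes>\<^sub>\<gamma> y) = \<phi> x \<otimes>\<^sub>\<gamma> \<psi> y)) \<or>
    (\<exists>(\<mu> :: 'b \<Rightarrow> 'a) (\<rho> :: 'a \<Rightarrow> 'b). star_isomorphism \<mu> \<and> star_isomorphism \<rho> \<and> (\<forall>x y. \<theta> (x \<otimes>\<^sub>\<gamma> y) = \<mu> y \<otimes>\<^sub>\<gamma> \<rho> x))"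
proof -
  have straight: ?thesis
    if h: "\<forall>x. \<exists>a. \<theta> (x \<otimes>\<^sub>\<gamma> 1) = a \<otimes>\<^sub>\<gamma> 1" "\<forall>y. \<exists>b. \<theta> (1 \<otimes>\<^sub>\<gamma> y) = 1 \<otimes>\<^sub>\<gamma> b"
  proof -
    obtain \<phi> where \<phi>: "\<And>x. \<theta> (x \<otimes>\<^sub>\<gamma> 1) = \<phi> x \<otimes>\<^sub>\<gamma> 1" using choice[OF h(1)] by blast
    obtain \<psi> where \<psi>: "\<And>y. \<theta> (1 \<otimes>\<^sub>\<gamma> y) = 1 \<otimes>\<^sub>\<gamma> \<psi> y" using choice[OF h(2)] by blast
    show ?thesis
      by (intro disjI1 exI[of _ \<phi>] exI[of _ \<psi>] conjI allI leg_preserving_isomorphism[OF \<theta> iso \<phi> \<psi>])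
  qed
  have crossed: ?thesis
    if h: "\<forall>x. \<exists>b. \<theta> (x \<otimes>\<^sub>\<gamma> 1) = 1 \<otimes>\<^sub>\<gamma> b" "\<forall>y. \<exists>a. \<theta> (1 \<otimes>\<^sub>\<gamma> y) = a \<otimes>\<^sub>\<gamma> 1"
  proof -
    obtain \<rho> where \<rho>: "\<And>x. \<theta> (x \<otimes>\<^sub>\<gamma> 1) = 1 \<otimes>\<^sub>\<gamma> \<rho> x" using choice[OF h(1)] by blast
    obtain \<mu> where \<mu>: "\<And>y. \<theta> (1 \<otimes>\<^sub>\<gamma> y) = \<mu> y \<otimes>\<^sub>\<gamma> 1" using choice[OF h(2)] by blast
    show ?thesis
      by (intro disjI2 exI[of _ \<mu>] exI[of _ \<rho>] conjI allI leg_exchanging_isomorphism[OF \<theta> iso \<rho> \<mu>])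
  qed
  show ?thesis
    using left_leg_uniform[OF \<theta> iso] right_leg_uniform[OF \<theta> iso]
  proof (elim disjE)
    assume L: "\<forall>x. \<exists>a. \<theta> (x \<otimes>\<^sub>\<gamma> 1) = a \<otimes>\<^sub>\<gamma> 1" and R: "\<forall>y. \<exists>a. \<theta> (1 \<otimes>\<^sub>\<gamma> y) = a \<otimes>\<^sub>\<gamma> 1"
    show ?thesis
      by (rule straight[OF L]) (use not_both_legs_left[OF \<theta> iso] L R in blast)
  next
    assume L: "\<forall>x. \<exists>b. \<theta> (x \<otimes>\<^sub>\<gamma> 1) = 1 \<otimes>\<^sub>\<gamma> b" and R: "\<forall>y. \<exists>b. \<theta> (1 \<otimes>\<^sub>\<gamma> y) = 1 \<otimes>\<^sub>\<gamma> b"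
    show ?thesis
      by (rule straight[OF _ R]) (use not_both_legs_right[OF \<theta> iso] L R in blast)
  qed (rule straight crossed; assumption)+
qed

section \<open>Outer automorphisms\<close>

lemma ptensor_map_star:
  fixes \<phi> :: "'a::unital_cstar_algebra \<Rightarrow> 'c::unital_cstar_algebra" and \<psi> :: "'b::unital_cstar_algebra \<Rightarrow> 'd::unital_cstar_algebra"
  assumes \<phi>: "star_isomorphism \<phi>" and \<psi>: "star_isomorphism \<psi>"
  shows ptensor_map_pure: "ptensor_map \<phi> \<psi> (x \<otimes>\<^sub>\<gamma> y) = \<phi> x \<otimes>\<^sub>\<gamma> \<psi> y"
    and bounded_clinear_ptensor_map: "bounded_clinear (ptensor_map \<phi> \<psi>)"
    and norm_ptensor_map_le: "norm (ptensor_map \<phi> \<psi> z) \<le> norm z"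
proof -
  have n: "norm (\<phi> x) \<le> 1 * norm x" "norm (\<psi> y) \<le> 1 * norm y" for x y
    by (simp_all add: star_isomorphism_isometric \<phi> \<psi>)
  note pm = ptensor_map[OF star_isomorphism_clinear[OF \<phi>] star_isomorphism_clinear[OF \<psi>] n zero_le_one zero_le_one]
  show p: "ptensor_map \<phi> \<psi> (x \<otimes>\<^sub>\<gamma> y) = \<phi> x \<otimes>\<^sub>\<gamma> \<psi> y" for x y by (rule pm(3))
  have "norm (ptensor_map \<phi> \<psi> (x \<otimes>\<^sub>\<gamma> y)) \<le> 1 * (norm x * norm y)" for x y
    using norm_ptens_le[of "\<phi> x" "\<psi> y"] by (simp add: p star_isomorphism_isometric \<phi> \<psi>)
  from ptensor_norm_bound[OF pm(1,2) _ this] show le: "norm (ptensor_map \<phi> \<psi> z) \<le> norm z" for z by simp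
  show "bounded_clinear (ptensor_map \<phi> \<psi>)" by (rule bounded_clinearI[OF pm(1), of 1]) (simp add: le)
qed

lemma ptensor_map_star_isomorphism:
  fixes \<phi> :: "'a::unital_cstar_algebra \<Rightarrow> 'c::unital_cstar_algebra" and \<psi> :: "'b::unital_cstar_algebra \<Rightarrow> 'd::unital_cstar_algebra"
  assumes \<phi>: "star_isomorphism \<phi>" and \<psi>: "star_isomorphism \<psi>"
  shows "star_isomorphism (ptensor_map \<phi> \<psi>)" and "norm (ptensor_map \<phi> \<psi> z) = norm z"
proof -
  define \<phi>' \<psi>' where "\<phi>' = inv_into UNIV \<phi>" and "\<psi>' = inv_into UNIV \<psi>"
  have i: "star_isomorphism \<phi>'" "star_isomorphism \<psi>'" unfolding \<phi>'_def \<psi>'_def by (rule star_isomorphism_inv[OF \<phi>] star_isomorphism_inv[OF \<psi>])+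
  have s: "\<phi> (\<phi>' x) = x" "\<psi> (\<psi>' y) = y" "\<phi>' (\<phi> u) = u" "\<psi>' (\<psi> v) = v" for x y u v
    using star_isomorphism_bij[OF \<phi>] star_isomorphism_bij[OF \<psi>]
    by (simp_all add: \<phi>'_def \<psi>'_def bij_is_surj surj_f_inv_f bij_is_inj inv_f_f)
  have id: "bounded_clinear (\<lambda>z :: ('e::unital_cstar_algebra, 'f::unital_cstar_algebra) ptensor. z)"
    by (rule bounded_clinearI[of _ 1]) (simp_all add: clinear_def)
  have inv1: "ptensor_map \<phi>' \<psi>' (ptensor_map \<phi> \<psi> z) = z" for z
    by (rule ptensor_eqI[OF bounded_clinear_compose[OF bounded_clinear_ptensor_map[OF i] bounded_clinear_ptensor_map[OF \<phi> \<psi>]] id])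
      (simp add: ptensor_map_pure[OF i] ptensor_map_pure[OF \<phi> \<psi>] s)
  have inv2: "ptensor_map \<phi> \<psi> (ptensor_map \<phi>' \<psi>' z) = z" for z
    by (rule ptensor_eqI[OF bounded_clinear_compose[OF bounded_clinear_ptensor_map[OF \<phi> \<psi>] bounded_clinear_ptensor_map[OF i]] id])
      (simp add: ptensor_map_pure[OF i] ptensor_map_pure[OF \<phi> \<psi>] s)
  have "bij (ptensor_map \<phi> \<psi>)" by (rule o_bij[of "ptensor_map \<phi>' \<psi>'"]) (auto simp: inv1 inv2)
  moreover have "ptensor_map \<phi> \<psi> (z * w) = ptensor_map \<phi> \<psi> z * ptensor_map \<phi> \<psi> w" for z w
    by (rule multiplicative_on_ptensor[OF bounded_clinear_ptensor_map[OF \<phi> \<psi>]])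
      (simp add: ptensor_map_pure[OF \<phi> \<psi>] star_isomorphism_mult[OF \<phi>] star_isomorphism_mult[OF \<psi>] ptens_mult)
  moreover have "ptensor_map \<phi> \<psi> (star z) = star (ptensor_map \<phi> \<psi> z)" for z
    by (rule star_preserving_on_ptensor[OF bounded_clinear_ptensor_map[OF \<phi> \<psi>]])
      (simp add: ptensor_map_pure[OF \<phi> \<psi>] star_isomorphism_star[OF \<phi>] star_isomorphism_star[OF \<psi>] star_ptens)
  ultimately show "star_isomorphism (ptensor_map \<phi> \<psi>)"
    using bounded_clinear_clinear[OF bounded_clinear_ptensor_map[OF \<phi> \<psi>]] by (simp add: star_isomorphism_def)
  show "norm (ptensor_map \<phi> \<psi> z) = norm z"
    using norm_ptensor_map_le[OF \<phi> \<psi>, of z] norm_ptensor_map_le[OF i, of "ptensor_map \<phi> \<psi> z"] by (simp add: inv1)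
qed

text \<open>The second claim is the first one for the flipped unitary.\<close>

lemma inner_ptensor_map_imp_inner:
  fixes \<phi> :: "'a::unital_cstar_algebra \<Rightarrow> 'a" and \<psi> :: "'b::unital_cstar_algebra \<Rightarrow> 'b"
  assumes \<phi>: "star_isomorphism \<phi>" and \<psi>: "star_isomorphism \<psi>" and inner: "inner_map (ptensor_map \<phi> \<psi>)"
  shows "inner_map \<phi>" "inner_map \<psi>"
proof -
  obtain u where u: "unitary u" "\<And>z. ptensor_map \<phi> \<psi> z = u * z * star u" using inner by (auto simp: inner_map_def)
  have uz: "u * z = ptensor_map \<phi> \<psi> z * u" for z
    using u(1) by (simp add: u(2) unitary_def mult.assoc)
  note one = star_isomorphism_one[OF \<phi>] star_isomorphism_one[OF \<psi>]
  have ul: "u * (x \<otimes>\<^sub>\<gamma> 1) = (\<phi> x \<otimes>\<^sub>\<gamma> 1) * u" and ur: "u * (1 \<otimes>\<^sub>\<gamma> y) = (1 \<otimes>\<^sub>\<gamma> \<psi> y) * u" for x y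
    by (simp_all add: uz ptensor_map_pure[OF \<phi> \<psi>] one)
  show "inner_map \<phi>" by (rule tensor_intertwiner_imp_inner[OF \<psi> u(1) ul ur])
  define v where "v = flip u"
  note F = star_isomorphism_mult[OF flip_star_isomorphism] star_isomorphism_star[OF flip_star_isomorphism]
    star_isomorphism_one[OF flip_star_isomorphism]
  have "unitary v" using u(1) unfolding unitary_def v_def by (simp flip: F(1,2)) (simp add: F(3))
  moreover have "v * (y \<otimes>\<^sub>\<gamma> 1) = (\<psi> y \<otimes>\<^sub>\<gamma> 1) * v" for y
    using arg_cong[OF ur[of y], of flip] by (simp add: v_def F flip(3))
  moreover have "v * (1 \<otimes>\<^sub>\<gamma> x) = (1 \<otimes>\<^sub>\<gamma> \<phi> x) * v" for x
    using arg_cong[OF ul[of x], of flip] by (simp add: v_def F flip(3))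
  ultimately show "inner_map \<psi>" by (rule tensor_intertwiner_imp_inner[OF \<phi>])
qed

lemma inner_ptensor_map:
  fixes \<phi> :: "'a::unital_cstar_algebra \<Rightarrow> 'a" and \<psi> :: "'b::unital_cstar_algebra \<Rightarrow> 'b"
  assumes \<phi>: "star_isomorphism \<phi>" "inner_map \<phi>" and \<psi>: "star_isomorphism \<psi>" "inner_map \<psi>"
  shows "inner_map (ptensor_map \<phi> \<psi>)"
proof -
  obtain u v where u: "unitary u" "\<And>x. \<phi> x = u * x * star u" and v: "unitary v" "\<And>x. \<psi> x = v * x * star v"
    using \<phi>(2) \<psi>(2) by (auto simp: inner_map_def)
  have "ptensor_map \<phi> \<psi> z = (u \<otimes>\<^sub>\<gamma> v) * z * star (u \<otimes>\<^sub>\<gamma> v)" for z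
    by (rule ptensor_eqI[of _ "\<lambda>z. (u \<otimes>\<^sub>\<gamma> v) * z * star (u \<otimes>\<^sub>\<gamma> v)", OF bounded_clinear_ptensor_map[OF \<phi>(1) \<psi>(1)]
          bounded_clinear_compose[OF bounded_clinear_mult_right bounded_clinear_mult_left]])
      (simp add: ptensor_map_pure[OF \<phi>(1) \<psi>(1)] star_ptens ptens_mult u(2) v(2))
  moreover have "unitary (u \<otimes>\<^sub>\<gamma> v)"
    using u(1) v(1) by (simp add: unitary_def star_ptens ptens_mult ptens_one)
  ultimately show ?thesis by (auto simp: inner_map_def)
qed

theorem corollary2p8:
  fixes \<theta> :: "('a::unital_cstar_algebra, 'b::unital_cstar_algebra) ptensor \<Rightarrow> ('a, 'b) ptensor"
  assumes "\<not> matrix_algebra TYPE('a) \<or> \<not> matrix_algebra TYPE('b)"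
  shows "(star_automorphism \<theta> \<and> (\<forall>x. norm (\<theta> x) = norm x) \<and> outer_map \<theta>) \<longleftrightarrow>
    (\<exists>(\<phi> :: 'a \<Rightarrow> 'a) (\<psi> :: 'b \<Rightarrow> 'b).
        star_automorphism \<phi> \<and> star_automorphism \<psi> \<and> (outer_map \<phi> \<or> outer_map \<psi>) \<and>
        \<theta> = ptensor_map \<phi> \<psi>) \<or>
    (\<exists>(\<mu> :: 'b \<Rightarrow> 'a) (\<rho> :: 'a \<Rightarrow> 'b).
        star_isomorphism \<mu> \<and> star_isomorphism \<rho> \<and> \<theta> = ptensor_map \<mu> \<rho> \<circ> flip)"
    (is "?lhs \<longleftrightarrow> ?straight \<or> ?crossed")
proof
  assume ?lhs
  then have \<theta>: "star_isomorphism \<theta>" and iso: "\<And>z. norm (\<theta> z) = norm z" and outer: "outer_map \<theta>" by auto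
  note \<theta>b = isometric_isomorphism_bounded[OF \<theta> iso]
  from isometric_automorphism_cases[OF \<theta> iso] show "?straight \<or> ?crossed"
  proof
    assume "\<exists>\<phi> \<psi>. star_isomorphism \<phi> \<and> star_isomorphism \<psi> \<and> (\<forall>x y. \<theta> (x \<otimes>\<^sub>\<gamma> y) = \<phi> x \<otimes>\<^sub>\<gamma> \<psi> y)"
    then obtain \<phi> \<psi> where f: "star_isomorphism \<phi>" "star_isomorphism \<psi>" "\<And>x y. \<theta> (x \<otimes>\<^sub>\<gamma> y) = \<phi> x \<otimes>\<^sub>\<gamma> \<psi> y" by blast
    have e: "\<theta> = ptensor_map \<phi> \<psi>"
      by (rule ext, rule ptensor_eqI[OF \<theta>b bounded_clinear_ptensor_map[OF f(1,2)]])
        (simp add: f(3) ptensor_map_pure[OF f(1,2)])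
    have "outer_map \<phi> \<or> outer_map \<psi>" using inner_ptensor_map[OF f(1) _ f(2)] outer e by blast
    then show ?thesis using f(1,2) e by blast
  next
    assume "\<exists>\<mu> \<rho>. star_isomorphism \<mu> \<and> star_isomorphism \<rho> \<and> (\<forall>x y. \<theta> (x \<otimes>\<^sub>\<gamma> y) = \<mu> y \<otimes>\<^sub>\<gamma> \<rho> x)"
    then obtain \<mu> \<rho> where f: "star_isomorphism \<mu>" "star_isomorphism \<rho>" "\<And>x y. \<theta> (x \<otimes>\<^sub>\<gamma> y) = \<mu> y \<otimes>\<^sub>\<gamma> \<rho> x" by blast
    have b: "bounded_clinear (\<lambda>z. ptensor_map \<mu> \<rho> (flip z))"
      by (rule bounded_clinear_compose[OF bounded_clinear_ptensor_map[OF f(1,2)] bounded_clinear_flip])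
    have "\<theta> z = ptensor_map \<mu> \<rho> (flip z)" for z
      by (rule ptensor_eqI[OF \<theta>b b]) (simp add: f(3) ptensor_map_pure[OF f(1,2)] flip(3))
    then have "\<theta> = ptensor_map \<mu> \<rho> \<circ> flip" by (simp add: fun_eq_iff)
    then show ?thesis using f(1,2) by blast
  qed
next
  assume "?straight \<or> ?crossed"
  then show ?lhs
  proof
    assume ?straight
    then obtain \<phi> \<psi> where f: "star_isomorphism \<phi>" "star_isomorphism \<psi>" "outer_map \<phi> \<or> outer_map \<psi>"
      "\<theta> = ptensor_map \<phi> \<psi>" by blast
    then show ?lhs using ptensor_map_star_isomorphism[OF f(1,2)] inner_ptensor_map_imp_inner[OF f(1,2)] by blast
  next
    assume ?crossed
    then obtain \<mu> \<rho> where f: "star_isomorphism \<mu>" "star_isomorphism \<rho>" "\<theta> = ptensor_map \<mu> \<rho> \<circ> flip" by blast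
    have "outer_map \<theta>"
    proof
      assume "inner_map \<theta>"
      then obtain u where u: "unitary u" "\<And>z. \<theta> z = u * z * star u" by (auto simp: inner_map_def)
      have "u * z = \<theta> z * u" for z using u(1) by (simp add: u(2) unitary_def mult.assoc)
      then have "u * (a \<otimes>\<^sub>\<gamma> 1) = (1 \<otimes>\<^sub>\<gamma> \<rho> a) * u" for a
        by (simp add: f(3) flip(3) ptensor_map_pure[OF f(1,2)] star_isomorphism_one[OF f(1)])
      then have A: "matrix_algebra TYPE('a)" by (rule flip_intertwiner_imp_matrix_algebra[OF f(2) u(1)])
      then show False using assms matrix_algebra_transfer[OF f(2)] by blast
    qed
    then show ?lhs
      using star_isomorphism_compose[OF ptensor_map_star_isomorphism(1)[OF f(1,2)] flip_star_isomorphism]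
      by (simp add: f(3) ptensor_map_star_isomorphism(2)[OF f(1,2)] norm_flip)
  qed
qed

end
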